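(* Let $p_0$ be a Dini-smooth boundary point of a domain $D\subset\mathbb{C}^n$. If $$\liminf_{z\to p_0}\frac{1-s_D(z)}{\delta_D(z)}=0,$$ where $s_D$ is the squeezing function of $D$ and $\delta_D(z)=\mathrm{dist}(z,\partial D)$, then $D$ is biholomorphic to the unit ball $\mathbb{B}_n\subset\mathbb{C}^n$.
   Context: The domain $D$ is not assumed bounded. $\mathcal{O}(X,Y)$ is the set of holomorphic maps from $X$ to $Y$. Squeezing function: for $z\in D$, $$s_D(z)=\sup\{r>0 : r\mathbb{B}_n\subset f(D),\ f\in\mathcal{O}(D,\mathbb{B}_n),\ f(z)=0,\ f \text{ injective}\},$$ with $s_D=0$ if $D$ is not biholomorphic to a bounded domain. The $\liminf$ is over $z\in D$; $\mathrm{dist}$ is the Euclidean distance. A boundary point $p_0$ is Dini-smooth if $\partial D$ is $\mathcal{C}^1$-smooth near $p_0$ and the inner unit normal $n_x$ to $\partial D$ at $x$ is Dini-continuous near $p_0$, i.e. for some neighborhood $U$ of $p_0$ one has $\int_0^1\frac{\omega(t)}{t}\,dt<\infty$, where $\omega(t)=\sup\{|n_x-n_y| : x,y\in\partial D\cap U,\ |x-y|<t\}$. (Thus $\mathcal{C}^{1,\varepsilon}$-smooth implies Dini-smooth, which implies $\mathcal{C}^1$-smooth.) *)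

theory Defs
  imports "HOL-Analysis.Analysis"
begin

(* C^n is complex^'n with n = CARD('n). Its norm is the Euclidean norm, "ball 0 r" is the
   Euclidean ball of radius r, and \<bullet> is the real inner product of C^n = R^(2n). *)

definition domain :: "(complex ^ 'n) set \<Rightarrow> bool" where
  "domain D \<longleftrightarrow> open D \<and> connected D \<and> D \<noteq> {}"

(* Only used for open D: Frechet differentiability with complex linear derivative. *)
definition holomorphic_map_on :: "(complex ^ 'n \<Rightarrow> complex ^ 'm) \<Rightarrow> (complex ^ 'n) set \<Rightarrow> bool" where
  "holomorphic_map_on f D \<longleftrightarrow>
     (\<forall>z\<in>D. \<exists>f'. (f has_derivative f') (at z) \<and> (\<forall>c v. f' (c *s v) = c *s f' v))"

definition biholomorphic :: "(complex ^ 'n) set \<Rightarrow> (complex ^ 'n) set \<Rightarrow> bool" where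
  "biholomorphic D E \<longleftrightarrow>
     (\<exists>f g. holomorphic_map_on f D \<and> holomorphic_map_on g E \<and> f ` D \<subseteq> E \<and> g ` E \<subseteq> D \<and>
        (\<forall>z\<in>D. g (f z) = z) \<and> (\<forall>w\<in>E. f (g w) = w))"

(* In the first case the set is nonempty for z in D and bounded above by 1. *)
definition squeezing :: "(complex ^ 'n) set \<Rightarrow> complex ^ 'n \<Rightarrow> real" where
  "squeezing D z =
     (if \<exists>E. domain E \<and> bounded E \<and> biholomorphic D E
      then Sup {r. 0 < r \<and>
                   (\<exists>f :: complex ^ 'n \<Rightarrow> complex ^ 'n.
                        holomorphic_map_on f D \<and> f ` D \<subseteq> ball 0 1 \<and> f z = 0 \<and>
                        inj_on f D \<and> ball 0 r \<subseteq> f ` D)}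
      else 0)"

(* g is the gradient of the C^1 function \<rho>. As g does not vanish on U, the boundary of D
   in U is the hypersurface {\<rho> = 0}, and D lies on one side of it. *)
definition C1_defining_function ::
  "(complex ^ 'n) set \<Rightarrow> (complex ^ 'n) set \<Rightarrow> (complex ^ 'n \<Rightarrow> real) \<Rightarrow>
   (complex ^ 'n \<Rightarrow> complex ^ 'n) \<Rightarrow> bool" where
  "C1_defining_function D U \<rho> g \<longleftrightarrow>
     open U \<and> (\<forall>x\<in>U. (\<rho> has_derivative (\<lambda>h. g x \<bullet> h)) (at x)) \<and> continuous_on U g \<and>
     (\<forall>x\<in>U. g x \<noteq> 0) \<and> D \<inter> U = {x \<in> U. \<rho> x < 0}"

definition modulus_of_continuity ::
  "(complex ^ 'n) set \<Rightarrow> (complex ^ 'n \<Rightarrow> complex ^ 'n) \<Rightarrow> real \<Rightarrow> real" where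
  "modulus_of_continuity S N t = Sup {norm (N x - N y) | x y. x \<in> S \<and> y \<in> S \<and> norm (x - y) < t}"

(* At a boundary point x in U the inner unit normal is - sgn (g x), where sgn v = v / norm v;
   it does not depend on the choice of the defining function. *)
definition dini_smooth_boundary_point :: "(complex ^ 'n) set \<Rightarrow> complex ^ 'n \<Rightarrow> bool" where
  "dini_smooth_boundary_point D p \<longleftrightarrow>
     p \<in> frontier D \<and>
     (\<exists>U \<rho> g. p \<in> U \<and> C1_defining_function D U \<rho> g \<and>
        (\<integral>\<^sup>+ t\<in>{0<..<1}.
            ennreal (modulus_of_continuity (frontier D \<inter> U) (\<lambda>x. - sgn (g x)) t / t) \<partial>lborel) < \<infinity>)"

definition boundary_dist :: "(complex ^ 'n) set \<Rightarrow> complex ^ 'n \<Rightarrow> real" where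
  "boundary_dist D z = infdist z (frontier D)"

end

theory Submission
  imports Defs "HOL-Complex_Analysis.Conformal_Mappings"
begin

text \<open>Fix \<open>a \<in> D\<close>. Near a Dini-smooth boundary point, holomorphic discs attached to the boundary
  along complex normal lines and the Schwarz lemma give \<open>1 - norm (h z) \<ge> c * boundary_dist D z\<close> for
  all holomorphic \<open>h\<close> from \<open>D\<close> to the ball with \<open>h a = 0\<close>. If \<open>f\<close> embeds \<open>D\<close> into the ball with
  \<open>f z = 0\<close> and \<open>f ` D\<close> contains the ball of radius \<open>1 - o(boundary_dist D z)\<close>, then, by this
  estimate, composing \<open>f\<close> with an automorphism of the ball that maps \<open>f a\<close> to \<open>0\<close> gives an embedding
  centred at \<open>a\<close> whose image contains a ball of radius close to \<open>1\<close>. The limit of such embeddings is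
  a biholomorphism onto the ball.\<close>

section \<open>The Hermitian product and holomorphic curves\<close>

text \<open>The bound for \<open>1 - norm (h z)\<close> is a Hopf lemma, and Hopf's lemma fails for
  general C^1 boundaries. With an inner tangent ball at each boundary point it would be the Schwarz
  lemma on a round disc. A Dini-smooth boundary has no such balls in general, so the disc is
  deformed by \<open>bend\<close>; the finite Dini integral keeps the deformation comparable to the
  identity on the real axis. The linear rate in \<open>boundary_dist D z\<close> is decisive: an
  automorphism \<open>ball_aut b\<close> magnifies the defect of a covered ball by a factor of order
  \<open>1 / (1 - norm b)\<close>, so that a defect o(\<open>boundary_dist D z\<close>) becomes
  o(1). The constant must be uniform in \<open>h\<close>, since \<open>h\<close> is built from an
  embedding that changes with \<open>z\<close>. Two obstacles remain. The squeezing function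
  supplies maps that are only injective and holomorphic, so the holomorphy of inverses has to be
  proved. And \<open>D\<close> may be unbounded, so the inverses of the embeddings are not bounded a
  priori; one embedding with a large image confines the others.\<close>

definition herm :: "complex ^ 'n \<Rightarrow> complex ^ 'n \<Rightarrow> complex" where
  "herm x y = (\<Sum>i\<in>UNIV. x $ i * cnj (y $ i))"

lemma herm_simps:
  "herm (x + y) z = herm x z + herm y z"
  "herm (x - y) z = herm x z - herm y z"
  "herm (c *s x) z = c * herm x z"
  "herm x (c *s z) = cnj c * herm x z"
  "herm 0 z = 0"
  by (simp_all add: herm_def algebra_simps sum.distrib sum_subtractf sum_distrib_left)

lemma herm_right_simps:
  "herm z (x + y) = herm z x + herm z y"
  "herm z (x - y) = herm z x - herm z y"
  "herm z 0 = 0"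
  by (simp_all add: herm_def algebra_simps sum.distrib sum_subtractf)

lemma herm_commute: "herm y x = cnj (herm x y)"
  by (simp add: herm_def mult.commute)

lemma inner_eq_Re_herm: "x \<bullet> y = Re (herm x y)"
  by (simp add: herm_def inner_vec_def inner_complex_def)

lemma herm_self: "herm x x = of_real ((norm x)\<^sup>2)"
proof -
  have "herm x x = of_real (\<Sum>i\<in>UNIV. (norm (x $ i))\<^sup>2)"
    by (simp add: herm_def complex_norm_square[symmetric])
  also have "(\<Sum>i\<in>UNIV. (norm (x $ i))\<^sup>2) = (norm x)\<^sup>2"
    by (simp add: norm_vec_def L2_set_def sum_nonneg)
  finally show ?thesis .
qed

lemma norm_smult: "norm (c *s (x :: complex ^ 'n)) = cmod c * norm x"
  by (simp add: norm_vec_def L2_set_def norm_mult power_mult_distrib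
      flip: sum_distrib_left real_sqrt_mult) (simp add: real_sqrt_mult)

lemma scaleR_eq_smult: "r *\<^sub>R x = complex_of_real r *s x"
  unfolding vec_eq_iff vector_smult_component vector_scaleR_component by (simp add: scaleR_conv_of_real)

text \<open>A unimodular factor \<open>c\<close> turns \<open>herm x y\<close> into a nonnegative
  real number, which is a real inner product, so the real Cauchy-Schwarz inequality applies.\<close>

lemma cmod_herm_le: "cmod (herm x y) \<le> norm x * norm y"
proof (cases "herm x y = 0")
  case False
  define c where "c = cnj (herm x y) / cmod (herm x y)"
  have c: "cmod c = 1" using False by (simp add: c_def norm_divide)
  have "c * herm x y = of_real (cmod (herm x y))"
    using False by (simp add: c_def complex_norm_square[symmetric] field_simps power2_eq_square)
  then have "cmod (herm x y) = (c *s x) \<bullet> y"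
    by (simp add: inner_eq_Re_herm herm_simps)
  also have "\<dots> \<le> norm (c *s x) * norm y" by (rule norm_cauchy_schwarz)
  finally show ?thesis using c by (simp add: norm_smult)
qed simp

text \<open>Vector-valued Schwarz estimates are reduced to scalar ones through this: pairing a map
  with the fixed unit vector \<open>u = sgn y\<close> gives a scalar holomorphic function whose
  value at the point of interest is the norm of \<open>y\<close>.\<close>

lemma herm_sgn: "herm x (sgn x) = of_real (norm x)"
proof -
  have "herm x (sgn x) = of_real (inverse (norm x)) * herm x x"
    by (simp add: sgn_div_norm scaleR_eq_smult herm_simps)
  then show ?thesis by (cases "x = 0") (simp_all add: herm_self power2_eq_square)
qed

section \<open>Coordinates and restriction to holomorphic curves\<close>

lemma tendsto_smult_right [tendsto_intros]:
  "(f \<longlongrightarrow> a) F \<Longrightarrow> ((\<lambda>x. (f x :: complex) *s (v :: complex ^ 'n)) \<longlongrightarrow> a *s v) F"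
  by (rule vec_tendstoI) (auto intro!: tendsto_intros)

lemma has_derivative_vecI:
  fixes f :: "'a::real_normed_vector \<Rightarrow> 'b::euclidean_space ^ 'n"
  assumes "\<And>i. ((\<lambda>x. f x $ i) has_derivative (\<lambda>h. f' h $ i)) (at x within S)"
  shows "(f has_derivative f') (at x within S)"
  unfolding has_derivative_componentwise_within[of f]
proof
  fix b :: "'b ^ 'n" assume "b \<in> Basis"
  then obtain i u where b: "b = axis i u" by (auto simp: Basis_vec_def)
  have "((\<lambda>x. f x $ i \<bullet> u) has_derivative (\<lambda>h. f' h $ i \<bullet> u)) (at x within S)"
    by (intro derivative_intros assms)
  then show "((\<lambda>x. f x \<bullet> b) has_derivative (\<lambda>h. f' h \<bullet> b)) (at x within S)"
    by (simp add: b inner_axis)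
qed

lemma has_derivative_vec_nth:
  fixes f :: "'a::real_normed_vector \<Rightarrow> 'b::real_normed_vector ^ 'n"
  assumes "(f has_derivative f') (at x within S)"
  shows "((\<lambda>x. f x $ i) has_derivative (\<lambda>h. f' h $ i)) (at x within S)"
  using bounded_linear.has_derivative[OF bounded_linear_vec_nth assms] .

lemma curve_has_derivative:
  fixes \<gamma> :: "complex \<Rightarrow> complex ^ 'n"
  assumes "open S" "\<And>i. (\<lambda>\<zeta>. \<gamma> \<zeta> $ i) holomorphic_on S" "\<zeta> \<in> S"
  obtains v where "(\<gamma> has_derivative (\<lambda>h. h *s v)) (at \<zeta>)"
proof -
  define v where "v = (\<chi> i. deriv (\<lambda>\<zeta>. \<gamma> \<zeta> $ i) \<zeta>)"
  have "((\<lambda>\<zeta>. \<gamma> \<zeta> $ i) has_derivative (\<lambda>h. (h *s v) $ i)) (at \<zeta>)" for i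
    using holomorphic_derivI[OF assms(2,1,3)]
    by (simp add: v_def has_field_derivative_def mult.commute[of _ "deriv _ _"])
  then show thesis by (intro that has_derivative_vecI)
qed

lemma holomorphic_map_on_curve:
  fixes \<gamma> :: "complex \<Rightarrow> complex ^ 'n"
  assumes f: "holomorphic_map_on f D" and "open S" "\<And>i. (\<lambda>\<zeta>. \<gamma> \<zeta> $ i) holomorphic_on S" "\<gamma> ` S \<subseteq> D"
  shows "(\<lambda>\<zeta>. f (\<gamma> \<zeta>) $ i) holomorphic_on S"
  unfolding holomorphic_on_open[OF \<open>open S\<close>]
proof
  fix \<zeta> assume \<zeta>: "\<zeta> \<in> S"
  obtain v where v: "(\<gamma> has_derivative (\<lambda>h. h *s v)) (at \<zeta>)"
    using curve_has_derivative[OF assms(2,3) \<zeta>] .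
  obtain f' where f': "(f has_derivative f') (at (\<gamma> \<zeta>))" "\<And>c v. f' (c *s v) = c *s f' v"
    using f \<zeta> assms(4) unfolding holomorphic_map_on_def by blast
  have "((\<lambda>\<zeta>. f (\<gamma> \<zeta>)) has_derivative (\<lambda>h. f' (h *s v))) (at \<zeta>)"
    using has_derivative_compose[OF v f'(1)] .
  from has_derivative_vec_nth[OF this, of i]
  show "\<exists>f'. ((\<lambda>\<zeta>. f (\<gamma> \<zeta>) $ i) has_field_derivative f') (at \<zeta>)"
    by (auto simp: f'(2) has_field_derivative_def mult.commute[of _ "f' v $ i"] intro!: exI[of _ "f' v $ i"])
qed

lemma holomorphic_map_on_line:
  assumes f: "holomorphic_map_on f D" and "open S" "\<And>\<zeta>. \<zeta> \<in> S \<Longrightarrow> z + \<zeta> *s v \<in> D"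
  shows "(\<lambda>\<zeta>. f (z + \<zeta> *s v) $ i) holomorphic_on S"
  by (rule holomorphic_map_on_curve[OF f assms(2)]) (auto intro!: holomorphic_intros assms(3))

lemma holomorphic_map_on_imp_continuous_on:
  "holomorphic_map_on f D \<Longrightarrow> continuous_on D f"
  unfolding holomorphic_map_on_def
  by (meson continuous_at_imp_continuous_on has_derivative_continuous)

lemma holomorphic_map_on_subset:
  "holomorphic_map_on f D \<Longrightarrow> E \<subseteq> D \<Longrightarrow> holomorphic_map_on f E"
  unfolding holomorphic_map_on_def by blast

lemma holomorphic_map_on_compose:
  assumes "holomorphic_map_on f D" "holomorphic_map_on g E" "f ` D \<subseteq> E"
  shows "holomorphic_map_on (\<lambda>z. g (f z)) D"
  unfolding holomorphic_map_on_def
proof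
  fix z assume "z \<in> D"
  obtain f' where f': "(f has_derivative f') (at z)" "\<And>c v. f' (c *s v) = c *s f' v"
    using assms(1) \<open>z \<in> D\<close> unfolding holomorphic_map_on_def by blast
  obtain g' where g': "(g has_derivative g') (at (f z))" "\<And>c v. g' (c *s v) = c *s g' v"
    using assms(2,3) \<open>z \<in> D\<close> unfolding holomorphic_map_on_def by blast
  show "\<exists>h'. ((\<lambda>z. g (f z)) has_derivative h') (at z) \<and> (\<forall>c v. h' (c *s v) = c *s h' v)"
    using has_derivative_compose[OF f'(1) g'(1)] f'(2) g'(2) by (intro exI conjI) auto
qed

text \<open>The maximum principle for \<open>J * k ^ N\<close>, with \<open>k\<close> the difference quotient of \<open>g\<close> at \<open>0\<close>,
  shows that the zeros of \<open>J\<close> are negligible for the Schwarz lemma. With \<open>J = 1\<close> this is the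
  usual Schwarz lemma.\<close>

lemma Schwarz_lemma_exceptional_set:
  fixes g J :: "complex \<Rightarrow> complex"
  assumes r: "0 < r" and contg: "continuous_on (cball 0 r) g" and contJ: "continuous_on (cball 0 r) J"
    and holg: "g holomorphic_on {\<zeta> \<in> ball 0 r. J \<zeta> \<noteq> 0}"
    and holJ: "J holomorphic_on {\<zeta> \<in> ball 0 r. J \<zeta> \<noteq> 0}"
    and J0: "J 0 \<noteq> 0" and bound: "\<And>\<zeta>. cmod \<zeta> = r \<Longrightarrow> cmod (g \<zeta> - g 0) \<le> M"
    and \<zeta>: "cmod \<zeta> < r" "J \<zeta> \<noteq> 0"
  shows "cmod (g \<zeta> - g 0) \<le> M * cmod \<zeta> / r"
proof -
  define \<Omega> where "\<Omega> = {\<zeta> \<in> ball 0 r. J \<zeta> \<noteq> 0}"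
  have "\<Omega> = ball 0 r \<inter> J -` (- {0})" by (auto simp: \<Omega>_def)
  moreover have "open (ball 0 r \<inter> J -` (- {0}))"
    by (rule continuous_open_preimage)
      (auto intro: continuous_on_subset[OF contJ])
  ultimately have open\<Omega>: "open \<Omega>" by simp
  have "0 \<in> \<Omega>" using J0 r by (simp add: \<Omega>_def)
  define k where "k = (\<lambda>z. if z = 0 then deriv g 0 else (g z - g 0) / (z - 0))"
  have holk: "k holomorphic_on \<Omega>"
    unfolding k_def by (rule pole_lemma_open) (use holg open\<Omega> in \<open>auto simp: \<Omega>_def\<close>)
  have M: "0 \<le> M" using bound[of "of_real r"] r
    by (metis abs_of_pos norm_ge_zero norm_of_real order_trans)
  have contk: "continuous_on (cball 0 r) k"
  proof -
    have "isCont k 0"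
      using holk open\<Omega> \<open>0 \<in> \<Omega>\<close> holomorphic_on_imp_continuous_on continuous_on_eq_continuous_at by blast
    moreover have "continuous (at z within cball 0 r) k" if "z \<in> cball 0 r" "z \<noteq> 0" for z
    proof (rule continuous_transform_within)
      have "continuous (at z within cball 0 r) g"
        using contg that by (auto simp: continuous_on_eq_continuous_within)
      then show "continuous (at z within cball 0 r) (\<lambda>z. (g z - g 0) / (z - 0))"
        using that by (intro continuous_intros) auto
      show "(g z' - g 0) / (z' - 0) = k z'" if "dist z' z < cmod z" for z'
        using that by (auto simp: k_def)
    qed (use that in auto)
    ultimately show ?thesis
      unfolding continuous_on_eq_continuous_within
      by (metis continuous_at_imp_continuous_at_within)
  qed
  have cl: "closure \<Omega> \<subseteq> cball 0 r"
    by (rule closure_minimal) (auto simp: \<Omega>_def)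
  have "bounded (J ` cball 0 r)"
    using contJ compact_cball compact_continuous_image compact_imp_bounded by blast
  then obtain C where C: "0 < C" "\<And>z. z \<in> cball 0 r \<Longrightarrow> cmod (J z) \<le> C"
    by (auto simp: bounded_pos)
  have main: "cmod (J z * k z ^ N) \<le> C * (M / r) ^ N" if N: "N > 0" and z: "z \<in> \<Omega>" for z N
  proof (rule maximum_modulus_frontier[of "\<lambda>z. J z * k z ^ N" \<Omega>])
    show "(\<lambda>z. J z * k z ^ N) holomorphic_on interior \<Omega>"
      using holk holJ open\<Omega> by (auto simp: interior_open \<Omega>_def intro!: holomorphic_intros)
    show "continuous_on (closure \<Omega>) (\<lambda>z. J z * k z ^ N)"
      using continuous_on_subset[OF contk cl] continuous_on_subset[OF contJ cl]
      by (intro continuous_intros) auto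
    show "bounded \<Omega>" by (rule bounded_subset[of "ball 0 r"]) (auto simp: \<Omega>_def)
    fix x assume x: "x \<in> frontier \<Omega>"
    then have "x \<in> cball 0 r" "x \<notin> \<Omega>"
      using cl open\<Omega> by (auto simp: frontier_def interior_open)
    show "cmod (J x * k x ^ N) \<le> C * (M / r) ^ N"
    \<comment> \<open>A frontier point of \<open>\<Omega>\<close> is a zero of \<open>J\<close>,
      where the product vanishes, or lies on the circle, where \<open>bound\<close> controls
      \<open>k\<close>.\<close>
    proof (cases "J x = 0")
      case False
      then have xr: "cmod x = r" using \<open>x \<in> cball 0 r\<close> \<open>x \<notin> \<Omega>\<close> by (auto simp: \<Omega>_def)
      then have "cmod (k x) \<le> M / r"
        using bound[OF xr] r by (auto simp: k_def norm_divide divide_right_mono)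
      then have "cmod (k x) ^ N \<le> (M / r) ^ N" by (intro power_mono) auto
      then show ?thesis using C(2)[OF \<open>x \<in> cball 0 r\<close>] C(1) r M
        by (simp add: norm_mult norm_power mult_mono)
    qed (use C M r in auto)
  qed (rule z)
  have le: "cmod (k z) \<le> M / r" if z: "z \<in> \<Omega>" for z
  proof (rule ccontr)
    assume "\<not> cmod (k z) \<le> M / r"
    then have gt: "M / r < cmod (k z)" by simp
    \<comment> \<open>This replaces taking N-th roots in \<open>main\<close>: the powers of
      \<open>q < 1\<close> eventually fall below the fixed number
      \<open>cmod (J z) / C\<close>.\<close>
    define q where "q = (M / r) / cmod (k z)"
    have kz: "cmod (k z) > 0" using gt M r by (smt (verit) divide_nonneg_pos)
    have q: "0 \<le> q" "q < 1" using gt M r kz by (auto simp: q_def field_simps)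
    have Jz: "0 < cmod (J z)" using z by (auto simp: \<Omega>_def)
    have "\<exists>N. q ^ N < cmod (J z) / C" using q Jz C by (intro real_arch_pow_inv) auto
    then obtain N where N: "q ^ N < cmod (J z) / C" by blast
    have "q ^ Suc N \<le> q ^ N" using q by (intro power_decreasing) auto
    then have "q ^ Suc N < cmod (J z) / C" using N by linarith
    then have "C * (M / r) ^ Suc N < cmod (J z) * cmod (k z) ^ Suc N"
    proof -
      have "M / r = q * cmod (k z)" using kz by (simp add: q_def)
      then have "C * (M / r) ^ Suc N = C * q ^ Suc N * cmod (k z) ^ Suc N"
        by (simp only: power_mult_distrib mult.assoc)
      also have "\<dots> < cmod (J z) * cmod (k z) ^ Suc N"
        using kz C(1) \<open>q ^ Suc N < cmod (J z) / C\<close>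
        by (intro mult_strict_right_mono) (simp_all only: pos_less_divide_eq mult.commute zero_less_power)
      finally show ?thesis .
    qed
    moreover have "cmod (J z) * cmod (k z) ^ Suc N \<le> C * (M / r) ^ Suc N"
      using main[OF _ z, of "Suc N"] by (simp only: norm_mult norm_power)
    ultimately show False by linarith
  qed
  have "\<zeta> \<in> \<Omega>" using \<zeta> by (simp add: \<Omega>_def)
  show ?thesis
  proof (cases "\<zeta> = 0")
    case False
    then show ?thesis using le[OF \<open>\<zeta> \<in> \<Omega>\<close>] r by (simp add: k_def norm_divide field_simps)
  qed auto
qed

text \<open>The previous lemma wants continuity up to the circle, so it is applied with
  \<open>J = 1\<close> on discs of radius \<open>r < R\<close>, and then \<open>r\<close> tends to
  \<open>R\<close>.\<close>

lemma Schwarz_lemma_bound: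
  assumes hol: "g holomorphic_on ball 0 R" and bound: "\<And>\<zeta>. cmod \<zeta> < R \<Longrightarrow> cmod (g \<zeta> - g 0) \<le> M"
    and \<zeta>: "cmod \<zeta> < R"
  shows "cmod (g \<zeta> - g 0) \<le> M * cmod \<zeta> / R"
proof -
  have R: "0 < R" using \<zeta> by (smt (verit) norm_ge_zero)
  have cont: "continuous_on (ball 0 R) g" using hol by (rule holomorphic_on_imp_continuous_on)
  have ev: "\<forall>\<^sub>F r in at_left R. cmod (g \<zeta> - g 0) \<le> M * cmod \<zeta> / r"
  proof (rule eventually_mono)
    show "\<forall>\<^sub>F r in at_left R. r \<in> {cmod \<zeta> <..< R}"
      using \<zeta> by (rule eventually_at_left_real)
    fix r assume r: "r \<in> {cmod \<zeta> <..< R}"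
    then have "0 < r" by (auto intro: le_less_trans[OF norm_ge_zero])
    show "cmod (g \<zeta> - g 0) \<le> M * cmod \<zeta> / r"
      by (rule Schwarz_lemma_exceptional_set[where J="\<lambda>_. 1"])
        (use r \<open>0 < r\<close> in \<open>auto intro!: bound continuous_on_subset[OF cont] holomorphic_on_subset[OF hol]\<close>)
  qed
  have "((\<lambda>r. M * cmod \<zeta> / r) \<longlongrightarrow> M * cmod \<zeta> / R) (at_left R)"
    using R by (auto intro!: tendsto_intros)
  from tendsto_lowerbound[OF this ev] show ?thesis by simp
qed

section \<open>Cauchy estimates\<close>

lemma frechet_derivative_holomorphic:
  assumes "holomorphic_map_on f D" "z \<in> D"
  shows "(f has_derivative frechet_derivative f (at z)) (at z)"
    and "frechet_derivative f (at z) (c *s v) = c *s frechet_derivative f (at z) v"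
  using assms frechet_derivative_at unfolding holomorphic_map_on_def by metis+

lemma holomorphic_map_on_diff:
  assumes "holomorphic_map_on f D" "holomorphic_map_on g D"
  shows "holomorphic_map_on (\<lambda>z. f z - g z) D"
  unfolding holomorphic_map_on_def
proof
  fix z assume "z \<in> D"
  note d = frechet_derivative_holomorphic[OF assms(1) this] frechet_derivative_holomorphic[OF assms(2) this]
  show "\<exists>h'. ((\<lambda>z. f z - g z) has_derivative h') (at z) \<and> (\<forall>c v. h' (c *s v) = c *s h' v)"
    using has_derivative_diff[OF d(1,3)] d(2,4) by (intro exI conjI) (auto simp: vector_ssub_ldistrib)
qed

lemma bounded_linear_smult: "bounded_linear (\<lambda>v :: complex ^ 'n. c *s v)"
  by (rule bounded_linear_intro[where K="cmod c"])
    (simp_all add: vec_eq_iff algebra_simps norm_smult)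

lemma holomorphic_map_on_affine: "holomorphic_map_on (\<lambda>z. c *s z + b) D"
  unfolding holomorphic_map_on_def
proof
  fix z
  have "((\<lambda>z. c *s z + b) has_derivative (\<lambda>h. c *s h)) (at z)"
    using bounded_linear.has_derivative[OF bounded_linear_smult[of c] has_derivative_ident]
    by (rule has_derivative_add_const)
  then show "\<exists>h'. ((\<lambda>z. c *s z + b) has_derivative h') (at z) \<and> (\<forall>c v. h' (c *s v) = c *s h' v)"
    by (intro exI conjI) (auto simp: mult.commute)
qed

lemma smult_sgn: "complex_of_real (norm h) *s sgn h = h"
  by (cases "h = 0") (simp_all add: sgn_div_norm scaleR_eq_smult)

lemma norm_smult_sgn: "h \<noteq> 0 \<Longrightarrow> norm (\<zeta> *s sgn h) = cmod \<zeta>"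
  by (simp add: norm_smult norm_sgn)

lemma Schwarz_lemma_map:
  assumes f: "holomorphic_map_on f (ball z R)"
    and M: "\<And>y. y \<in> ball z R \<Longrightarrow> norm (f y - f z) \<le> M" and h: "norm h < R"
  shows "norm (f (z + h) - f z) \<le> M * norm h / R"
proof (cases "h = 0")
  case False
  define u where "u = sgn (f (z + h) - f z)"
  define g where "g = (\<lambda>\<zeta>. herm (f (z + \<zeta> *s sgn h)) u)"
  have u: "norm u \<le> 1" by (simp add: u_def norm_sgn)
  have inball: "z + \<zeta> *s sgn h \<in> ball z R" if "cmod \<zeta> < R" for \<zeta>
    using False that by (simp add: dist_norm norm_smult_sgn)
  have "g holomorphic_on ball 0 R"
    unfolding g_def herm_def
    by (intro holomorphic_intros holomorphic_map_on_line[OF f]) (use inball in auto)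
  then have "cmod (g (norm h) - g 0) \<le> M * cmod (norm h) / R"
  proof (rule Schwarz_lemma_bound)
    fix \<zeta> :: complex assume "cmod \<zeta> < R"
    have "g \<zeta> - g 0 = herm (f (z + \<zeta> *s sgn h) - f z) u" by (simp add: g_def herm_simps)
    then have "cmod (g \<zeta> - g 0) \<le> norm (f (z + \<zeta> *s sgn h) - f z) * norm u"
      by (simp add: cmod_herm_le)
    also have "\<dots> \<le> norm (f (z + \<zeta> *s sgn h) - f z)"
      using u by (simp add: mult_left_le)
    also have "\<dots> \<le> M" using M[OF inball[OF \<open>cmod \<zeta> < R\<close>]] .
    finally show "cmod (g \<zeta> - g 0) \<le> M" .
  qed (use h in auto)
  moreover have "g (norm h) - g 0 = of_real (norm (f (z + h) - f z))"
    by (simp add: g_def smult_sgn u_def herm_sgn flip: herm_simps)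
  ultimately show ?thesis by simp
qed simp

text \<open>The Schwarz lemma is used twice. On the complex line through \<open>z\<close> and
  \<open>z + h\<close>, the difference quotient \<open>k\<close> of the scalar slice is bounded by
  \<open>M / R\<close>, and \<open>k 0\<close> is its derivative. Then \<open>k - k 0\<close>
  vanishes at \<open>0\<close> and is bounded by \<open>2 * M / R\<close>, so it is itself of first
  order. Pairing with the direction \<open>u\<close> of the remainder \<open>w\<close> makes the
  scalar bound a bound for \<open>norm w\<close>.\<close>

lemma second_order_bound:
  assumes f: "holomorphic_map_on f (ball z R)"
    and M: "\<And>y. y \<in> ball z R \<Longrightarrow> norm (f y - f z) \<le> M" and h: "norm h < R"
  shows "norm (f (z + h) - f z - frechet_derivative f (at z) h) \<le> 2 * M * (norm h)\<^sup>2 / R\<^sup>2"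
proof (cases "h = 0")
  case True
  have "z \<in> ball z R" using h by (smt (verit) centre_in_ball norm_ge_zero)
  from frechet_derivative_holomorphic(1)[OF f this]
  have "frechet_derivative f (at z) 0 = 0"
    using has_derivative_linear linear_0 by blast
  then show ?thesis using True by simp
next
  case False
  have R: "0 < R" using h by (smt (verit) norm_ge_zero)
  define f' where "f' = frechet_derivative f (at z)"
  have f': "(f has_derivative f') (at z)" "\<And>c v. f' (c *s v) = c *s f' v"
    using frechet_derivative_holomorphic[OF f] R by (simp_all add: f'_def)
  define w where "w = f (z + h) - f z - f' h"
  define u where "u = sgn w"
  define g where "g = (\<lambda>\<zeta>. herm (f (z + \<zeta> *s sgn h)) u)"
  define k where "k = (\<lambda>\<zeta>. if \<zeta> = 0 then deriv g 0 else (g \<zeta> - g 0) / (\<zeta> - 0))"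
  have inball: "z + \<zeta> *s sgn h \<in> ball z R" if "cmod \<zeta> < R" for \<zeta>
    using False that by (simp add: dist_norm norm_smult_sgn)
  have holg: "g holomorphic_on ball 0 R"
    unfolding g_def herm_def
    by (intro holomorphic_intros holomorphic_map_on_line[OF f]) (use inball in auto)
  then have holk: "k holomorphic_on ball 0 R"
    unfolding k_def by (rule pole_lemma_open) auto
  have gdiff: "cmod (g \<zeta> - g 0) \<le> M * cmod \<zeta> / R" if "cmod \<zeta> < R" for \<zeta>
  proof -
    have "g \<zeta> - g 0 = herm (f (z + \<zeta> *s sgn h) - f z) u" by (simp add: g_def herm_simps)
    then have "cmod (g \<zeta> - g 0) \<le> norm (f (z + \<zeta> *s sgn h) - f z) * norm u"
      by (simp add: cmod_herm_le)
    also have "\<dots> \<le> norm (f (z + \<zeta> *s sgn h) - f z)"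
      by (simp add: mult_left_le u_def norm_sgn)
    also have "\<dots> \<le> M * cmod \<zeta> / R"
      using Schwarz_lemma_map[OF f M, of "\<zeta> *s sgn h"] that False by (simp add: norm_smult_sgn)
    finally show ?thesis .
  qed
  have k1: "cmod (k \<zeta>) \<le> M / R" if "cmod \<zeta> < R" "\<zeta> \<noteq> 0" for \<zeta>
    using gdiff[OF that(1)] that by (simp add: k_def norm_divide field_simps)
  have k0: "cmod (k 0) \<le> M / R"
  proof (rule tendsto_upperbound)
    have "isCont k 0"
      using holk R holomorphic_on_imp_continuous_on continuous_on_eq_continuous_at
      by (metis centre_in_ball open_ball)
    then show "((\<lambda>\<zeta>. cmod (k \<zeta>)) \<longlongrightarrow> cmod (k 0)) (at 0)"
      by (auto simp: isCont_def intro: tendsto_norm)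
    show "\<forall>\<^sub>F \<zeta> in at 0. cmod (k \<zeta>) \<le> M / R"
      unfolding eventually_at using R by (auto intro!: exI[of _ R] k1)
  qed auto
  have "cmod (k (norm h) - k 0) \<le> 2 * M / R * cmod (norm h) / R"
  proof (rule Schwarz_lemma_bound[OF holk])
    fix \<zeta> :: complex assume "cmod \<zeta> < R"
    moreover have "0 \<le> M / R" using k0 norm_ge_zero order_trans by blast
    ultimately show "cmod (k \<zeta> - k 0) \<le> 2 * M / R"
      using k0 k1[of \<zeta>] norm_triangle_ineq4[of "k \<zeta>" "k 0"] by (cases "\<zeta> = 0") auto
  qed (use h in auto)
  then have "norm h * cmod (k (norm h) - k 0) \<le> norm h * (2 * M / R * norm h / R)"
    by (intro mult_left_mono) auto
  moreover have "norm h * cmod (k (norm h) - k 0) = norm w"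
  proof -
    have "((\<lambda>\<zeta>. f (z + \<zeta> *s sgn h)) has_derivative (\<lambda>\<zeta>. f' (\<zeta> *s sgn h))) (at 0)"
    proof (rule has_derivative_compose[where f="\<lambda>\<zeta>. z + \<zeta> *s sgn h"])
      show "((\<lambda>\<zeta>. z + \<zeta> *s sgn h) has_derivative (\<lambda>\<zeta>. \<zeta> *s sgn h)) (at 0)"
        by (rule has_derivative_vecI) (auto intro!: derivative_eq_intros)
    qed (use f' in simp)
    then have "(g has_derivative (\<lambda>\<zeta>. herm (f' (\<zeta> *s sgn h)) u)) (at 0)"
      unfolding g_def herm_def by (intro derivative_intros has_derivative_vec_nth)
    moreover have "(\<lambda>\<zeta>. herm (f' (\<zeta> *s sgn h)) u) = (*) (herm (f' (sgn h)) u)"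
      by (auto simp: f' herm_simps mult.commute)
    ultimately have "deriv g 0 = herm (f' (sgn h)) u"
      by (intro DERIV_imp_deriv) (simp add: has_field_derivative_def)
    then have "complex_of_real (norm h) * (k (norm h) - k 0)
        = herm (f (z + h)) u - herm (f z) u - herm (complex_of_real (norm h) *s f' (sgn h)) u"
      using False by (simp add: k_def g_def smult_sgn herm_simps field_simps)
    also have "\<dots> = herm w u"
      unfolding f'(2)[symmetric] smult_sgn by (simp add: w_def herm_simps)
    also have "\<dots> = of_real (norm w)" by (simp add: u_def herm_sgn)
    finally have "cmod (complex_of_real (norm h) * (k (norm h) - k 0)) = norm w" by simp
    then show ?thesis by (simp add: norm_mult)
  qed
  ultimately show ?thesis by (simp add: w_def f'_def power2_eq_square mult_ac)
qed

text \<open>Tychonoff's theorem replaces the extraction of subsequences: by passing to a finer filter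
  one gets pointwise convergence without any countability or equicontinuity assumption.\<close>

lemma pointwise_convergent_finer_filter:
  fixes f :: "'i \<Rightarrow> 'a \<Rightarrow> 'b::euclidean_space"
  assumes F: "F \<noteq> bot" and bdd: "\<And>x. \<exists>M. \<forall>\<^sub>F j in F. norm (f j x) \<le> M"
  obtains F' g where "F' \<le> F" "F' \<noteq> bot" "\<And>x. ((\<lambda>j. f j x) \<longlongrightarrow> g x) F'"
proof -
  obtain M where M: "\<And>x. \<forall>\<^sub>F j in F. norm (f j x) \<le> M x" using bdd by metis
  \<comment> \<open>Truncation puts every index, not only eventually every index, into a compact
    product. The absolute value in \<open>K\<close> keeps the default value \<open>0\<close> inside
    when \<open>M x\<close> is negative.\<close>
  define f' where "f' = (\<lambda>j x. if norm (f j x) \<le> M x then f j x else 0)"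
  define K where "K = PiE UNIV (\<lambda>x. cball (0::'b) \<bar>M x\<bar>)"
  have "compactin (product_topology (\<lambda>x. euclidean) UNIV) K"
    unfolding K_def by (subst compactin_PiE) (auto simp: compactin_euclidean_iff)
  then have "compact K" by (simp add: euclidean_product_topology compactin_euclidean_iff)
  moreover have "f' j \<in> K" for j by (auto simp: K_def f'_def)
  moreover have "filtermap f' F \<noteq> bot" using F by (simp add: filtermap_bot_iff)
  ultimately obtain g where g: "inf (nhds g) (filtermap f' F) \<noteq> bot"
    unfolding compact_filter by (metis (mono_tags) eventually_filtermap always_eventually)
  \<comment> \<open>Along this filter \<open>f'\<close> converges to the cluster point
    \<open>g\<close>; it is proper exactly because \<open>g\<close> is a cluster point.\<close>
  define F' where "F' = inf F (filtercomap f' (nhds g))"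
  have "F' \<noteq> bot"
  proof
    assume "F' = bot"
    then have "eventually (\<lambda>_. False) F'" by simp
    then obtain P Q where PQ: "eventually P F" "eventually Q (filtercomap f' (nhds g))"
      "\<And>x. P x \<Longrightarrow> Q x \<Longrightarrow> False"
      unfolding F'_def eventually_inf by auto
    obtain S where S: "eventually S (nhds g)" "\<And>x. S (f' x) \<Longrightarrow> Q x"
      using PQ(2) by (auto simp: eventually_filtercomap)
    have "eventually (\<lambda>y. \<not> S y) (filtermap f' F)"
      unfolding eventually_filtermap using PQ(1) by (rule eventually_mono) (use PQ S in blast)
    then have "eventually (\<lambda>_. False) (inf (nhds g) (filtermap f' F))"
      using S(1) unfolding eventually_inf by blast
    then show False using g by (simp add: trivial_limit_def)
  qed
  have "filterlim f' (nhds g) F'"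
    by (rule filterlim_mono[OF filterlim_filtercomap[of f' "nhds g"]]) (auto simp: F'_def)
  then have lim': "((\<lambda>j. f' j x) \<longlongrightarrow> g x) F'" for x
  proof -
    have "continuous_on UNIV (\<lambda>h :: 'a \<Rightarrow> 'b. h x)" by simp
    from continuous_on_tendsto_compose[OF this \<open>filterlim f' (nhds g) F'\<close>] show ?thesis by simp
  qed
  have "F' \<le> F" by (simp add: F'_def)
  have "((\<lambda>j. f j x) \<longlongrightarrow> g x) F'" for x
  proof (rule Lim_transform_eventually[OF lim'])
    show "\<forall>\<^sub>F j in F'. f' j x = f j x"
      using filter_leD[OF \<open>F' \<le> F\<close> M[of x]] by (rule eventually_mono) (simp add: f'_def)
  qed
  then show thesis using \<open>F' \<le> F\<close> \<open>F' \<noteq> bot\<close> that by blast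
qed

section \<open>Limits of holomorphic maps\<close>

text \<open>At \<open>norm h = R / 2\<close> the first and the second order bounds contribute
  \<open>M / 2\<close> each, and linearity rescales \<open>h\<close> to \<open>v\<close>. This
  yields the factor 2; the 3 is slack.\<close>

lemma derivative_cmult_bound:
  assumes f: "holomorphic_map_on f (ball z R)" "R > 0"
    and M: "\<And>y. y \<in> ball z R \<Longrightarrow> norm (f y - f z) \<le> M"
  shows "norm (frechet_derivative f (at z) v) \<le> 3 * M * norm v / R"
proof -
  let ?L = "frechet_derivative f (at z)"
  have "0 \<le> M" using M[of z] f by simp
  define h where "h = (R / 2) *\<^sub>R sgn v"
  show ?thesis
  proof (cases "v = 0")
    case True
    have "linear ?L" using frechet_derivative_holomorphic(1)[OF f(1)] f(2)
      by (meson centre_in_ball has_derivative_linear)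
    then show ?thesis using True by (simp add: linear_0)
  next
    case False
    have lin: "linear ?L" using frechet_derivative_holomorphic(1)[OF f(1)] f(2)
      by (meson centre_in_ball has_derivative_linear)
    have nh: "norm h = R / 2" using False f(2) by (simp add: h_def norm_sgn)
    have "norm (?L h) \<le> norm (f (z + h) - f z) + norm (f (z + h) - f z - ?L h)"
      by (metis add_diff_cancel_left' diff_add_cancel norm_triangle_ineq4 norm_minus_commute)
    also have "\<dots> \<le> M * norm h / R + 2 * M * (norm h)\<^sup>2 / R\<^sup>2"
      using nh f(2) by (intro add_mono Schwarz_lemma_map[OF f(1) M] second_order_bound[OF f(1) M]) auto
    also have "\<dots> = M" using f(2) by (simp add: nh field_simps power2_eq_square)
    finally have "norm (?L h) \<le> M" .
    moreover have "v = (2 * norm v / R) *\<^sub>R h"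
      using False f(2) by (simp add: h_def sgn_div_norm)
    then have "?L v = (2 * norm v / R) *\<^sub>R ?L h" by (metis lin linear_cmul)
    ultimately have "norm (?L v) \<le> (2 * norm v / R) * M"
      using f(2) by (auto intro!: mult_left_mono divide_right_mono)
    also have "\<dots> \<le> 3 * M * norm v / R"
      using f(2) \<open>0 \<le> M\<close> by (simp add: divide_right_mono mult_right_mono)
    finally show ?thesis .
  qed
qed

text \<open>Weierstrass' theorem from pointwise convergence and local bounds. The derivatives at
  \<open>z\<close> are bounded, so on a finer filter they converge to some \<open>L0\<close>. The
  constant in \<open>second_order_bound\<close> does not depend on the index, so the bound survives
  the limit and makes \<open>L0\<close> the derivative of \<open>f0\<close>.\<close>

lemma holomorphic_map_on_limit:
  fixes f :: "'i \<Rightarrow> complex ^ 'n \<Rightarrow> complex ^ 'm"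
  assumes F: "F \<noteq> bot"
    and bdd: "\<And>z. z \<in> D \<Longrightarrow> \<exists>R>0. \<exists>M. ball z R \<subseteq> D \<and>
      (\<forall>\<^sub>F j in F. holomorphic_map_on (f j) (ball z R) \<and> (\<forall>y\<in>ball z R. norm (f j y) \<le> M))"
    and lim: "\<And>z. z \<in> D \<Longrightarrow> ((\<lambda>j. f j z) \<longlongrightarrow> f0 z) F"
  shows "holomorphic_map_on f0 D"
  unfolding holomorphic_map_on_def
proof
  fix z assume z: "z \<in> D"
  obtain R M where R: "R > 0" "ball z R \<subseteq> D"
    and hol: "\<forall>\<^sub>F j in F. holomorphic_map_on (f j) (ball z R) \<and> (\<forall>y\<in>ball z R. norm (f j y) \<le> M)"
    using bdd[OF z] by blast
  have bd: "norm (f j y - f j z) \<le> 2 * M"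
    if "\<forall>y\<in>ball z R. norm (f j y) \<le> M" "y \<in> ball z R" for j y
    using that R norm_triangle_ineq4[of "f j y" "f j z"] by (smt (verit) centre_in_ball)
  define L where "L = (\<lambda>j. frechet_derivative (f j) (at z))"
  have "\<exists>B. \<forall>\<^sub>F j in F. norm (L j v) \<le> B" for v
  proof (intro exI)
    show "\<forall>\<^sub>F j in F. norm (L j v) \<le> 3 * (2 * M) * norm v / R"
      using hol
    proof (rule eventually_mono)
      fix j assume "holomorphic_map_on (f j) (ball z R) \<and> (\<forall>y\<in>ball z R. norm (f j y) \<le> M)"
      then show "norm (L j v) \<le> 3 * (2 * M) * norm v / R"
        unfolding L_def by (intro derivative_cmult_bound R bd) auto
    qed
  qed
  from pointwise_convergent_finer_filter[OF F, of L, OF this]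
  obtain F' L0 where F': "F' \<le> F" "F' \<noteq> bot" and L0: "\<And>v. ((\<lambda>j. L j v) \<longlongrightarrow> L0 v) F'" by metis
  note hol' = filter_leD[OF F'(1) hol]
  have lim': "((\<lambda>j. f j y) \<longlongrightarrow> f0 y) F'" if "y \<in> D" for y
    using lim[OF that] F'(1) tendsto_mono by blast
  have Leq: "L0 x = y" if "((\<lambda>j. L j x) \<longlongrightarrow> y) F'" for x y
    using tendsto_unique[OF F'(2) L0 that] .
  have der: "\<forall>\<^sub>F j in F'. (f j has_derivative L j) (at z) \<and> (\<forall>c v. L j (c *s v) = c *s L j v)"
    using hol' by (rule eventually_mono)
      (use R in \<open>auto simp: L_def intro!: frechet_derivative_holomorphic\<close>)
  have L_smult: "L0 (c *s v) = c *s L0 v" for c v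
  proof (rule Leq, rule Lim_transform_eventually)
    show "((\<lambda>j. c *s L j v) \<longlongrightarrow> c *s L0 v) F'"
      using bounded_linear.tendsto[OF bounded_linear_smult L0] .
    show "\<forall>\<^sub>F j in F'. c *s L j v = L j (c *s v)"
      using der by (rule eventually_mono) auto
  qed
  have L_add: "L0 (v + w) = L0 v + L0 w" for v w
  proof (rule Leq, rule Lim_transform_eventually)
    show "((\<lambda>j. L j v + L j w) \<longlongrightarrow> L0 v + L0 w) F'"
      by (intro tendsto_intros L0)
    show "\<forall>\<^sub>F j in F'. L j v + L j w = L j (v + w)"
      using der by (rule eventually_mono) (metis has_derivative_linear linear_add)
  qed
  have "linear L0" using L_add L_smult by (intro linearI) (auto simp: scaleR_eq_smult)
  then have "bounded_linear L0" by (simp add: linear_conv_bounded_linear)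
  define C where "C = 2 * (2 * M) / R\<^sup>2"
  have est: "norm (f0 (z + h) - f0 z - L0 h) \<le> C * (norm h)\<^sup>2" if h: "norm h < R" for h
  proof (rule tendsto_upperbound[OF _ _ F'(2)])
    have "z + h \<in> ball z R" using h by (simp add: dist_norm)
    then show "((\<lambda>j. norm (f j (z + h) - f j z - L j h)) \<longlongrightarrow> norm (f0 (z + h) - f0 z - L0 h)) F'"
      using R z by (intro tendsto_intros lim' L0) auto
    have "norm (f j (z + h) - f j z - L j h) \<le> C * (norm h)\<^sup>2"
      if "holomorphic_map_on (f j) (ball z R) \<and> (\<forall>y\<in>ball z R. norm (f j y) \<le> M)" for j
      using second_order_bound[of "f j" z R "2 * M" h] that h bd[of j]
      by (auto simp: C_def L_def)
    with hol' show "\<forall>\<^sub>F j in F'. norm (f j (z + h) - f j z - L j h) \<le> C * (norm h)\<^sup>2"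
      by (auto elim: eventually_mono)
  qed
  have "(f0 has_derivative L0) (at z)"
    unfolding has_derivative_at
  proof
    show "(\<lambda>h. norm (f0 (z + h) - f0 z - L0 h) / norm h) \<midarrow>0\<rightarrow> 0"
    proof (rule Lim_null_comparison)
      show "\<forall>\<^sub>F h in at 0. norm (norm (f0 (z + h) - f0 z - L0 h) / norm h) \<le> C * norm h"
        unfolding eventually_at
      proof (intro exI[of _ R] conjI ballI impI R)
        fix h :: "complex ^ 'n" assume "h \<noteq> 0 \<and> dist h 0 < R"
        then show "norm (norm (f0 (z + h) - f0 z - L0 h) / norm h) \<le> C * norm h"
          using est[of h] by (simp add: field_simps power2_eq_square)
      qed
      show "(\<lambda>h :: complex ^ 'n. C * norm h) \<midarrow>0\<rightarrow> 0"
        by (intro tendsto_mult_right_zero tendsto_norm_zero tendsto_ident_at)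
    qed
  qed (rule \<open>bounded_linear L0\<close>)
  then show "\<exists>f'. (f0 has_derivative f') (at z) \<and> (\<forall>c v. f' (c *s v) = c *s f' v)"
    using L_smult by blast
qed

text \<open>The difference quotients \<open>q t\<close> are holomorphic and locally bounded, and
  \<open>second_order_bound\<close> gives their convergence as \<open>t\<close> decreases to
  \<open>0\<close>; so the limit lemma applies. It is needed to see that the Jacobian is holomorphic
  along curves.\<close>

lemma holomorphic_map_on_derivative:
  fixes f :: "complex ^ 'n \<Rightarrow> complex ^ 'm"
  assumes f: "holomorphic_map_on f D" and "open D"
  shows "holomorphic_map_on (\<lambda>z. frechet_derivative f (at z) v) D"
proof (rule holomorphic_map_on_limit)
  define q where "q = (\<lambda>(t::real) y. complex_of_real (1 / t) *s (f (y + t *\<^sub>R v) - f y))"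
  fix z assume z: "z \<in> D"
  obtain e where e: "e > 0" "cball z e \<subseteq> D"
    using \<open>open D\<close> z open_contains_cball by blast
  define R where "R = e / 4"
  have R: "R > 0" "cball z (4 * R) \<subseteq> D" using e by (auto simp: R_def)
  have "compact (f ` cball z (4 * R))"
    using continuous_on_subset[OF holomorphic_map_on_imp_continuous_on[OF f] R(2)]
    by (intro compact_continuous_image) auto
  then obtain M where M: "\<And>y. y \<in> cball z (4 * R) \<Longrightarrow> norm (f y) \<le> M"
    using compact_imp_bounded bounded_iff by (metis imageI)
  have sub: "ball y (2 * R) \<subseteq> cball z (4 * R)" if "y \<in> ball z R" for y
  proof
    fix x assume "x \<in> ball y (2 * R)"
    then show "x \<in> cball z (4 * R)"
      using that R(1) dist_triangle[of z x y] by simp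
  qed
  have "z \<in> ball z R" using R by simp
  have zsub: "ball z R \<subseteq> D"
  proof
    fix x assume "x \<in> ball z R"
    then show "x \<in> D" using R by (intro subsetD[OF R(2)]) auto
  qed
  have bd: "norm (f x - f y) \<le> 2 * M" if "y \<in> ball z R" "x \<in> ball y (2 * R)" for x y
  proof -
    have "y \<in> ball y (2 * R)" using R by simp
    then have "norm (f x) \<le> M" "norm (f y) \<le> M" using M sub[OF that(1)] that(2) by blast+
    then show ?thesis using norm_triangle_ineq4[of "f x" "f y"] by linarith
  qed
  have ho: "holomorphic_map_on f (ball y (2 * R))" if "y \<in> ball z R" for y
    using holomorphic_map_on_subset[OF f] sub[OF that] R(2) by blast
  define d where "d = R / (norm v + 1)"
  have d: "d > 0" using R by (simp add: d_def add_nonneg_pos)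
  have tv: "norm (t *\<^sub>R v) < R" if "0 < t" "t < d" for t
  proof -
    have "t * (norm v + 1) < R" using that unfolding d_def by (simp add: less_divide_eq add_nonneg_pos)
    then have "t * norm v < R" using that by (simp add: algebra_simps)
    then show ?thesis using that by simp
  qed
  have ev: "\<forall>\<^sub>F t in at_right 0. 0 < t \<and> t < d"
    using d eventually_at_right_real[of 0 d] by simp
  have qb: "norm (q t y) \<le> M * norm v / R" if t: "0 < t" "t < d" and y: "y \<in> ball z R" for t y
  proof -
    have "norm (f (y + t *\<^sub>R v) - f y) \<le> (2 * M) * norm (t *\<^sub>R v) / (2 * R)"
      using Schwarz_lemma_map[OF ho[OF y] bd[OF y], of "t *\<^sub>R v"] tv[OF t] R(1) by linarith
    then have "(1 / t) * norm (f (y + t *\<^sub>R v) - f y) \<le> (1 / t) * ((2 * M) * norm (t *\<^sub>R v) / (2 * R))"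
      using t by (intro mult_left_mono) auto
    then show ?thesis unfolding q_def norm_smult using t by (simp add: norm_divide)
  qed
  have qh: "holomorphic_map_on (q t) (ball z R)" if t: "0 < t" "t < d" for t
  proof -
    have 1: "holomorphic_map_on (\<lambda>y. f (y + t *\<^sub>R v)) (ball z R)"
    proof (rule holomorphic_map_on_compose[OF _ f])
      show "holomorphic_map_on (\<lambda>y. y + t *\<^sub>R v) (ball z R)"
        using holomorphic_map_on_affine[of 1 "t *\<^sub>R v"] by simp
      have "y + t *\<^sub>R v \<in> D" if "y \<in> ball z R" for y
      proof -
        have "y + t *\<^sub>R v \<in> ball y (2 * R)" using tv[OF t] R(1) by (simp add: dist_norm)
        then show ?thesis using sub[OF that] R(2) by blast
      qed
      then show "(\<lambda>y. y + t *\<^sub>R v) ` ball z R \<subseteq> D" by blast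
    qed
    have 2: "holomorphic_map_on (\<lambda>y. f (y + t *\<^sub>R v) - f y) (ball z R)"
      by (intro holomorphic_map_on_diff 1 holomorphic_map_on_subset[OF f zsub])
    show ?thesis
      using holomorphic_map_on_compose[OF 2 holomorphic_map_on_affine[of _ 0 UNIV]]
      by (simp add: q_def)
  qed
  show "\<exists>R>0. \<exists>M. ball z R \<subseteq> D \<and> (\<forall>\<^sub>F t in at_right 0. holomorphic_map_on (q t) (ball z R) \<and>
      (\<forall>y\<in>ball z R. norm (q t y) \<le> M))"
    by (rule exI[of _ R], intro conjI exI[of _ "M * norm v / R"] R(1) zsub)
      (rule eventually_mono[OF ev], use qh qb in auto)
  let ?L = "frechet_derivative f (at z)"
  have smul: "?L (c *s w) = c *s ?L w" for c w
    using frechet_derivative_holomorphic(2)[OF f z] .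
  define C where "C = 2 * (2 * M) / (2 * R)\<^sup>2 * (norm v)\<^sup>2"
  show "((\<lambda>t. q t z) \<longlongrightarrow> ?L v) (at_right 0)"
  proof (rule LIM_zero_cancel, rule Lim_null_comparison)
    show "\<forall>\<^sub>F t in at_right 0. norm (q t z - ?L v) \<le> C * t"
      using ev
    proof (rule eventually_mono)
      fix t assume t: "0 < t \<and> t < d"
      have "norm (f (z + t *\<^sub>R v) - f z - ?L (t *\<^sub>R v)) \<le> 2 * (2 * M) * (norm (t *\<^sub>R v))\<^sup>2 / (2 * R)\<^sup>2"
        using tv[of t] t R(1) \<open>z \<in> ball z R\<close>
        by (intro second_order_bound[OF ho bd]) auto
      also have "\<dots> = C * t\<^sup>2" by (simp add: C_def power_mult_distrib)
      finally have le: "norm (f (z + t *\<^sub>R v) - f z - ?L (t *\<^sub>R v)) \<le> C * t\<^sup>2" .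
      have "?L v = complex_of_real (1 / t) *s ?L (t *\<^sub>R v)"
        using t by (simp add: scaleR_eq_smult smul vec_eq_iff)
      then have "q t z - ?L v = complex_of_real (1 / t) *s (f (z + t *\<^sub>R v) - f z - ?L (t *\<^sub>R v))"
        by (simp add: q_def vector_ssub_ldistrib)
      then have "norm (q t z - ?L v) = (1 / t) * norm (f (z + t *\<^sub>R v) - f z - ?L (t *\<^sub>R v))"
        using t by (simp only: norm_smult) (simp add: norm_divide)
      also have "\<dots> \<le> (1 / t) * (C * t\<^sup>2)" using t le by (intro mult_left_mono) auto
      also have "\<dots> = C * t" using t by (simp add: power2_eq_square)
      finally show "norm (q t z - ?L v) \<le> C * t" .
    qed
    show "((\<lambda>t. C * t) \<longlongrightarrow> 0) (at_right 0)"
      by (intro tendsto_mult_right_zero tendsto_ident_at)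
  qed
qed simp

section \<open>Inverses of injective holomorphic maps\<close>

text \<open>Sard's theorem \<open>baby_Sard\<close> lives on real coordinate spaces. The type
  \<open>'n bit0\<close> has twice as many elements as \<open>'n\<close>, so
  \<open>real ^ 'n bit0\<close> is a real-linear copy of \<open>complex ^ 'n\<close>; a negligible
  set there has empty interior.\<close>

lemma interior_singular_image:
  fixes f :: "complex ^ 'n \<Rightarrow> complex ^ 'n"
  assumes der: "\<And>x. x \<in> S \<Longrightarrow> (f has_derivative f' x) (at x)" and sing: "\<And>x. x \<in> S \<Longrightarrow> \<not> inj (f' x)"
  shows "interior (f ` S) = {}"
proof -
  have "DIM(real ^ 'n bit0) = DIM(complex ^ 'n)" by simp
  from isomorphisms_UNIV_UNIV[OF this]
  obtain T :: "real ^ 'n bit0 \<Rightarrow> complex ^ 'n" and T' where T: "linear T" "linear T'"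
    "\<And>x. T' (T x) = x" "\<And>y. T (T' y) = y" by metis
  define h where "h = (\<lambda>x. T' (f (T x)))"
  have bl: "bounded_linear T" "bounded_linear T'" using T by (simp_all add: linear_conv_bounded_linear)
  have "negligible (h ` (T' ` S))"
  proof (rule baby_Sard)
    fix x assume "x \<in> T' ` S"
    then have x: "T x \<in> S" using T by auto
    have "((\<lambda>x. f (T x)) has_derivative (\<lambda>v. f' (T x) (T v))) (at x)"
      by (rule has_derivative_compose[OF bounded_linear_imp_has_derivative[OF bl(1)] der[OF x]])
    from bounded_linear.has_derivative[OF bl(2) this]
    have d: "(h has_derivative (\<lambda>v. T' (f' (T x) (T v)))) (at x)" unfolding h_def .
    then show "(h has_derivative (\<lambda>v. T' (f' (T x) (T v)))) (at x within T' ` S)"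
      by (rule has_derivative_at_withinI)
    have "\<not> inj (\<lambda>v. T' (f' (T x) (T v)))"
    proof
      assume inj: "inj (\<lambda>v. T' (f' (T x) (T v)))"
      have "inj (f' (T x))"
      proof (rule injI)
        fix a b assume "f' (T x) a = f' (T x) b"
        then have "T' (f' (T x) (T (T' a))) = T' (f' (T x) (T (T' b)))" by (simp add: T)
        then have "T' a = T' b" by (rule injD[OF inj])
        then show "a = b" by (metis T(4))
      qed
      then show False using sing[OF x] by blast
    qed
    moreover have "(*v) (matrix (\<lambda>v. T' (f' (T x) (T v)))) = (\<lambda>v. T' (f' (T x) (T v)))"
      using has_derivative_linear[OF d] by (auto simp: matrix_vector_mul)
    ultimately show "rank (matrix (\<lambda>v. T' (f' (T x) (T v)))) < CARD('n bit0)"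
      by (subst less_rank_noninjective) simp
  qed simp
  moreover have "h ` (T' ` S) = T' ` (f ` S)" by (auto simp: h_def T image_image)
  ultimately have neg: "negligible (T' ` (f ` S))" by simp
  have "open (T -` interior (f ` S))"
    by (intro open_vimage linear_continuous_on bl(1) open_interior)
  moreover have "T -` interior (f ` S) \<subseteq> T' ` (f ` S)"
  proof
    fix x assume "x \<in> T -` interior (f ` S)"
    then have "T x \<in> f ` S" using interior_subset by blast
    then have "T' (T x) \<in> T' ` (f ` S)" by (rule imageI)
    then show "x \<in> T' ` (f ` S)" by (simp only: T(3))
  qed
  ultimately have "T -` interior (f ` S) = {}"
    using neg negligible_subset open_not_negligible by blast
  moreover have "T' y \<in> T -` interior (f ` S)" if "y \<in> interior (f ` S)" for y
    using that by (simp add: T(4))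
  ultimately show ?thesis by blast
qed

text \<open>The complex determinant, unlike the real one, is a polynomial in the complex partial
  derivatives. Hence it is holomorphic, as the function \<open>J\<close> in
  \<open>Schwarz_lemma_exceptional_set\<close> has to be.\<close>

lemma det_derivative_nz_iff:
  fixes f' :: "complex ^ 'n \<Rightarrow> complex ^ 'n"
  assumes "linear f'" "\<And>c v. f' (c *s v) = c *s f' v"
  shows "det (matrix f') \<noteq> 0 \<longleftrightarrow> inj f'"
  by (rule det_nz_iff_inj_gen) (use assms in \<open>unfold_locales, auto simp: linear_add\<close>)

text \<open>Osgood's theorem. The inverse \<open>G\<close> is continuous by invariance of domain and holomorphic off
  the closed nowhere dense set of critical values. On a complex line, the Jacobian of \<open>f\<close> along \<open>G\<close>
  serves as the exceptional function in the Schwarz lemma, so \<open>G\<close> is locally Lipschitz, whence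
  there are no critical values at all.\<close>

theorem injective_holomorphic_map_inverse:
  fixes f :: "complex ^ 'n \<Rightarrow> complex ^ 'n"
  assumes f: "holomorphic_map_on f D" and D: "open D" and inj: "inj_on f D"
  shows "open (f ` D)" "holomorphic_map_on (inv_into D f) (f ` D)"
proof -
  define E where "E = f ` D"
  define G where "G = inv_into D f"
  define L where "L = (\<lambda>z. frechet_derivative f (at z))"
  define J where "J = (\<lambda>z. det (matrix (L z)))"
  have contf: "continuous_on D f" by (rule holomorphic_map_on_imp_continuous_on[OF f])
  show "open (f ` D)" by (rule invariance_of_domain[OF contf D inj])
  then have E: "open E" by (simp add: E_def)
  have GD: "G w \<in> D" "f (G w) = w" if "w \<in> E" for w
    using that by (auto simp: E_def G_def inv_into_into f_inv_into_f)
  have Gf: "G (f z) = z" if "z \<in> D" for z using that inj by (simp add: G_def)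
  have contG: "continuous_on E G"
    unfolding E_def by (rule continuous_on_inverse_open[OF D contf]) (use Gf in auto)
  have L: "(f has_derivative L z) (at z)" "linear (L z)" "L z (c *s v) = c *s L z v" if "z \<in> D" for z c v
    using frechet_derivative_holomorphic[OF f that] has_derivative_linear by (auto simp: L_def)
  have Jinj: "J z \<noteq> 0 \<longleftrightarrow> inj (L z)" if "z \<in> D" for z
    unfolding J_def using L[OF that] by (intro det_derivative_nz_iff) auto
  have holL: "holomorphic_map_on (\<lambda>z. L z v) D" for v
    unfolding L_def by (rule holomorphic_map_on_derivative[OF f D])
  have contJ: "continuous_on D J"
    unfolding J_def det_def matrix_def
    using bounded_linear.continuous_on[OF bounded_linear_vec_nth holomorphic_map_on_imp_continuous_on[OF holL]]
    by (intro continuous_on_sum continuous_on_mult continuous_on_prod continuous_on_const) simp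
  define Reg where "Reg = {w \<in> E. J (G w) \<noteq> 0}"
  have contJG: "continuous_on E (\<lambda>w. J (G w))"
    by (rule continuous_on_compose2[OF contJ contG]) (use GD in auto)
  have "Reg = E \<inter> (\<lambda>w. J (G w)) -` (- {0})" by (auto simp: Reg_def)
  then have "open Reg" using continuous_open_preimage[OF contJG E] by auto
  have holG: "holomorphic_map_on G Reg"
    unfolding holomorphic_map_on_def
  proof
    fix w assume "w \<in> Reg"
    then have w: "w \<in> E" and injL: "inj (L (G w))" using Jinj GD by (auto simp: Reg_def)
    note Lw = L[OF GD(1)[OF w]]
    obtain g' where g': "linear g'" "g' \<circ> L (G w) = id"
      using linear_injective_left_inverse[OF Lw(2) injL] by blast
    have "(G has_derivative g') (at w)"
    proof (rule has_derivative_inverse_basic[where f = f and g = G and y = w, OF Lw(1) _ g'(2) _ E w])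
      show "continuous (at w) G" using contG E w continuous_on_eq_continuous_at by blast
    qed (use g' GD in \<open>auto simp: linear_conv_bounded_linear\<close>)
    moreover have "g' (c *s v) = c *s g' v" for c v
    proof -
      obtain u where u: "v = L (G w) u"
        using linear_injective_imp_surjective[OF Lw(2) injL] by (metis surjD)
      have "c *s v = L (G w) (c *s u)" using Lw(3) u by simp
      then show ?thesis using g'(2) u by (metis comp_apply id_apply)
    qed
    ultimately show "\<exists>f'. (G has_derivative f') (at w) \<and> (\<forall>c v. f' (c *s v) = c *s f' v)" by blast
  qed
  have lip: "\<exists>R>0. \<exists>C. C-lipschitz_on (ball w0 R) G \<and> ball w0 R \<subseteq> E" if w0: "w0 \<in> E" for w0
  proof -
    obtain e where e: "e > 0" "cball w0 e \<subseteq> E" using E w0 open_contains_cball by blast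
    define R where "R = e / 4"
    have R: "R > 0" and RE: "cball w0 (4 * R) \<subseteq> E" using e by (auto simp: R_def)
    have "compact (G ` cball w0 (4 * R))"
      using continuous_on_subset[OF contG RE] by (intro compact_continuous_image) auto
    then obtain M where M: "\<And>y. y \<in> cball w0 (4 * R) \<Longrightarrow> norm (G y) \<le> M"
      using compact_imp_bounded bounded_iff by (metis imageI)
    have "0 \<le> M" using M[of w0] R by (smt (verit) centre_in_cball norm_ge_zero)
    define A where "A = Reg \<inter> ball w0 R"
    \<comment> \<open>Both endpoints are regular values, so \<open>J\<close> does not vanish there,
      while the complex line joining them may meet critical values in between.\<close>
    have bound: "norm (G w' - G w) \<le> 2 * M * norm (w' - w) / (2 * R)" if w: "w \<in> A" and w': "w' \<in> A" for w w'
    proof (cases "w = w'")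
      case False
      define v where "v = sgn (w' - w)"
      have nv: "norm v = 1" using False by (simp add: v_def norm_sgn)
      define u where "u = sgn (G w' - G w)"
      define \<gamma> where "\<gamma> = (\<lambda>\<zeta>. G (w + \<zeta> *s v))"
      define \<Omega> where "\<Omega> = {\<zeta> \<in> ball 0 (2 * R). J (\<gamma> \<zeta>) \<noteq> 0}"
      have inb: "w + \<zeta> *s v \<in> cball w0 (4 * R)" if "\<zeta> \<in> cball 0 (2 * R)" for \<zeta>
      proof -
        have "dist w (w + \<zeta> *s v) \<le> 2 * R" using that nv by (simp add: dist_norm norm_smult)
        moreover have "dist w0 w < R" using w by (simp add: A_def)
        ultimately show ?thesis using dist_triangle[of w0 "w + \<zeta> *s v" w] R by simp
      qed
      have line: "continuous_on X (\<lambda>\<zeta>. w + \<zeta> *s v)" for X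
        unfolding continuous_on_def by (auto intro!: tendsto_intros)
      have cont\<gamma>: "continuous_on (cball 0 (2 * R)) \<gamma>"
        unfolding \<gamma>_def by (rule continuous_on_compose2[OF contG line]) (use inb RE in auto)
      have contJ\<gamma>: "continuous_on (cball 0 (2 * R)) (\<lambda>\<zeta>. J (\<gamma> \<zeta>))"
        unfolding \<gamma>_def by (rule continuous_on_compose2[OF contJG line]) (use inb RE in auto)
      have "\<Omega> = ball 0 (2 * R) \<inter> (\<lambda>\<zeta>. J (\<gamma> \<zeta>)) -` (- {0})" by (auto simp: \<Omega>_def)
      moreover have "open (ball 0 (2 * R) \<inter> (\<lambda>\<zeta>. J (\<gamma> \<zeta>)) -` (- {0}))"
        by (rule continuous_open_preimage) (auto intro: continuous_on_subset[OF contJ\<gamma>])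
      ultimately have open\<Omega>: "open \<Omega>" by simp
      have \<Omega>Reg: "w + \<zeta> *s v \<in> Reg" if "\<zeta> \<in> \<Omega>" for \<zeta>
        using that inb[of \<zeta>] RE by (auto simp: \<Omega>_def Reg_def \<gamma>_def)
      have hol\<gamma>: "(\<lambda>\<zeta>. \<gamma> \<zeta> $ i) holomorphic_on \<Omega>" for i
        unfolding \<gamma>_def by (rule holomorphic_map_on_line[OF holG open\<Omega> \<Omega>Reg])
      have \<gamma>D: "\<gamma> ` \<Omega> \<subseteq> D" using \<Omega>Reg GD by (auto simp: \<gamma>_def Reg_def)
      have holJ: "(\<lambda>\<zeta>. J (\<gamma> \<zeta>)) holomorphic_on \<Omega>"
        unfolding J_def det_def matrix_def
        by (auto intro!: holomorphic_intros holomorphic_map_on_curve[OF holL open\<Omega> hol\<gamma> \<gamma>D])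
      define g where "g = (\<lambda>\<zeta>. herm (\<gamma> \<zeta>) u)"
      have "cmod (g (norm (w' - w)) - g 0) \<le> 2 * M * cmod (norm (w' - w)) / (2 * R)"
      proof (rule Schwarz_lemma_exceptional_set[where J = "\<lambda>\<zeta>. J (\<gamma> \<zeta>)"])
        show "continuous_on (cball 0 (2 * R)) g"
          unfolding g_def herm_def by (intro continuous_intros cont\<gamma>)
        show "g holomorphic_on {\<zeta> \<in> ball 0 (2 * R). J (\<gamma> \<zeta>) \<noteq> 0}"
          unfolding g_def herm_def using hol\<gamma> by (auto simp: \<Omega>_def intro!: holomorphic_intros)
        show "(\<lambda>\<zeta>. J (\<gamma> \<zeta>)) holomorphic_on {\<zeta> \<in> ball 0 (2 * R). J (\<gamma> \<zeta>) \<noteq> 0}"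
          using holJ by (simp add: \<Omega>_def)
        show "J (\<gamma> 0) \<noteq> 0" using w by (simp add: \<gamma>_def A_def Reg_def)
        have "w' = w + complex_of_real (norm (w' - w)) *s v" by (simp add: v_def smult_sgn)
        then show "J (\<gamma> (complex_of_real (norm (w' - w)))) \<noteq> 0"
          using w' by (simp add: \<gamma>_def A_def Reg_def)
        show "cmod (complex_of_real (norm (w' - w))) < 2 * R"
          using w w' dist_triangle_less_add[of w' w0 R w R] by (simp add: A_def dist_norm norm_minus_commute)
        fix \<zeta> assume "cmod \<zeta> = 2 * R"
        have "cmod (g \<zeta> - g 0) \<le> norm (\<gamma> \<zeta> - \<gamma> 0) * norm u"
          using cmod_herm_le[of "\<gamma> \<zeta> - \<gamma> 0" u] by (simp add: g_def herm_simps)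
        also have "\<dots> \<le> norm (\<gamma> \<zeta> - \<gamma> 0)" by (simp add: mult_left_le u_def norm_sgn)
        also have "\<dots> \<le> norm (\<gamma> \<zeta>) + norm (\<gamma> 0)" by (rule norm_triangle_ineq4)
        also have "\<dots> \<le> M + M"
          unfolding \<gamma>_def using \<open>cmod \<zeta> = 2 * R\<close> R by (intro add_mono M inb) auto
        finally show "cmod (g \<zeta> - g 0) \<le> 2 * M" by simp
      qed (use contJ\<gamma> R in auto)
      moreover have "g (norm (w' - w)) - g 0 = of_real (norm (G w' - G w))"
        by (simp add: g_def \<gamma>_def u_def v_def smult_sgn herm_sgn flip: herm_simps)
      ultimately show ?thesis by simp
    qed simp
    have "(2 * M / (2 * R))-lipschitz_on A G"
      using bound R \<open>0 \<le> M\<close> by (auto intro!: lipschitz_onI simp: dist_norm norm_minus_commute)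
    moreover have "closure A \<subseteq> cball w0 (4 * R)"
      by (rule closure_minimal) (use R in \<open>auto simp: A_def\<close>)
    ultimately have "(2 * M / (2 * R))-lipschitz_on (closure A) G"
      using RE by (intro lipschitz_on_closure continuous_on_subset[OF contG]) auto
    \<comment> \<open>Otherwise a nonempty open set would consist of critical values, against
      \<open>interior_singular_image\<close>. Density carries the Lipschitz bound from
      \<open>A\<close> to the whole ball.\<close>
    moreover have "ball w0 R \<subseteq> closure A"
    proof
      fix w assume w: "w \<in> ball w0 R"
      show "w \<in> closure A"
      proof (rule ccontr)
        assume "w \<notin> closure A"
        define W where "W = ball w0 R - closure A"
        have "W \<subseteq> f ` {z \<in> D. J z = 0}"
        proof
          fix x assume x: "x \<in> W"
          then have "x \<in> E" using RE R by (auto simp: W_def)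
          moreover have "x \<notin> Reg" using x closure_subset[of A] by (auto simp: W_def A_def)
          ultimately show "x \<in> f ` {z \<in> D. J z = 0}"
            using GD[of x] by (auto simp: Reg_def intro!: image_eqI[of _ _ "G x"])
        qed
        moreover have "open W" "w \<in> W" using w \<open>w \<notin> closure A\<close> by (auto simp: W_def)
        moreover have "interior (f ` {z \<in> D. J z = 0}) = {}"
          by (rule interior_singular_image[where f' = L]) (use L(1) Jinj in blast)+
        ultimately have "w \<in> interior (f ` {z \<in> D. J z = 0})" by (intro interiorI)
        then show False using \<open>interior (f ` {z \<in> D. J z = 0}) = {}\<close> by simp
      qed
    qed
    ultimately have "(2 * M / (2 * R))-lipschitz_on (ball w0 R) G" by (rule lipschitz_on_subset)
    moreover have "ball w0 R \<subseteq> E" using RE R by auto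
    ultimately show ?thesis using R by blast
  qed
  have "E \<subseteq> Reg"
  proof
    fix w assume w: "w \<in> E"
    obtain R C where R: "R > 0" and C: "C-lipschitz_on (ball w R) G" "ball w R \<subseteq> E" using lip[OF w] by blast
    have C0: "0 \<le> C" using C lipschitz_on_nonneg by blast
    define z where "z = G w"
    have z: "z \<in> D" "f z = w" using GD w by (auto simp: z_def)
    have "v = 0" if v: "L z v = 0" for v
    proof (rule ccontr)
      assume "v \<noteq> 0"
      \<comment> \<open>If the derivative kills \<open>v\<close>, then \<open>f\<close> moves
        \<open>z + s *\<^sub>R v\<close> only by o(s), while the Lipschitz bound for
        \<open>G\<close> demands a movement of order s. This \<open>\<epsilon>\<close> makes
        \<open>C * \<epsilon>\<close> at most 1/2, which suffices for a contradiction.\<close>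
      define \<epsilon> where "\<epsilon> = 1 / (2 * (C + 1))"
      have "\<epsilon> > 0" using C0 by (simp add: \<epsilon>_def)
      then obtain d where d: "d > 0" "\<And>y. norm (y - z) < d \<Longrightarrow> norm (f y - f z - L z (y - z)) \<le> \<epsilon> * norm (y - z)"
        using L(1)[OF z(1)] unfolding has_derivative_at_alt by blast
      have "isCont f z" using L(1)[OF z(1)] by (rule has_derivative_continuous)
      then obtain d2 where d2: "d2 > 0" "\<And>y. dist y z < d2 \<Longrightarrow> dist (f y) (f z) < R"
        unfolding continuous_at_eps_delta using R by blast
      obtain d3 where d3: "d3 > 0" "ball z d3 \<subseteq> D" using D z open_contains_ball by blast
      define s where "s = min d (min d2 d3) / (2 * norm v)"
      have s: "s > 0" using d d2 d3 \<open>v \<noteq> 0\<close> by (simp add: s_def)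
      define y where "y = z + s *\<^sub>R v"
      have ny: "norm (y - z) = min d (min d2 d3) / 2"
        using s d(1) d2(1) d3(1) \<open>v \<noteq> 0\<close> by (simp add: y_def s_def)
      have y: "norm (y - z) < d" "dist y z < d2" "y \<in> D" "0 < norm (y - z)"
        using ny d(1) d2(1) d3 by (auto simp: dist_norm norm_minus_commute intro!: subsetD[OF d3(2)])
      have "L z (y - z) = 0" using v L(2)[OF z(1)] by (simp add: y_def linear_cmul)
      then have "norm (f y - f z) \<le> \<epsilon> * norm (y - z)" using d(2)[OF y(1)] by simp
      moreover have "norm (y - z) \<le> C * norm (f y - f z)"
      proof -
        have "f y \<in> ball w R" "f z \<in> ball w R" using d2(2)[OF y(2)] z R by (auto simp: dist_commute)
        from lipschitz_onD[OF C(1) this] show ?thesis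
          unfolding Gf[OF y(3)] Gf[OF z(1)] by (simp add: dist_norm)
      qed
      ultimately have "norm (y - z) \<le> C * (\<epsilon> * norm (y - z))"
        using C0 by (meson mult_left_mono order_trans)
      also have "\<dots> = (C * \<epsilon>) * norm (y - z)" by simp
      also have "C * \<epsilon> \<le> 1 / 2" using C0 by (simp add: \<epsilon>_def field_simps)
      finally show False using y(4) by (simp add: mult_right_mono)
    qed
    then have "inj (L z)" using L(2)[OF z(1)] by (simp add: linear_injective_0)
    then show "w \<in> Reg" using Jinj z w by (auto simp: Reg_def z_def)
  qed
  then show "holomorphic_map_on (inv_into D f) (f ` D)"
    using holomorphic_map_on_subset[OF holG] by (simp add: E_def G_def)
qed

section \<open>Automorphisms of the ball\<close>

text \<open>The standard involution of the ball that exchanges \<open>0\<close> and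
  \<open>b\<close>. With P the orthogonal projection onto the line of \<open>b\<close> it usually
  reads (b - P w - s (w - P w)) / (1 - <w,b>). Since (1 - s) / |b|^2 = 1 / (1 + s), the division by
  |b|^2 disappears and \<open>b = 0\<close> is no special case.\<close>

definition ball_aut :: "complex ^ 'n \<Rightarrow> complex ^ 'n \<Rightarrow> complex ^ 'n" where
  "ball_aut b w = (let s = complex_of_real (sqrt (1 - (norm b)\<^sup>2)) in
     (1 / (1 - herm w b)) *s ((1 - herm w b / (1 + s)) *s b - s *s w))"

lemma one_minus_herm_nz:
  assumes "norm b < 1" "norm w < 1"
  shows "1 - herm w b \<noteq> 0"
proof
  assume "1 - herm w b = 0"
  then have "cmod (herm w b) = 1" by simp
  moreover have "cmod (herm w b) \<le> norm w * norm b" by (rule cmod_herm_le)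
  moreover have "norm w * norm b \<le> norm w" using assms by (simp add: mult_left_le)
  ultimately show False using assms by linarith
qed

lemma sqrt_norm_facts:
  fixes b :: "complex ^ 'n"
  assumes "norm b < 1"
  defines "s \<equiv> complex_of_real (sqrt (1 - (norm b)\<^sup>2))"
  shows "s \<noteq> 0" "1 + s \<noteq> 0" "s\<^sup>2 = 1 - herm b b" "cnj s = s"
proof -
  have 1: "1 - (norm b)\<^sup>2 > 0" using assms(1) by (simp add: power_less_one_iff abs_square_less_1)
  then show "s \<noteq> 0" by (simp add: s_def)
  have "1 + sqrt (1 - (norm b)\<^sup>2) > 0" using 1 by (simp add: add_pos_pos)
  then show "1 + s \<noteq> 0" unfolding s_def by (metis of_real_1 of_real_add of_real_eq_0_iff less_irrefl)
  show "s\<^sup>2 = 1 - herm b b" using 1 unfolding s_def herm_self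
    by (metis less_imp_le of_real_1 of_real_diff of_real_power real_sqrt_pow2)
qed (simp add: s_def)

lemma one_minus_norm_ball_aut:
  assumes b: "norm b < 1" and w: "norm w < 1"
  shows "1 - (norm (ball_aut b w))\<^sup>2 = (1 - (norm b)\<^sup>2) * (1 - (norm w)\<^sup>2) / (cmod (1 - herm w b))\<^sup>2"
proof -
  define s where "s = complex_of_real (sqrt (1 - (norm b)\<^sup>2))"
  note s = sqrt_norm_facts[OF b, folded s_def]
  define c where "c = herm w b"
  \<comment> \<open>With \<open>t\<close> as a variable tied by \<open>t * (1 + s) = 1\<close>, and
    \<open>herm b b = 1 - s * s\<close>, the claim becomes a polynomial identity.\<close>
  define t where "t = 1 / (1 + s)"
  have t: "t * (1 + s) = 1" "cnj t = t" using s by (simp_all add: t_def)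
  have c: "1 - c \<noteq> 0" using one_minus_herm_nz[OF b w] by (simp add: c_def)
  have c': "herm b w = cnj c" unfolding c_def by (rule herm_commute)
  define N where "N = (1 - c * t) *s b - s *s w"
  have N: "ball_aut b w = (1 / (1 - c)) *s N"
    by (simp add: ball_aut_def N_def c_def s_def t_def Let_def)
  have "herm N N = (1 - c * t) * (1 - cnj c * t) * herm b b - (1 - c * t) * s * cnj c
      - s * (1 - cnj c * t) * c + s * s * herm w w"
    unfolding N_def by (simp add: herm_simps herm_right_simps c' t s flip: c_def) (simp add: algebra_simps)
  moreover have "herm b b = 1 - s * s" using s by (simp add: power2_eq_square)
  ultimately have "herm N N = (1 - c) * (1 - cnj c) - (1 - herm b b) * (1 - herm w w)"
    using t(1) by algebra
  moreover have "(complex_of_real (cmod (1 - c)))\<^sup>2 = (1 - c) * (1 - cnj c)"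
    using complex_norm_square[of "1 - c"] by simp
  ultimately have "complex_of_real ((norm N)\<^sup>2) =
      of_real ((cmod (1 - c))\<^sup>2 - (1 - (norm b)\<^sup>2) * (1 - (norm w)\<^sup>2))"
    by (simp add: herm_self)
  then have "(norm N)\<^sup>2 = (cmod (1 - c))\<^sup>2 - (1 - (norm b)\<^sup>2) * (1 - (norm w)\<^sup>2)"
    unfolding of_real_eq_iff .
  then show ?thesis
    using c unfolding N norm_smult by (simp add: norm_divide power_divide power_mult_distrib field_simps flip: c_def)
qed

lemma ball_aut_in_ball:
  assumes "norm b < 1" "norm w < 1"
  shows "norm (ball_aut b w) < 1"
proof -
  have "0 < (1 - (norm b)\<^sup>2) * (1 - (norm w)\<^sup>2) / (cmod (1 - herm w b))\<^sup>2"
    using assms one_minus_herm_nz[OF assms] by (intro divide_pos_pos mult_pos_pos) (simp_all add: power_less_one_iff abs_square_less_1)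
  then have "(norm (ball_aut b w))\<^sup>2 < 1" using one_minus_norm_ball_aut[OF assms] by linarith
  then show ?thesis by (simp add: abs_square_less_1)
qed

lemma ball_aut_zero: "ball_aut b 0 = b"
  by (simp add: ball_aut_def Let_def herm_simps)

lemma ball_aut_involution:
  assumes b: "norm b < 1" and w: "norm w < 1"
  shows "ball_aut b (ball_aut b w) = w"
proof -
  define s where "s = complex_of_real (sqrt (1 - (norm b)\<^sup>2))"
  note s = sqrt_norm_facts[OF b, folded s_def]
  define c where "c = herm w b"
  define t where "t = 1 / (1 + s)"
  have t: "t * (1 + s) = 1" using s by (simp add: t_def)
  have c: "1 - c \<noteq> 0" using one_minus_herm_nz[OF b w] by (simp add: c_def)
  define y where "y = ball_aut b w"
  have y: "y = (1 / (1 - c)) *s ((1 - c * t) *s b - s *s w)"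
    by (simp add: y_def ball_aut_def c_def s_def t_def Let_def)
  define c2 where "c2 = herm y b"
  have "(1 - c) * c2 = (1 - c * t) * herm b b - s * c"
    unfolding c2_def y herm_simps c_def[symmetric] using c by simp
  moreover have bb: "herm b b = 1 - s * s" using s by (simp add: power2_eq_square)
  \<comment> \<open>The denominators of the two applications multiply to the constant
    \<open>s * s\<close>, which is why they cancel below.\<close>
  ultimately have c2: "(1 - c) * (1 - c2) = s * s" using t by algebra
  then have c2nz: "1 - c2 \<noteq> 0" using s c by auto
  have cancel: "(1 - c) * ((1 / (1 - c)) * x) = x" for x using c by simp
  have yi: "(1 - c) * y $ i = (1 - c * t) * b $ i - s * w $ i" for i
    unfolding y by (simp only: vector_smult_component vector_minus_component cancel)
  have "ball_aut b y $ i = w $ i" for i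
  proof -
    have "ball_aut b y $ i = (1 / (1 - c2)) * ((1 - c2 * t) * b $ i - s * y $ i)"
      by (simp only: ball_aut_def c2_def s_def t_def Let_def vector_smult_component
          vector_minus_component times_divide_eq_right mult_1_right)
    moreover have "(1 - c2 * t) * b $ i - s * y $ i = (1 - c2) * w $ i"
    proof -
      have "(1 - c) * ((1 - c2 * t) * b $ i - s * y $ i) = (1 - c) * ((1 - c2) * w $ i)"
        using c2 t yi[of i] by algebra
      then show ?thesis using c by simp
    qed
    ultimately show ?thesis using c2nz by simp
  qed
  then show ?thesis by (simp add: y_def vec_eq_iff)
qed

lemma ball_aut_self: "norm b < 1 \<Longrightarrow> ball_aut b b = 0"
  using ball_aut_involution[of b 0] by (simp add: ball_aut_zero)

lemma has_derivative_herm [derivative_intros]: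
  "(f has_derivative f') (at x within S) \<Longrightarrow>
    ((\<lambda>x. herm (f x) b) has_derivative (\<lambda>h. herm (f' h) b)) (at x within S)"
  unfolding herm_def by (intro derivative_intros has_derivative_vec_nth)

lemma holomorphic_map_on_ball_aut:
  fixes b :: "complex ^ 'n"
  assumes b: "norm b < 1"
  shows "holomorphic_map_on (ball_aut b) (ball 0 1)"
  unfolding holomorphic_map_on_def
proof
  fix w :: "complex ^ 'n" assume "w \<in> ball 0 1"
  then have nz: "1 - herm w b \<noteq> 0" using one_minus_herm_nz[OF b] by simp
  define s where "s = complex_of_real (sqrt (1 - (norm b)\<^sup>2))"
  note s = sqrt_norm_facts[OF b, folded s_def]
  define t where "t = 1 / (1 + s)"
  define d where "d = inverse (1 - herm w b)"
  define f' where "f' = (\<lambda>h. (d * herm h b * d) *s ((1 - herm w b * t) *s b - s *s w)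
      + d *s (- (herm h b * t) *s b - s *s h))"
  have "((\<lambda>w. ball_aut b w $ i) has_derivative (\<lambda>h. f' h $ i)) (at w)" for i
  proof -
    have eq: "(\<lambda>w. ball_aut b w $ i) = (\<lambda>w. inverse (1 - herm w b) * ((1 - herm w b * t) * b $ i - s * w $ i))"
      by (simp only: ball_aut_def Let_def vector_smult_component vector_minus_component s_def t_def
          times_divide_eq_right mult_1_right inverse_eq_divide)
    have nth: "((\<lambda>w. w $ i) has_derivative (\<lambda>h. h $ i)) (at w)"
      using has_derivative_vec_nth[OF has_derivative_ident] .
    show ?thesis unfolding eq
      by (rule derivative_eq_intros nth refl nz)+
        (simp add: f'_def fun_eq_iff algebra_simps flip: d_def)
  qed
  then have "(ball_aut b has_derivative f') (at w)" by (rule has_derivative_vecI)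
  moreover have "f' (c *s h) = c *s f' h" for c h
    by (simp add: f'_def herm_simps vec_eq_iff algebra_simps)
  ultimately show "\<exists>f'. (ball_aut b has_derivative f') (at w) \<and> (\<forall>c v. f' (c *s v) = c *s f' v)"
    by blast
qed

text \<open>The denominator in \<open>one_minus_norm_ball_aut\<close> is at most 4. In the
  application \<open>r\<close> is the radius that the recentred embedding is to cover and
  \<open>q\<close> the radius already covered.\<close>

lemma ball_aut_image_bound:
  assumes b: "norm b < 1" and u: "norm u < r" "r \<le> 1"
    and q: "0 \<le> q" "1 - q\<^sup>2 \<le> (1 - (norm b)\<^sup>2) * (1 - r\<^sup>2) / 4"
  shows "norm (ball_aut b u) < q"
proof -
  have u1: "norm u < 1" using u by simp
  have "(norm u)\<^sup>2 < r\<^sup>2" using u by (intro power_strict_mono) auto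
  moreover have b2: "1 - (norm b)\<^sup>2 > 0" using b by (simp add: abs_square_less_1)
  ultimately have 1: "(1 - (norm b)\<^sup>2) * (1 - r\<^sup>2) < (1 - (norm b)\<^sup>2) * (1 - (norm u)\<^sup>2)" by simp
  have "(1 - (norm b)\<^sup>2) * (1 - (norm u)\<^sup>2) / 4 \<le> (1 - (norm b)\<^sup>2) * (1 - (norm u)\<^sup>2) / (cmod (1 - herm u b))\<^sup>2"
  proof (rule divide_left_mono)
    have "cmod (herm u b) \<le> 1"
      by (intro order_trans[OF cmod_herm_le] mult_le_one norm_ge_zero less_imp_le[OF b] less_imp_le[OF u1])
    then have "cmod (1 - herm u b) \<le> 2" using norm_triangle_ineq4[of 1 "herm u b"] by simp
    then show "(cmod (1 - herm u b))\<^sup>2 \<le> 4" using power_mono[of "cmod (1 - herm u b)" 2 2] by simp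
    show "0 \<le> (1 - (norm b)\<^sup>2) * (1 - (norm u)\<^sup>2)"
      using b u1 by (intro mult_nonneg_nonneg) (auto simp: abs_square_le_1)
    show "0 < 4 * (cmod (1 - herm u b))\<^sup>2" using one_minus_herm_nz[OF b u1] by simp
  qed
  then have "1 - q\<^sup>2 < 1 - (norm (ball_aut b u))\<^sup>2"
    using q(2) 1 unfolding one_minus_norm_ball_aut[OF b u1] by linarith
  then show ?thesis using q(1) power2_less_imp_less by auto
qed

section \<open>Harnack-type inequalities for maps into the ball\<close>

text \<open>An automorphism moves \<open>h (\<gamma> p)\<close> to \<open>0\<close>, the Schwarz
  lemma bounds the composition \<open>k\<close>, and the norm identity brings the bound back. The 8
  is 4, from the squared denominator, times 2, from passing from the squared norm to the
  norm.\<close>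

lemma Harnack_curve:
  fixes h :: "complex ^ 'n \<Rightarrow> complex ^ 'm"
  assumes h: "holomorphic_map_on h D" "h ` D \<subseteq> ball 0 1"
    and \<gamma>: "\<And>i. (\<lambda>\<zeta>. \<gamma> \<zeta> $ i) holomorphic_on ball p R" "\<gamma> ` ball p R \<subseteq> D"
    and \<zeta>: "\<zeta> \<in> ball p R"
  shows "(1 - norm (h (\<gamma> p))) * (1 - cmod (\<zeta> - p) / R) / 8 \<le> 1 - norm (h (\<gamma> \<zeta>))"
proof -
  have R: "R > 0" using \<zeta> by (smt (verit) mem_ball zero_le_dist)
  define b where "b = h (\<gamma> p)"
  have hb: "norm (h (\<gamma> \<xi>)) < 1" if "\<xi> \<in> ball p R" for \<xi>
  proof -
    have "\<gamma> \<xi> \<in> D" using that \<gamma>(2) by blast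
    then show ?thesis using h(2) by auto
  qed
  have b: "norm b < 1" using hb R by (simp add: b_def)
  define k where "k = (\<lambda>z. ball_aut b (h z))"
  have holk: "holomorphic_map_on k D"
    unfolding k_def using h by (intro holomorphic_map_on_compose[OF _ holomorphic_map_on_ball_aut[OF b]])
  define y where "y = k (\<gamma> \<zeta>)"
  define u where "u = sgn y"
  define g where "g = (\<lambda>\<xi>. herm (k (\<gamma> (p + \<xi>))) u)"
  have inb: "p + \<xi> \<in> ball p R" if "cmod \<xi> < R" for \<xi> using that by (simp add: dist_norm)
  have gb: "cmod (g \<xi>) \<le> 1" if "cmod \<xi> < R" for \<xi>
  proof -
    have "norm (k (\<gamma> (p + \<xi>))) \<le> 1"
      using ball_aut_in_ball[OF b hb[OF inb[OF that]]] by (simp add: k_def)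
    moreover have "norm u \<le> 1" by (simp add: u_def norm_sgn)
    ultimately show ?thesis unfolding g_def
      by (meson cmod_herm_le mult_le_one norm_ge_zero order_trans)
  qed
  have g0: "g 0 = 0" by (simp add: g_def k_def ball_aut_self[OF b] herm_simps flip: b_def)
  have "(\<lambda>\<xi>. k (\<gamma> \<xi>) $ i) holomorphic_on ball p R" for i
    by (rule holomorphic_map_on_curve[OF holk _ \<gamma>]) auto
  then have "((\<lambda>\<xi>. k (\<gamma> \<xi>) $ i) \<circ> (\<lambda>\<xi>. p + \<xi>)) holomorphic_on ball 0 R" for i
    by (intro holomorphic_on_compose_gen[where t = "ball p R"] holomorphic_intros) (auto intro: inb)
  then have "g holomorphic_on ball 0 R"
    unfolding g_def herm_def by (intro holomorphic_intros) (simp add: o_def)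
  then have "cmod (g (\<zeta> - p) - g 0) \<le> 1 * cmod (\<zeta> - p) / R"
    by (rule Schwarz_lemma_bound) (use g0 gb \<zeta> in \<open>auto simp: dist_norm norm_minus_commute\<close>)
  moreover have "g (\<zeta> - p) = of_real (norm y)" by (simp add: g_def u_def herm_sgn y_def)
  ultimately have y: "norm y \<le> cmod (\<zeta> - p) / R" using g0 by simp
  define q where "q = cmod (\<zeta> - p) / R"
  have q: "0 \<le> q" "q < 1" using \<zeta> R by (auto simp: q_def dist_norm norm_minus_commute)
  have y1: "norm y < 1" using y q by (simp add: q_def)
  have hy: "h (\<gamma> \<zeta>) = ball_aut b y"
    using ball_aut_involution[OF b hb[OF \<zeta>]] by (simp add: y_def k_def)
  define m where "m = (1 - norm b) * (1 - q) / 4"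
  have "m \<le> (1 - (norm b)\<^sup>2) * (1 - (norm y)\<^sup>2) / 4"
  proof -
    have "1 - norm b \<le> 1 - (norm b)\<^sup>2" using b by (simp add: power2_eq_square mult_left_le)
    moreover have "1 - q \<le> 1 - (norm y)\<^sup>2"
      using y y1 mult_left_le[of "norm y" "norm y"] by (simp add: q_def power2_eq_square)
    ultimately show ?thesis
      using b q unfolding m_def by (intro divide_right_mono mult_mono) auto
  qed
  also have "\<dots> \<le> (1 - (norm b)\<^sup>2) * (1 - (norm y)\<^sup>2) / (cmod (1 - herm y b))\<^sup>2"
  proof (rule divide_left_mono)
    have "cmod (herm y b) \<le> 1"
      by (intro order_trans[OF cmod_herm_le] mult_le_one norm_ge_zero less_imp_le[OF b] less_imp_le[OF y1])
    then have "cmod (1 - herm y b) \<le> 2" using norm_triangle_ineq4[of 1 "herm y b"] by simp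
    then show "(cmod (1 - herm y b))\<^sup>2 \<le> 4" using power_mono[of "cmod (1 - herm y b)" 2 2] by simp
    show "0 \<le> (1 - (norm b)\<^sup>2) * (1 - (norm y)\<^sup>2)"
      using b y1 by (intro mult_nonneg_nonneg) (auto simp: abs_square_le_1)
    show "0 < 4 * (cmod (1 - herm y b))\<^sup>2" using one_minus_herm_nz[OF b y1] by simp
  qed
  also have "\<dots> = 1 - (norm (h (\<gamma> \<zeta>)))\<^sup>2" using one_minus_norm_ball_aut[OF b y1] by (simp add: hy)
  also have "\<dots> \<le> 2 * (1 - norm (h (\<gamma> \<zeta>)))"
  proof -
    have "0 \<le> (1 - norm (h (\<gamma> \<zeta>)))\<^sup>2" by simp
    then show ?thesis by (simp add: power2_diff)
  qed
  finally show ?thesis by (simp add: m_def q_def b_def)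
qed

lemma Harnack_ball:
  assumes h: "holomorphic_map_on h D" "h ` D \<subseteq> ball 0 1" "ball p R \<subseteq> D" and z: "z \<in> ball p R"
  shows "(1 - norm (h p)) * (1 - dist z p / R) / 8 \<le> 1 - norm (h z)"
proof (cases "z = p")
  case True
  have "p \<in> D" using h(3) z True by blast
  then have "norm (h p) < 1" using h(2) by auto
  then show ?thesis using True by simp
next
  case False
  have "(1 - norm (h (p + 0 *s sgn (z - p)))) * (1 - cmod (complex_of_real (norm (z - p)) - 0) / R) / 8
      \<le> 1 - norm (h (p + complex_of_real (norm (z - p)) *s sgn (z - p)))"
  proof (rule Harnack_curve[OF h(1,2)])
    show "(\<lambda>\<zeta>. p + \<zeta> *s sgn (z - p)) ` ball 0 R \<subseteq> D"
      using h(3) False by (auto simp: dist_norm norm_smult_sgn intro!: subsetD[OF h(3)])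
  qed (use z in \<open>auto intro!: holomorphic_intros simp: dist_norm norm_minus_commute\<close>)
  then show ?thesis by (simp add: smult_sgn dist_norm)
qed

text \<open>Harnack chains: on a small ball the values of \<open>1 - norm (h x)\<close> at any two
  points differ at most by the factor 24, for all \<open>h\<close> at once. Connectedness spreads a
  positive bound from \<open>a\<close>, where the value is 1, and compactness of \<open>K\<close>
  leaves one constant.\<close>

lemma uniform_bound_on_compact:
  fixes D :: "(complex ^ 'n) set"
  assumes D: "open D" "connected D" and a: "a \<in> D" and K: "compact K" "K \<subseteq> D"
  obtains c where "c > 0" "\<And>(h :: complex ^ 'n \<Rightarrow> complex ^ 'm) q. holomorphic_map_on h D \<Longrightarrow>
    h ` D \<subseteq> ball 0 1 \<Longrightarrow> h a = 0 \<Longrightarrow> q \<in> K \<Longrightarrow> c \<le> 1 - norm (h q)"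
proof -
  define H where "H = {h :: complex ^ 'n \<Rightarrow> complex ^ 'm. holomorphic_map_on h D \<and> h ` D \<subseteq> ball 0 1 \<and> h a = 0}"
  have loc: "\<exists>R>0. ball q R \<subseteq> D \<and> (\<forall>c>0. \<forall>x\<in>ball q R. \<forall>y\<in>ball q R.
      (\<forall>h\<in>H. c \<le> 1 - norm (h x)) \<longrightarrow> (\<forall>h\<in>H. c / 24 \<le> 1 - norm (h y)))" if q: "q \<in> D" for q
  proof -
    obtain e where e: "e > 0" "ball q e \<subseteq> D" using D q open_contains_ball by blast
    define R where "R = e / 4"
    have R: "R > 0" "ball q (4 * R) \<subseteq> D" using e by (auto simp: R_def)
    have "c / 24 \<le> 1 - norm (h y)"
      if c: "c > 0" and x: "x \<in> ball q R" and y: "y \<in> ball q R" and h: "h \<in> H" and cx: "c \<le> 1 - norm (h x)" for c x y h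
    proof -
      have "ball x (3 * R) \<subseteq> ball q (4 * R)"
      proof
        fix v assume "v \<in> ball x (3 * R)"
        then show "v \<in> ball q (4 * R)" using x dist_triangle[of q v x] by simp
      qed
      then have sub: "ball x (3 * R) \<subseteq> D" using R by blast
      have d: "dist y x < 2 * R"
        using x y dist_triangle[of y x q] by (simp add: dist_commute)
      \<comment> \<open>This 1/3 and the 1/8 of \<open>Harnack_ball\<close> make up the factor
        24.\<close>
      then have "1 / 3 \<le> 1 - dist y x / (3 * R)" using R by (simp add: field_simps)
      then have "c * (1 / 3) / 8 \<le> (1 - norm (h x)) * (1 - dist y x / (3 * R)) / 8"
        using c cx by (intro divide_right_mono mult_mono) auto
      also have "\<dots> \<le> 1 - norm (h y)"
        using h d R sub by (intro Harnack_ball) (auto simp: H_def dist_commute)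
      finally show ?thesis by simp
    qed
    moreover have "ball q R \<subseteq> D" using R by auto
    ultimately show ?thesis using R(1) by blast
  qed
  have P: "\<exists>c>0. \<forall>h\<in>H. c \<le> 1 - norm (h q)" if q: "q \<in> D" for q
  proof (rule connected_induction_simple[OF D(2), where P = "\<lambda>q. \<exists>c>0. \<forall>h\<in>H. c \<le> 1 - norm (h q)", OF a q])
    show "\<exists>c>0. \<forall>h\<in>H. c \<le> 1 - norm (h a)" by (intro exI[of _ 1]) (auto simp: H_def)
    fix x assume "x \<in> D"
    from loc[OF this] obtain R where R: "R > 0" "ball x R \<subseteq> D" and *: "\<forall>c>0. \<forall>y\<in>ball x R. \<forall>z\<in>ball x R.
      (\<forall>h\<in>H. c \<le> 1 - norm (h y)) \<longrightarrow> (\<forall>h\<in>H. c / 24 \<le> 1 - norm (h z))" by blast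
    have "\<exists>c>0. \<forall>h\<in>H. c \<le> 1 - norm (h z)" if "y \<in> ball x R" "z \<in> ball x R" "c > 0" "\<forall>h\<in>H. c \<le> 1 - norm (h y)" for y z c
    proof -
      have "\<forall>h\<in>H. c / 24 \<le> 1 - norm (h z)" using * that by blast
      then show ?thesis using that(3) by (intro exI[of _ "c / 24"]) simp
    qed
    then show "\<exists>T. openin (top_of_set D) T \<and> x \<in> T \<and> (\<forall>y\<in>T. \<forall>z\<in>T.
        (\<exists>c>0. \<forall>h\<in>H. c \<le> 1 - norm (h y)) \<longrightarrow> (\<exists>c>0. \<forall>h\<in>H. c \<le> 1 - norm (h z)))"
      using R D by (intro exI[of _ "ball x R"]) (auto simp: openin_open_eq)
  qed
  have "\<exists>R>0. \<exists>c>0. \<forall>h\<in>H. \<forall>y\<in>ball q R. c \<le> 1 - norm (h y)" if "q \<in> K" for q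
  proof -
    have "q \<in> D" using that K by blast
    obtain c where c: "c > 0" "\<forall>h\<in>H. c \<le> 1 - norm (h q)" using P[OF \<open>q \<in> D\<close>] by blast
    obtain R where R: "R > 0" "\<forall>c>0. \<forall>x\<in>ball q R. \<forall>y\<in>ball q R.
      (\<forall>h\<in>H. c \<le> 1 - norm (h x)) \<longrightarrow> (\<forall>h\<in>H. c / 24 \<le> 1 - norm (h y))"
      using loc[OF \<open>q \<in> D\<close>] by blast
    have "\<forall>h\<in>H. c / 24 \<le> 1 - norm (h y)" if "y \<in> ball q R" for y
      using R c that by (metis centre_in_ball)
    then show ?thesis using R(1) c(1) by (intro exI[of _ R] conjI exI[of _ "c / 24"]) auto
  qed
  then obtain R c where Rc: "\<And>q. q \<in> K \<Longrightarrow> R q > 0 \<and> c q > 0 \<and> (\<forall>h\<in>H. \<forall>y\<in>ball q (R q). c q \<le> 1 - norm (h y))"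
    by metis
  have "K \<subseteq> (\<Union>q\<in>K. ball q (R q))" using Rc by force
  then obtain Q where Q: "Q \<subseteq> K" "finite Q" "K \<subseteq> (\<Union>q\<in>Q. ball q (R q))"
    using compactE_image[OF K(1), of K "\<lambda>q. ball q (R q)"] by auto
  define m where "m = Min (insert 1 (c ` Q))"
  have "m > 0" using Q Rc unfolding m_def by (subst Min_gr_iff) auto
  moreover have "m \<le> 1 - norm (h q)" if h: "h \<in> H" and q: "q \<in> K" for h q
  proof -
    obtain x where x: "x \<in> Q" "q \<in> ball x (R x)" using Q q by blast
    have "m \<le> c x" unfolding m_def using Q x by (intro Min_le) auto
    also have "c x \<le> 1 - norm (h q)" using Rc x Q h by blast
    finally show ?thesis .
  qed
  ultimately show thesis by (intro that[of m]) (auto simp: H_def)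
qed

section \<open>Embeddings exhausting the ball\<close>

lemma biholomorphic_injective_image:
  fixes f :: "complex ^ 'n \<Rightarrow> complex ^ 'n"
  assumes "holomorphic_map_on f D" "open D" "inj_on f D"
  shows "biholomorphic D (f ` D)"
  unfolding biholomorphic_def
  using assms injective_holomorphic_map_inverse(2)[OF assms]
  by (intro exI[of _ f] exI[of _ "inv_into D f"]) (auto simp: inv_into_into f_inv_into_f)

text \<open>A pointwise limit \<open>F0\<close> of the embeddings is holomorphic. Its injectivity
  and surjectivity both come from the inverses \<open>G j\<close>, which on smaller balls eventually
  take values in a fixed compact subset of \<open>D\<close>.\<close>

theorem biholomorphic_ball_if_images_exhaust:
  fixes F :: "nat \<Rightarrow> complex ^ 'n \<Rightarrow> complex ^ 'n"
  assumes D: "open D" "connected D" and a: "a \<in> D"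
    and F: "\<And>j. holomorphic_map_on (F j) D" "\<And>j. F j ` D \<subseteq> ball 0 1" "\<And>j. F j a = 0" "\<And>j. inj_on (F j) D"
    and r: "\<And>j. ball 0 (r j) \<subseteq> F j ` D" "r \<longlonglongrightarrow> 1"
  shows "biholomorphic D (ball (0 :: complex ^ 'n) 1)"
proof -
  define G where "G = (\<lambda>j. inv_into D (F j))"
  have FG: "G j w \<in> D" "F j (G j w) = w" if "norm w < r j" for j w
    using that r(1)[of j] by (auto simp: G_def intro!: inv_into_into f_inv_into_f)
  have GF: "G j (F j z) = z" if "z \<in> D" for j z using F(4) that by (simp add: G_def)
  have holG: "holomorphic_map_on (G j) (ball 0 (r j))" for j
    unfolding G_def using injective_holomorphic_map_inverse(2)[OF F(1)[of j] D(1) F(4)[of j]] r(1)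
    by (rule holomorphic_map_on_subset)
  have F1: "norm (F j z) < 1" if "z \<in> D" for j z using F(2)[of j] that by auto
  have r_ev: "\<forall>\<^sub>F j in sequentially. \<rho> < r j" if "\<rho> < 1" for \<rho>
    using order_tendstoD(1)[OF r(2) that] .
  \<comment> \<open>Fix one \<open>k\<close> whose image contains the ball of radius
    \<open>\<rho>'\<close>. The map \<open>F k\<close> after \<open>G j\<close> fixes
    \<open>0\<close> and takes values in the unit ball, so it shrinks \<open>norm w\<close> to at
    most \<open>norm w / r j\<close>. Hence \<open>G j w\<close> lies in the
    \<open>G k\<close>-image of a closed ball, which is compact.\<close>
  have preimages: "\<exists>K. compact K \<and> K \<subseteq> D \<and>
      (\<forall>\<^sub>F j in sequentially. \<rho> < r j \<and> (\<forall>w. norm w \<le> \<rho> \<longrightarrow> G j w \<in> K))" if \<rho>: "0 < \<rho>" "\<rho> < 1" for \<rho>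
  proof -
    define \<rho>' where "\<rho>' = (1 + \<rho>) / 2"
    have \<rho>': "\<rho> < \<rho>'" "\<rho>' < 1" using \<rho> by (auto simp: \<rho>'_def)
    obtain k where k: "\<rho>' < r k" using r_ev[OF \<rho>'(2)] by (auto simp: eventually_sequentially)
    define K where "K = G k ` cball 0 \<rho>'"
    have "continuous_on (cball 0 \<rho>') (G k)"
      by (rule continuous_on_subset[OF holomorphic_map_on_imp_continuous_on[OF holG[of k]]]) (use k in auto)
    then have "compact K" unfolding K_def by (intro compact_continuous_image) auto
    moreover have "K \<subseteq> D" using FG k by (auto simp: K_def)
    moreover have "\<forall>\<^sub>F j in sequentially. \<rho> < r j \<and> (\<forall>w. norm w \<le> \<rho> \<longrightarrow> G j w \<in> K)"
    proof (rule eventually_mono)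
      have "\<rho> / \<rho>' < 1" using \<rho> \<rho>' by simp
      from eventually_conj[OF r_ev[OF this] r_ev[OF \<rho>(2)]]
      show "\<forall>\<^sub>F j in sequentially. \<rho> / \<rho>' < r j \<and> \<rho> < r j" .
      fix j assume j: "\<rho> / \<rho>' < r j \<and> \<rho> < r j"
      have "G j w \<in> K" if w: "norm w \<le> \<rho>" for w
      proof -
        have wr: "norm w < r j" using w j by simp
        have hol: "holomorphic_map_on (\<lambda>x. F k (G j x)) (ball 0 (r j))"
          by (rule holomorphic_map_on_compose[OF holG F(1)]) (use FG in auto)
        have "F k (G j 0) = 0" using GF[OF a, of j] F(3) by simp
        then have "norm (F k (G j w)) \<le> 1 * norm w / r j"
          using Schwarz_lemma_map[OF hol, of 1 w] F1 FG wr by (force simp: less_imp_le)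
        also have "\<dots> \<le> \<rho>'"
        proof -
          have "0 < r j" using j \<rho> by simp
          moreover have "\<rho> < \<rho>' * r j" using j \<rho> \<rho>' by (simp add: field_simps)
          ultimately show ?thesis using w by (simp add: field_simps)
        qed
        finally have "F k (G j w) \<in> cball 0 \<rho>'" by simp
        then have "G k (F k (G j w)) \<in> K" unfolding K_def by (rule imageI)
        then show ?thesis using GF FG[OF wr] by simp
      qed
      then show "\<rho> < r j \<and> (\<forall>w. norm w \<le> \<rho> \<longrightarrow> G j w \<in> K)" using j by blast
    qed
    ultimately show ?thesis by blast
  qed
  have "\<exists>M. \<forall>\<^sub>F j in sequentially. norm (if z \<in> D then F j z else 0) \<le> M" for z
    using F1 by (intro exI[of _ 1] always_eventually) (auto simp: less_imp_le)
  from pointwise_convergent_finer_filter[OF sequentially_bot, of "\<lambda>j z. if z \<in> D then F j z else 0", OF this]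
  obtain A F0 where A: "A \<le> sequentially" "A \<noteq> bot"
    and lim0: "\<And>z. ((\<lambda>j. if z \<in> D then F j z else 0) \<longlongrightarrow> F0 z) A" by metis
  have lim: "((\<lambda>j. F j z) \<longlongrightarrow> F0 z) A" if "z \<in> D" for z using lim0[of z] that by simp
  have hol0: "holomorphic_map_on F0 D"
  proof (rule holomorphic_map_on_limit[OF A(2) _ lim])
    fix z assume "z \<in> D"
    then obtain R where R: "R > 0" "ball z R \<subseteq> D" using D open_contains_ball by blast
    then show "\<exists>R>0. \<exists>M. ball z R \<subseteq> D \<and>
        (\<forall>\<^sub>F j in A. holomorphic_map_on (F j) (ball z R) \<and> (\<forall>y\<in>ball z R. norm (F j y) \<le> M))"
      using holomorphic_map_on_subset[OF F(1) R(2)] F1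
      by (intro exI[of _ R] conjI exI[of _ 1] always_eventually) (auto intro!: less_imp_le)
  qed
  \<comment> \<open>A limit of points of the open ball might reach the sphere; the bound uniform in
    \<open>h\<close> excludes this.\<close>
  have F0_ball: "norm (F0 z) < 1" if z: "z \<in> D" for z
  proof -
    obtain c where c: "c > 0" "\<And>(h :: complex ^ 'n \<Rightarrow> complex ^ 'n) q. holomorphic_map_on h D \<Longrightarrow>
      h ` D \<subseteq> ball 0 1 \<Longrightarrow> h a = 0 \<Longrightarrow> q \<in> {z} \<Longrightarrow> c \<le> 1 - norm (h q)"
      using uniform_bound_on_compact[OF D a, of "{z}"] z by (metis compact_sing empty_subsetI insert_subset)
    have "norm (F0 z) \<le> 1 - c"
    proof (rule tendsto_upperbound[OF tendsto_norm[OF lim[OF z]] _ A(2)])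
      show "\<forall>\<^sub>F j in A. norm (F j z) \<le> 1 - c"
        using c(2)[OF F(1) F(2) F(3)] by (intro always_eventually allI) (smt (verit) singletonI)
    qed
    then show ?thesis using c(1) by simp
  qed
  have "inj_on F0 D"
  proof (rule inj_onI)
    fix z z' assume z: "z \<in> D" "z' \<in> D" "F0 z = F0 z'"
    define w where "w = F0 z"
    define \<rho> where "\<rho> = (1 + norm w) / 2"
    have w: "norm w < 1" using F0_ball z by (simp add: w_def)
    have \<rho>: "0 < \<rho>" "\<rho> < 1" using w by (auto simp: \<rho>_def add_pos_nonneg)
    from preimages[OF this] obtain K where K: "compact K" "K \<subseteq> D"
      "\<forall>\<^sub>F j in sequentially. \<rho> < r j \<and> (\<forall>w. norm w \<le> \<rho> \<longrightarrow> G j w \<in> K)" by blast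
    obtain M where M: "\<And>x. x \<in> K \<Longrightarrow> norm x \<le> M"
      using K(1) compact_imp_bounded bounded_iff by metis
    \<comment> \<open>With this \<open>e\<close>, a ball of radius \<open>e\<close> about a point
      closer than \<open>e\<close> to \<open>w\<close> stays within norm \<open>\<rho>\<close>.
      There all late \<open>G j\<close> are Lipschitz near \<open>F j z\<close> with one constant,
      so equal limits of \<open>F j z\<close> and \<open>F j z'\<close> force
      \<open>z = z'\<close>.\<close>
    define e where "e = (\<rho> - norm w) / 2"
    have e: "e > 0" using w by (simp add: e_def \<rho>_def)
    have l: "((\<lambda>j. F j z) \<longlongrightarrow> w) A" "((\<lambda>j. F j z') \<longlongrightarrow> w) A"
      using lim[OF z(1)] lim[OF z(2)] z(3) by (simp_all add: w_def)
    have "((\<lambda>j. 2 * M * norm (F j z' - F j z) / e) \<longlongrightarrow> 2 * M * norm (w - w) / e) A"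
      using e by (intro tendsto_intros l) auto
    moreover have "\<forall>\<^sub>F j in A. norm (z' - z) \<le> 2 * M * norm (F j z' - F j z) / e"
    proof -
      have "((\<lambda>j. norm (F j z' - F j z)) \<longlongrightarrow> norm (w - w)) A" by (intro tendsto_intros l)
      then have 1: "\<forall>\<^sub>F j in A. norm (F j z' - F j z) < e" using e by (intro order_tendstoD(2)) auto
      have "((\<lambda>j. norm (F j z - w)) \<longlongrightarrow> norm (w - w)) A" by (intro tendsto_intros l)
      then have 2: "\<forall>\<^sub>F j in A. norm (F j z - w) < e" using e by (intro order_tendstoD(2)) auto
      show ?thesis using eventually_conj[OF 1 eventually_conj[OF 2 filter_leD[OF A(1) K(3)]]]
      proof (rule eventually_mono)
        fix j assume j: "norm (F j z' - F j z) < e \<and> norm (F j z - w) < e \<and> \<rho> < r j \<and>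
          (\<forall>w. norm w \<le> \<rho> \<longrightarrow> G j w \<in> K)"
        define p where "p = F j z"
        have sub: "norm y \<le> \<rho>" if "y \<in> ball p e" for y
        proof -
          have "norm y \<le> norm (y - p) + norm (p - w) + norm w"
            using norm_triangle_ineq[of "y - p" "p - w"] norm_triangle_ineq[of "y - w" w] by simp
          moreover have "norm (y - p) < e" using that by (simp add: dist_norm norm_minus_commute)
          ultimately show ?thesis using j by (simp add: p_def e_def)
        qed
        have p: "p \<in> ball p e" using e by simp
        have "norm (G j (p + (F j z' - p)) - G j p) \<le> 2 * M * norm (F j z' - p) / e"
        proof (rule Schwarz_lemma_map)
          show "holomorphic_map_on (G j) (ball p e)"
            by (rule holomorphic_map_on_subset[OF holG]) (use sub j in force)
          show "norm (G j y - G j p) \<le> 2 * M" if "y \<in> ball p e" for y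
            using norm_triangle_ineq4[of "G j y" "G j p"] M sub[OF that] sub[OF p] j by (smt (verit))
        qed (use j in \<open>simp add: p_def\<close>)
        then show "norm (z' - z) \<le> 2 * M * norm (F j z' - F j z) / e"
          using GF z by (simp add: p_def)
      qed
    qed
    ultimately have "norm (z' - z) \<le> 2 * M * norm (w - w) / e"
      using A(2) by (intro tendsto_lowerbound)
    then show "z = z'" by simp
  qed
  moreover have "F0 ` D = ball 0 1"
  proof
    show "F0 ` D \<subseteq> ball 0 1" using F0_ball by auto
    show "ball 0 1 \<subseteq> F0 ` D"
    proof
      fix w :: "complex ^ 'n" assume "w \<in> ball 0 1"
      then have w: "norm w < 1" by simp
      define \<rho> where "\<rho> = (1 + norm w) / 2"
      have \<rho>: "0 < \<rho>" "\<rho> < 1" "norm w \<le> \<rho>" using w by (auto simp: \<rho>_def add_pos_nonneg)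
      from preimages[OF \<rho>(1,2)] obtain K where K: "compact K" "K \<subseteq> D"
        "\<forall>\<^sub>F j in sequentially. \<rho> < r j \<and> (\<forall>w. norm w \<le> \<rho> \<longrightarrow> G j w \<in> K)" by blast
      have inK: "\<forall>\<^sub>F j in A. norm w < r j \<and> G j w \<in> K"
        using filter_leD[OF A(1) K(3)] by (rule eventually_mono) (use \<rho> in auto)
      obtain M where M: "\<And>x. x \<in> K \<Longrightarrow> norm x \<le> M"
        using K(1) compact_imp_bounded bounded_iff by metis
      \<comment> \<open>The finer-filter lemma speaks of families of functions; a single point
        sequence is a function on \<open>unit\<close>.\<close>
      have "\<exists>M. \<forall>\<^sub>F j in A. norm (G j w) \<le> M" for u :: unit
        using inK by (intro exI[of _ M]) (auto elim!: eventually_mono intro: M)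
      from pointwise_convergent_finer_filter[OF A(2), of "\<lambda>j (u::unit). G j w", OF this]
      obtain B g where B: "B \<le> A" "B \<noteq> bot" and g: "((\<lambda>j. G j w) \<longlongrightarrow> g ()) B" by metis
      define z where "z = g ()"
      have inK': "\<forall>\<^sub>F j in B. norm w < r j \<and> G j w \<in> K" using filter_leD[OF B(1) inK] .
      have "\<forall>\<^sub>F j in B. G j w \<in> K" using inK' by (rule eventually_mono) simp
      from Lim_in_closed_set[OF compact_imp_closed[OF K(1)] this B(2) g]
      have "z \<in> K" by (simp add: z_def)
      then have z: "z \<in> D" using K(2) by blast
      obtain R where R: "R > 0" "ball z R \<subseteq> D" using D z open_contains_ball by blast
      have l: "((\<lambda>j. G j w) \<longlongrightarrow> z) B" using g by (simp add: z_def)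
      \<comment> \<open>As \<open>w = F j (G j w)\<close> and the \<open>F j\<close> are
        equi-Lipschitz near \<open>z\<close>, the convergence of \<open>G j w\<close> to
        \<open>z\<close> gives that of \<open>F j z\<close> to \<open>w\<close>.\<close>
      have "((\<lambda>j. F j z - w) \<longlongrightarrow> 0) B"
      proof (rule Lim_null_comparison)
        have "((\<lambda>j. norm (G j w - z)) \<longlongrightarrow> norm (z - z)) B" by (intro tendsto_intros l)
        then have near: "\<forall>\<^sub>F j in B. norm (G j w - z) < R" using R by (intro order_tendstoD(2)) auto
        have "((\<lambda>j. 2 * norm (G j w - z) / R) \<longlongrightarrow> 2 * norm (z - z) / R) B"
          using R by (intro tendsto_intros l) auto
        then show "((\<lambda>j. 2 * norm (G j w - z) / R) \<longlongrightarrow> 0) B" by simp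
        show "\<forall>\<^sub>F j in B. norm (F j z - w) \<le> 2 * norm (G j w - z) / R"
          using eventually_conj[OF near inK']
        proof (rule eventually_mono)
          fix j assume j: "norm (G j w - z) < R \<and> norm w < r j \<and> G j w \<in> K"
          have "norm (F j (z + (G j w - z)) - F j z) \<le> 2 * norm (G j w - z) / R"
          proof (rule Schwarz_lemma_map)
            show "holomorphic_map_on (F j) (ball z R)"
              by (rule holomorphic_map_on_subset[OF F(1) R(2)])
            show "norm (F j y - F j z) \<le> 2" if "y \<in> ball z R" for y
              using norm_triangle_ineq4[of "F j y" "F j z"] F1[OF z, of j] F1[OF subsetD[OF R(2) that], of j] by linarith
          qed (use j in simp)
          then show "norm (F j z - w) \<le> 2 * norm (G j w - z) / R"
            using FG j by (simp add: norm_minus_commute)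
        qed
      qed
      then have "((\<lambda>j. F j z) \<longlongrightarrow> w) B" by (rule LIM_zero_cancel)
      moreover have "((\<lambda>j. F j z) \<longlongrightarrow> F0 z) B" using lim[OF z] B(1) tendsto_mono by blast
      ultimately have "w = F0 z" using tendsto_unique[OF B(2)] by blast
      then show "w \<in> F0 ` D" using z by blast
    qed
  qed
  ultimately show ?thesis
    using biholomorphic_injective_image[OF hol0 D(1)] by simp
qed

section \<open>Dini-smooth boundaries\<close>

text \<open>The real \<open>Sup\<close> is an upper bound only for bounded sets; vectors of norm at
  most 1 have differences of norm at most 2.\<close>

lemma norm_diff_le_modulus_of_continuity:
  assumes "\<And>x. norm (N x) \<le> 1" "x \<in> S" "y \<in> S" "norm (x - y) < t"
  shows "norm (N x - N y) \<le> modulus_of_continuity S N t"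
  unfolding modulus_of_continuity_def
proof (rule cSup_upper)
  show "bdd_above {norm (N x - N y) | x y. x \<in> S \<and> y \<in> S \<and> norm (x - y) < t}"
  proof (rule bdd_aboveI[of _ 2])
    fix r assume "r \<in> {norm (N x - N y) | x y. x \<in> S \<and> y \<in> S \<and> norm (x - y) < t}"
    then obtain x y where "r = norm (N x - N y)" by blast
    then show "r \<le> 2" using norm_triangle_ineq4[of "N x" "N y"] assms(1)[of x] assms(1)[of y] by linarith
  qed
qed (use assms in blast)

lemma modulus_of_continuity_nonneg:
  assumes "\<And>x. norm (N x) \<le> 1" "x \<in> S" "0 < t"
  shows "0 \<le> modulus_of_continuity S N t"
  using norm_diff_le_modulus_of_continuity[OF assms(1,2,2), of t] assms(3) by simp

lemma modulus_of_continuity_mono: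
  assumes "\<And>x. norm (N x) \<le> 1" "x \<in> S" "0 < s" "s \<le> t"
  shows "modulus_of_continuity S N s \<le> modulus_of_continuity S N t"
proof -
  have "norm (x - x) < s" using assms(3) by simp
  then have "norm (N x - N x) \<in> {norm (N x - N y) | x y. x \<in> S \<and> y \<in> S \<and> norm (x - y) < s}"
    using assms(2) by blast
  then show ?thesis
    unfolding modulus_of_continuity_def[of S N s]
  proof (intro cSup_least)
    fix r assume "r \<in> {norm (N x - N y) | x y. x \<in> S \<and> y \<in> S \<and> norm (x - y) < s}"
    then obtain x y where "r = norm (N x - N y)" "x \<in> S" "y \<in> S" "norm (x - y) < s" by blast
    then show "r \<le> modulus_of_continuity S N t"
      using norm_diff_le_modulus_of_continuity[OF assms(1), of x S y t] assms(4) by simp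
  qed blast
qed

lemma C1_defining_function_on_line:
  assumes "C1_defining_function D U \<rho> g" "x + s *\<^sub>R v \<in> U"
  shows "((\<lambda>s. \<rho> (x + s *\<^sub>R v)) has_real_derivative (g (x + s *\<^sub>R v) \<bullet> v)) (at s)"
proof -
  have "(\<rho> has_derivative (\<lambda>h. g (x + s *\<^sub>R v) \<bullet> h)) (at (x + s *\<^sub>R v))"
    using assms by (simp add: C1_defining_function_def)
  moreover have "((\<lambda>s. x + s *\<^sub>R v) has_derivative (\<lambda>h. h *\<^sub>R v)) (at s)"
    by (auto intro!: derivative_eq_intros)
  ultimately have "((\<lambda>s. \<rho> (x + s *\<^sub>R v)) has_derivative (\<lambda>h. g (x + s *\<^sub>R v) \<bullet> (h *\<^sub>R v))) (at s)"
    using has_derivative_compose by blast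
  then show ?thesis by (simp add: has_field_derivative_def mult.commute[of _ "g (x + s *\<^sub>R v) \<bullet> v"])
qed

lemma C1_defining_function_frontier:
  assumes C: "C1_defining_function D U \<rho> g" and D: "open D" and x: "x \<in> U"
  shows "x \<in> frontier D \<longleftrightarrow> x \<in> closure D \<and> \<rho> x = 0"
proof -
  have U: "open U" "D \<inter> U = {x \<in> U. \<rho> x < 0}" using C by (auto simp: C1_defining_function_def)
  have fr: "frontier D = closure D - D" using D by (simp add: frontier_def interior_open)
  have "isCont \<rho> x" using C x by (auto simp: C1_defining_function_def intro: has_derivative_continuous)
  have "\<rho> x \<le> 0" if "x \<in> closure D"
  proof (rule ccontr)
    assume "\<not> \<rho> x \<le> 0"
    then have "\<forall>\<^sub>F y in nhds x. 0 < \<rho> y"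
      using \<open>isCont \<rho> x\<close> order_tendstoD(1)[of \<rho> "\<rho> x" "nhds x" 0] by (simp add: isCont_def tendsto_nhds_iff)
    moreover have "\<forall>\<^sub>F y in nhds x. y \<in> U" using U x by (simp add: eventually_nhds_in_open)
    ultimately have "\<forall>\<^sub>F y in nhds x. 0 < \<rho> y \<and> y \<in> U" by (rule eventually_conj)
    then obtain W where W: "open W" "x \<in> W" "\<And>y. y \<in> W \<Longrightarrow> 0 < \<rho> y \<and> y \<in> U"
      unfolding eventually_nhds by blast
    have "W \<inter> D \<noteq> {}" using open_Int_closure_eq_empty[OF W(1), of D] W(2) that by blast
    then obtain y where "y \<in> W" "y \<in> D" by blast
    then show False using W(3)[of y] U(2) by force
  qed
  then show ?thesis using U x fr by force
qed

text \<open>If the segment left \<open>D\<close>, then at its first exit point \<open>b\<close> the function \<open>\<rho>\<close> would be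
  nondecreasing along \<open>v\<close>; but the normal at \<open>b\<close> is too close to the one at \<open>x\<close> for that. The normals
  are only compared at boundary points, where the modulus of continuity controls them.\<close>

lemma inner_cone_subset_domain:
  fixes D :: "(complex ^ 'n) set"
  assumes C: "C1_defining_function D U \<rho> g" and D: "open D" and x: "x \<in> frontier D"
    and seg: "\<And>s. 0 \<le> s \<Longrightarrow> s \<le> 1 \<Longrightarrow> x + s *\<^sub>R v \<in> U" and t: "norm v < t"
    and v: "modulus_of_continuity (frontier D \<inter> U) (\<lambda>x. - sgn (g x)) t * norm v < - sgn (g x) \<bullet> v"
  shows "x + v \<in> D"
proof (rule ccontr)
  assume "x + v \<notin> D"
  define N where "N = (\<lambda>x. - sgn (g x))"
  define \<omega> where "\<omega> = modulus_of_continuity (frontier D \<inter> U) N t"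
  have N1: "norm (N y) \<le> 1" for y by (simp add: N_def norm_sgn)
  have U: "D \<inter> U = {x \<in> U. \<rho> x < 0}" "\<And>y. y \<in> U \<Longrightarrow> g y \<noteq> 0" using C by (auto simp: C1_defining_function_def)
  have xU: "x \<in> U" using seg[of 0] by simp
  have gN: "g y \<bullet> v = - norm (g y) * (N y \<bullet> v)" if "y \<in> U" for y
  proof -
    have "norm (g y) *\<^sub>R sgn (g y) = g y" using U(2)[OF that] by (simp add: sgn_div_norm)
    then have "g y \<bullet> v = norm (g y) * (sgn (g y) \<bullet> v)" by (metis inner_scaleR_left)
    then show ?thesis by (simp add: N_def)
  qed
  have "0 \<le> \<omega>" unfolding \<omega>_def using N1 x xU t
    by (intro modulus_of_continuity_nonneg[of N x]) (auto intro: le_less_trans[OF norm_ge_zero])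
  have v': "\<omega> * norm v < N x \<bullet> v" using v by (simp add: \<omega>_def N_def)
  define m where "m = (\<lambda>s. \<rho> (x + s *\<^sub>R v))"
  have der: "(m has_real_derivative (g (x + s *\<^sub>R v) \<bullet> v)) (at s)" if "0 \<le> s" "s \<le> 1" for s
    unfolding m_def by (rule C1_defining_function_on_line[OF C seg[OF that]])
  have m0: "m 0 = 0" using x xU C1_defining_function_frontier[OF C D xU] by (simp add: m_def)
  have mD: "x + s *\<^sub>R v \<in> D \<longleftrightarrow> m s < 0" if "0 \<le> s" "s \<le> 1" for s
    using U(1) seg[OF that] by (auto simp: m_def)
  have neg: "g y \<bullet> v < 0" if "y \<in> frontier D" "y \<in> U" "norm (y - x) < t" for y
  proof -
    have "norm (N y - N x) \<le> \<omega>"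
      unfolding \<omega>_def using N1 that x xU by (intro norm_diff_le_modulus_of_continuity) auto
    then have "\<bar>(N y - N x) \<bullet> v\<bar> \<le> \<omega> * norm v"
      by (meson Cauchy_Schwarz_ineq2 mult_right_mono norm_ge_zero order_trans)
    then have "0 < N y \<bullet> v" using v' by (simp add: inner_diff_left)
    moreover have "0 < norm (g y)" using U that by simp
    ultimately show ?thesis using gN[OF that(2)] by simp
  qed
  have "g x \<bullet> v < 0"
    using neg[OF x xU] t by (simp add: le_less_trans[OF norm_ge_zero])
  then obtain d where d: "d > 0" "\<And>h. 0 < h \<Longrightarrow> h < d \<Longrightarrow> m h < 0"
    using DERIV_neg_dec_right[OF der[of 0]] m0 by auto
  define d' where "d' = min d 1 / 2"
  have d': "0 < d'" "d' < d" "d' < 1" using d by (auto simp: d'_def)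
  \<comment> \<open>\<open>m\<close> vanishes at \<open>0\<close> as well, so the search for the
    first exit starts at \<open>d' > 0\<close>; before \<open>d'\<close> the derivative at
    \<open>0\<close> ensures that \<open>m\<close> is negative.\<close>
  define Z where "Z = {s \<in> {d'..1}. 0 \<le> m s}"
  have contm: "continuous_on {0..1} m"
    using der by (intro continuous_at_imp_continuous_on ballI DERIV_isCont) auto
  have "closed ({d'..1} \<inter> m -` {0..})"
    using d' by (intro continuous_closed_preimage continuous_on_subset[OF contm]) auto
  moreover have "Z = {d'..1} \<inter> m -` {0..}" by (auto simp: Z_def)
  moreover have "bounded Z" by (rule bounded_subset[of "{d'..1}"]) (auto simp: Z_def)
  ultimately have "compact Z" by (simp add: compact_eq_bounded_closed)
  moreover have "1 \<in> Z" using \<open>x + v \<notin> D\<close> mD[of 1] d' by (simp add: Z_def)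
  ultimately obtain s where s: "s \<in> Z" "\<And>s'. s' \<in> Z \<Longrightarrow> s \<le> s'"
    using compact_attains_inf[of Z] by blast
  have s01: "0 < s" "s \<le> 1" "0 \<le> m s" using s(1) d' by (auto simp: Z_def)
  have below: "m s' < 0" if "0 < s'" "s' < s" for s'
    using d(2)[of s'] s(2)[of s'] that d' s01 by (force simp: Z_def)
  have ev: "\<forall>\<^sub>F s' in at_left s. m s' < 0 \<and> 0 < s' \<and> s' < s"
    using eventually_at_left_real[OF s01(1)] by (rule eventually_mono) (use below in auto)
  have "(m \<longlongrightarrow> m s) (at_left s)"
    using DERIV_isCont[OF der[of s]] s01 by (auto simp: isCont_def filterlim_at_split)
  then have "m s \<le> 0"
    by (rule tendsto_upperbound[OF _ eventually_mono[OF ev]]) auto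
  then have ms: "m s = 0" using s01 by simp
  define b where "b = x + s *\<^sub>R v"
  have bU: "b \<in> U" using seg s01 by (simp add: b_def)
  have "b \<in> closure D"
  proof (rule Lim_in_closed_set[of "closure D" "\<lambda>s'. x + s' *\<^sub>R v" "at_left s"])
    show "\<forall>\<^sub>F s' in at_left s. x + s' *\<^sub>R v \<in> closure D"
      using ev by (rule eventually_mono) (use mD s01 closure_subset in force)
    show "((\<lambda>s'. x + s' *\<^sub>R v) \<longlongrightarrow> b) (at_left s)"
      unfolding b_def by (intro tendsto_intros)
  qed auto
  then have "b \<in> frontier D"
    using C1_defining_function_frontier[OF C D bU] ms by (simp add: m_def b_def)
  moreover have "norm (b - x) < t"
  proof -
    have "norm (b - x) = s * norm v" using s01 by (simp add: b_def)
    also have "\<dots> \<le> norm v" using s01 by (simp add: mult_left_le_one_le)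
    finally show ?thesis using t by simp
  qed
  ultimately have "g b \<bullet> v < 0" using neg bU by blast
  then obtain e where e: "e > 0" "\<And>h. 0 < h \<Longrightarrow> h < e \<Longrightarrow> m s < m (s - h)"
    using DERIV_neg_dec_left[OF der[of s]] s01 by (auto simp: b_def)
  define h where "h = min e s / 2"
  have "0 < h" "h < e" "h < s" using e s01 by (auto simp: h_def)
  then show False using e(2)[of h] below[of "s - h"] ms by simp
qed

lemma ball_boundary_dist_subset:
  fixes D :: "(complex ^ 'n) set"
  assumes D: "open D" and z: "z \<in> D"
  shows "ball z (boundary_dist D z) \<subseteq> D"
proof (rule ccontr)
  assume "\<not> ?thesis"
  then obtain y where y: "y \<in> ball z (boundary_dist D z)" "y \<notin> D" by blast
  then have "boundary_dist D z > 0" by (smt (verit) mem_ball zero_le_dist)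
  then have "ball z (boundary_dist D z) \<inter> frontier D \<noteq> {}"
    using y z centre_in_ball[of z "boundary_dist D z"]
    by (intro connected_Int_frontier) (blast intro: connected_ball)+
  then obtain x where "x \<in> frontier D" "dist z x < boundary_dist D z" by auto
  then show False using infdist_le[of x "frontier D" z] by (simp add: boundary_dist_def)
qed

text \<open>A direction \<open>v\<close> with \<open>0 < v \<bullet> w\<close>, where
  \<open>w = z - x\<close>, enters the ball about \<open>z\<close> that touches the boundary at
  \<open>x\<close>. This ball lies in \<open>D\<close>, so \<open>\<rho>\<close> cannot increase
  along \<open>v\<close>. If the unit vectors \<open>n\<close> and \<open>sgn w\<close> were not
  opposite, their sum would be such a direction with \<open>\<rho>\<close> increasing.\<close>

lemma nearest_boundary_point_normal:
  fixes D :: "(complex ^ 'n) set"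
  assumes C: "C1_defining_function D U \<rho> g" and D: "open D" and z: "z \<in> D"
    and x: "x \<in> frontier D" "x \<in> U" "dist z x = boundary_dist D z"
  shows "z = x + boundary_dist D z *\<^sub>R (- sgn (g x))"
proof -
  define w where "w = z - x"
  define n where "n = sgn (g x)"
  have U: "open U" "D \<inter> U = {x \<in> U. \<rho> x < 0}" "g x \<noteq> 0" using C x by (auto simp: C1_defining_function_def)
  have "x \<notin> D" using x D by (simp add: frontier_def interior_open)
  then have w: "w \<noteq> 0" "norm w = boundary_dist D z" using z x by (auto simp: w_def dist_norm)
  have \<rho>x: "\<rho> x = 0" using C1_defining_function_frontier[OF C D x(2)] x by blast
  have le: "g x \<bullet> v \<le> 0" if v: "0 < v \<bullet> w" for v
  proof (rule ccontr)
    assume "\<not> g x \<bullet> v \<le> 0"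
    then have "0 < g x \<bullet> v" by simp
    moreover have "((\<lambda>s. \<rho> (x + s *\<^sub>R v)) has_real_derivative (g x \<bullet> v)) (at 0)"
      using C1_defining_function_on_line[OF C, of x 0 v] x by simp
    ultimately obtain d where d: "d > 0" "\<And>h. 0 < h \<Longrightarrow> h < d \<Longrightarrow> 0 < \<rho> (x + h *\<^sub>R v)"
      using DERIV_pos_inc_right[of "\<lambda>s. \<rho> (x + s *\<^sub>R v)" "g x \<bullet> v" 0] \<rho>x by auto
    obtain e where e: "e > 0" "ball x e \<subseteq> U" using U x open_contains_ball by blast
    have v0: "0 < norm v" using v by auto
    have "\<exists>h>0. h < d \<and> h < p \<and> h < q" if "0 < p" "0 < q" for p q
      using that d(1) by (intro exI[of _ "min d (min p q) / 2"]) auto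
    moreover have "0 < e / norm v" "0 < v \<bullet> w / (norm v)\<^sup>2" using e v v0 by auto
    ultimately obtain h where h: "0 < h" "h < d" "h < e / norm v" "h < v \<bullet> w / (norm v)\<^sup>2" by blast
    have "h * norm v < e" using h v0 by (simp add: field_simps)
    then have "x + h *\<^sub>R v \<in> U" using h by (intro subsetD[OF e(2)]) (simp add: dist_norm)
    moreover have "x + h *\<^sub>R v \<in> D"
    proof -
      have "h * (norm v)\<^sup>2 < v \<bullet> w" using h v0 by (simp add: field_simps)
      then have "h * (h * (norm v)\<^sup>2) < h * (2 * (v \<bullet> w))" using h v by (intro mult_strict_left_mono) auto
      moreover have "(norm (h *\<^sub>R v - w))\<^sup>2 = h * (h * (norm v)\<^sup>2) - h * (2 * (v \<bullet> w)) + (norm w)\<^sup>2"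
        unfolding power2_norm_eq_inner by (simp add: inner_diff_left inner_diff_right inner_commute algebra_simps)
      ultimately have "(norm (h *\<^sub>R v - w))\<^sup>2 < (norm w)\<^sup>2" by linarith
      then have "norm (h *\<^sub>R v - w) < norm w" by (rule power2_less_imp_less) simp
      then have "x + h *\<^sub>R v \<in> ball z (boundary_dist D z)"
        using w by (simp add: dist_norm w_def norm_minus_commute algebra_simps)
      then show ?thesis using ball_boundary_dist_subset[OF D z] by blast
    qed
    ultimately have "\<rho> (x + h *\<^sub>R v) < 0" using U by blast
    then show False using d(2)[of h] h by simp
  qed
  have n: "norm n = 1" "norm (sgn w) = 1" using U w by (simp_all add: n_def norm_sgn)
  then have nn: "n \<bullet> n = 1" "sgn w \<bullet> sgn w = 1" by (simp_all add: dot_square_norm)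
  have "n + sgn w = 0"
  proof (rule ccontr)
    assume "n + sgn w \<noteq> 0"
    then have "0 < (n + sgn w) \<bullet> (n + sgn w)" by simp
    moreover have "(n + sgn w) \<bullet> (n + sgn w) = 2 + 2 * (n \<bullet> sgn w)"
      using nn inner_commute[of n "sgn w"] by (simp add: inner_add_left inner_add_right)
    ultimately have pos: "0 < 1 + n \<bullet> sgn w" by simp
    have gx: "g x = norm (g x) *\<^sub>R n" "w = norm w *\<^sub>R sgn w" using U(3) w(1) by (simp_all add: n_def sgn_div_norm)
    have "(n + sgn w) \<bullet> w = norm w * (1 + n \<bullet> sgn w)"
      by (subst gx(2)) (use nn in \<open>simp add: inner_add_left distrib_left\<close>)
    then have "0 < (n + sgn w) \<bullet> w" using pos w(1) by simp
    then have "g x \<bullet> (n + sgn w) \<le> 0" by (rule le)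
    moreover have "g x \<bullet> (n + sgn w) = norm (g x) * (1 + n \<bullet> sgn w)"
      by (subst gx(1)) (use nn in \<open>simp add: inner_add_right distrib_left\<close>)
    ultimately show False using pos U(3) by (simp add: mult_le_0_iff)
  qed
  then have "sgn w = - n" by (simp add: add_eq_0_iff)
  moreover have "w = norm w *\<^sub>R sgn w" using w(1) by (simp add: sgn_div_norm)
  ultimately have "w = boundary_dist D z *\<^sub>R (- n)" using w(2) by simp
  then show ?thesis by (simp add: w_def n_def algebra_simps)
qed

section \<open>Bending a half-plane into a region with a Dini-smooth boundary\<close>

lemma Re_divide_add_ge:
  assumes "0 < Re \<zeta>" "0 < s"
  shows "(cmod \<zeta>)\<^sup>2 / (cmod \<zeta> + s)\<^sup>2 \<le> Re (\<zeta> / (\<zeta> + of_real s))"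
    and "cmod (\<zeta> / (\<zeta> + of_real s)) \<le> 1"
    and "\<zeta> + of_real s \<noteq> 0"
proof -
  show nz: "\<zeta> + of_real s \<noteq> 0"
    using assms by (metis Re_complex_of_real add_pos_pos less_irrefl plus_complex.simps(1) zero_complex.simps(1))
  have eq: "(cmod (\<zeta> + of_real s))\<^sup>2 = (cmod \<zeta>)\<^sup>2 + 2 * s * Re \<zeta> + s\<^sup>2"
    by (simp add: cmod_power2) (simp add: power2_eq_square algebra_simps)
  have pos: "0 < (cmod (\<zeta> + of_real s))\<^sup>2" using nz by simp
  have "Re (\<zeta> / (\<zeta> + of_real s)) = ((cmod \<zeta>)\<^sup>2 + s * Re \<zeta>) / (cmod (\<zeta> + of_real s))\<^sup>2"
    unfolding Re_divide cmod_power2 by (simp add: power2_eq_square algebra_simps)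
  moreover have "(cmod \<zeta>)\<^sup>2 / (cmod \<zeta> + s)\<^sup>2 \<le> (cmod \<zeta>)\<^sup>2 / (cmod (\<zeta> + of_real s))\<^sup>2"
  proof (rule divide_left_mono)
    have "cmod (\<zeta> + of_real s) \<le> cmod \<zeta> + s" using norm_triangle_ineq[of \<zeta> "of_real s"] assms by simp
    then show "(cmod (\<zeta> + of_real s))\<^sup>2 \<le> (cmod \<zeta> + s)\<^sup>2" by (intro power_mono) auto
    have "0 < cmod \<zeta> + s" using assms by (intro add_nonneg_pos) auto
    then show "0 < (cmod \<zeta> + s)\<^sup>2 * (cmod (\<zeta> + of_real s))\<^sup>2"
      using pos by simp
  qed simp
  moreover have "\<dots> \<le> ((cmod \<zeta>)\<^sup>2 + s * Re \<zeta>) / (cmod (\<zeta> + of_real s))\<^sup>2"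
    using assms by (intro divide_right_mono) auto
  ultimately show "(cmod \<zeta>)\<^sup>2 / (cmod \<zeta> + s)\<^sup>2 \<le> Re (\<zeta> / (\<zeta> + of_real s))" by linarith
  have "(cmod \<zeta>)\<^sup>2 \<le> (cmod (\<zeta> + of_real s))\<^sup>2" using assms eq by (simp add: add_nonneg_nonneg)
  then have "cmod \<zeta> \<le> cmod (\<zeta> + of_real s)" by (rule power2_le_imp_le) simp
  then show "cmod (\<zeta> / (\<zeta> + of_real s)) \<le> 1" using nz by (simp add: norm_divide)
qed

text \<open>At scale \<open>s\<close>, the map \<open>\<zeta> \<mapsto> - \<zeta>\<^sup>2 / (\<zeta> + s)\<close> bends the imaginary axis
  into the right half-plane: its real part at \<open>\<i>y\<close> is \<open>y\<^sup>2 s / (y\<^sup>2 + s\<^sup>2)\<close>, of order \<open>s\<close> for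
  \<open>\<bar>y\<bar>\<close> of order \<open>s\<close>. A superposition over dyadic scales, weighted by the modulus of continuity,
  maps the half-plane near \<open>0\<close> into a region with a Dini-smooth boundary, and the Dini condition
  makes the total weight finite, so that the map is comparable to the identity on the real axis.\<close>

definition bend :: "nat set \<Rightarrow> (nat \<Rightarrow> real) \<Rightarrow> complex \<Rightarrow> complex" where
  "bend A m \<zeta> = \<zeta> * (1 - (\<Sum>k\<in>A. of_real (m k) * (\<zeta> / (\<zeta> + of_real ((1/2) ^ k)))))"

lemma bend_properties:
  assumes A: "finite A" "\<And>k. k \<in> A \<Longrightarrow> 0 \<le> m k" "sum m A \<le> 1 / 2" and \<zeta>: "0 < Re \<zeta>"
  shows norm_bend: "cmod (bend A m \<zeta>) \<le> 3 / 2 * cmod \<zeta>"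
    and Re_bend: "j \<in> A \<Longrightarrow>
      Re \<zeta> / 2 + m j * ((1/2) ^ j * ((cmod \<zeta>)\<^sup>2 / (cmod \<zeta> + (1/2) ^ j)\<^sup>2)) \<le> Re (bend A m \<zeta>)"
proof -
  let ?q = "\<lambda>k. \<zeta> / (\<zeta> + of_real ((1/2) ^ k))"
  have s: "0 < (1/2::real) ^ k" for k by simp
  note q = Re_divide_add_ge[OF \<zeta> s]
  have "cmod (\<Sum>k\<in>A. of_real (m k) * ?q k) \<le> (\<Sum>k\<in>A. m k)"
  proof (rule sum_norm_le)
    fix k assume "k \<in> A"
    then show "cmod (of_real (m k) * ?q k) \<le> m k"
      using A(2)[of k] mult_left_mono[OF q(2)[of k], of "m k"] by (simp only: norm_mult norm_of_real) simp
  qed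
  then have "cmod (1 - (\<Sum>k\<in>A. of_real (m k) * ?q k)) \<le> 3 / 2"
    using norm_triangle_ineq4[of 1 "\<Sum>k\<in>A. of_real (m k) * ?q k"] A(3) by simp
  then show "cmod (bend A m \<zeta>) \<le> 3 / 2 * cmod \<zeta>"
    unfolding bend_def norm_mult by (subst mult.commute) (intro mult_right_mono norm_ge_zero)
  assume j: "j \<in> A"
  have "Re (bend A m \<zeta>) = Re \<zeta> - (\<Sum>k\<in>A. m k * Re (\<zeta> * ?q k))"
  proof -
    have "bend A m \<zeta> = \<zeta> - (\<Sum>k\<in>A. of_real (m k) * (\<zeta> * ?q k))"
      unfolding bend_def by (simp add: algebra_simps sum_distrib_left)
    then show ?thesis by (simp add: Re_sum del: times_divide_eq_right times_divide_eq_left)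
  qed
  \<comment> \<open>The identity z * z / (z + s) = z - s * z / (z + s) splits each scale into a
    multiple of \<open>Re \<zeta>\<close>, at most half of which is lost in total, and a nonnegative
    gain; only the gain at scale \<open>j\<close> is kept.\<close>
  also have "\<dots> = Re \<zeta> - (\<Sum>k\<in>A. m k * (Re \<zeta> - (1/2) ^ k * Re (?q k)))"
  proof -
    have "\<zeta> * ?q k = \<zeta> - of_real ((1/2) ^ k) * ?q k" for k
      using q(3)[of k] by (simp add: field_simps)
    then have "Re (\<zeta> * ?q k) = Re \<zeta> - (1/2) ^ k * Re (?q k)" for k
      by (metis minus_complex.simps(1) Re_complex_of_real Im_complex_of_real times_complex.simps(1) mult_zero_left diff_zero)
    then show ?thesis by simp
  qed
  also have "\<dots> = Re \<zeta> * (1 - sum m A) + (\<Sum>k\<in>A. m k * ((1/2) ^ k * Re (?q k)))"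
    by (simp only: right_diff_distrib sum_subtractf sum_distrib_left sum_distrib_right mult_1_right mult.commute[of "m _" "Re \<zeta>"])
  finally have eq: "Re (bend A m \<zeta>) = Re \<zeta> * (1 - sum m A) + (\<Sum>k\<in>A. m k * ((1/2) ^ k * Re (?q k)))" .
  have low: "m k * ((1/2) ^ k * ((cmod \<zeta>)\<^sup>2 / (cmod \<zeta> + (1/2) ^ k)\<^sup>2)) \<le> m k * ((1/2) ^ k * Re (?q k))" if "k \<in> A" for k
    using A(2)[OF that] by (intro mult_left_mono q(1)) auto
  have nonneg: "0 \<le> m k * ((1/2) ^ k * Re (?q k))" if "k \<in> A" for k
    by (rule order_trans[OF _ low[OF that]]) (use A(2)[OF that] in auto)
  have "m j * ((1/2) ^ j * Re (?q j)) \<le> (\<Sum>k\<in>A. m k * ((1/2) ^ k * Re (?q k)))"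
    using nonneg A(1) by (intro member_le_sum[OF j]) auto
  moreover have "Re \<zeta> / 2 \<le> Re \<zeta> * (1 - sum m A)"
    using \<zeta> A(3) mult_left_mono[of "1/2" "1 - sum m A" "Re \<zeta>"] by simp
  ultimately show "Re \<zeta> / 2 + m j * ((1/2) ^ j * ((cmod \<zeta>)\<^sup>2 / (cmod \<zeta> + (1/2) ^ j)\<^sup>2)) \<le> Re (bend A m \<zeta>)"
    using low[OF j] eq by linarith
qed

lemma holomorphic_on_bend: "bend A m holomorphic_on {\<zeta>. 0 < Re \<zeta>}"
proof -
  have "\<zeta> + of_real ((1/2) ^ k) \<noteq> 0" if "0 < Re \<zeta>" for \<zeta> k
    by (rule Re_divide_add_ge(3)[OF that]) simp
  then show ?thesis unfolding bend_def by (intro holomorphic_intros) auto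
qed

lemma bend_real:
  fixes x :: real
  assumes A: "finite A" "\<And>k. k \<in> A \<Longrightarrow> 0 \<le> m k" "sum m A \<le> 1 / 2" and x: "0 < x"
  defines "\<phi> \<equiv> \<lambda>x. x * (1 - (\<Sum>k\<in>A. m k * (x / (x + (1/2) ^ k))))"
  shows "bend A m (of_real x) = of_real (\<phi> x)" "x / 2 \<le> \<phi> x" "\<phi> x \<le> x"
proof -
  show "bend A m (of_real x) = of_real (\<phi> x)" by (simp add: bend_def \<phi>_def)
  have q: "0 \<le> x / (x + (1/2) ^ k)" "x / (x + (1/2) ^ k) \<le> 1" for k
    using x by (simp_all add: divide_le_eq add_pos_pos)
  have 0: "0 \<le> (\<Sum>k\<in>A. m k * (x / (x + (1/2) ^ k)))"
    using A(2) q by (intro sum_nonneg mult_nonneg_nonneg) auto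
  have "(\<Sum>k\<in>A. m k * (x / (x + (1/2) ^ k))) \<le> (\<Sum>k\<in>A. m k)"
    using A(2) q by (intro sum_mono mult_left_le) auto
  then have "1 / 2 \<le> 1 - (\<Sum>k\<in>A. m k * (x / (x + (1/2) ^ k)))" using A(3) by linarith
  then show "x / 2 \<le> \<phi> x" using x mult_left_mono[of "1/2" _ x] unfolding \<phi>_def by fastforce
  show "\<phi> x \<le> x" unfolding \<phi>_def using 0 x by (intro mult_left_le) auto
qed

text \<open>The disc must pass exactly through the point at depth \<open>\<delta>\<close> on the
  normal. On the real axis \<open>bend\<close> lies between x/2 and x, so the intermediate value
  theorem finds a parameter comparable to \<open>\<delta>\<close>.\<close>

lemma bend_real_surj:
  assumes A: "finite A" "\<And>k. k \<in> A \<Longrightarrow> 0 \<le> m k" "sum m A \<le> 1 / 2" and \<delta>: "0 < \<delta>"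
  obtains t where "\<delta> \<le> t" "t \<le> 2 * \<delta>" "bend A m (of_real t) = of_real \<delta>"
proof -
  define \<phi> where "\<phi> = (\<lambda>x. x * (1 - (\<Sum>k\<in>A. m k * (x / (x + (1/2) ^ k)))))"
  have b: "bend A m (of_real x) = of_real (\<phi> x)" "x / 2 \<le> \<phi> x" "\<phi> x \<le> x" if "0 < x" for x
    unfolding \<phi>_def by (rule bend_real[OF A that]; assumption)+
  have nz: "x + (1/2) ^ k \<noteq> 0" if "0 < x" for x :: real and k
    using that by (smt (verit) zero_less_power half_gt_zero)
  have "continuous_on {\<delta>..2 * \<delta>} \<phi>"
    unfolding \<phi>_def by (intro continuous_intros) (use nz \<delta> in auto)
  then obtain t where "\<delta> \<le> t" "t \<le> 2 * \<delta>" "\<phi> t = \<delta>"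
  proof -
    have "\<phi> \<delta> \<le> \<delta>" "\<delta> \<le> \<phi> (2 * \<delta>)" using b(2)[of "2 * \<delta>"] b(3)[of \<delta>] \<delta> by linarith+
    then show thesis using IVT'[of \<phi> \<delta> \<delta> "2 * \<delta>"] \<open>continuous_on _ \<phi>\<close> \<delta> that by (metis less_eq_real_def mult_2 add_increasing)
  qed
  then show thesis using b(1)[of t] \<delta> by (intro that) auto
qed

text \<open>Only the dyadic scale \<open>s\<close> with s/2 <= |zeta| < s is used, and
  \<open>t = 2 * s\<close>. Its gain is at least 12/8 = 3/2 times
  \<open>\<omega> (2 * s) * cmod \<zeta>\<close>, while \<open>cmod w\<close> is at most 3/2 times
  \<open>cmod \<zeta>\<close>: this is the origin of the weight 12. The leftover
  \<open>Re \<zeta> / 2\<close> makes the inequality strict.\<close>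

lemma bend_in_cone:
  fixes \<omega> :: "real \<Rightarrow> real"
  assumes \<omega>: "\<And>k. k0 \<le> k \<Longrightarrow> 0 \<le> \<omega> (2 * (1/2) ^ k)"
    and sum: "(\<Sum>k\<in>{k0..<N}. 12 * \<omega> (2 * (1/2) ^ k)) \<le> 1 / 2"
    and \<zeta>: "0 < Re \<zeta>" "(1/2) ^ N \<le> cmod \<zeta>" "cmod \<zeta> < (1/2) ^ k0"
  defines "w \<equiv> bend {k0..<N} (\<lambda>k. 12 * \<omega> (2 * (1/2) ^ k)) \<zeta>"
  obtains t where "cmod w < t" "\<omega> t * cmod w < Re w"
proof -
  define P where "P = (\<lambda>k. k0 \<le> k \<and> (1/2) ^ Suc k \<le> cmod \<zeta>)"
  have "k0 < N"
  proof (rule ccontr)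
    assume "\<not> k0 < N"
    then have "(1/2::real) ^ k0 \<le> (1/2) ^ N" by (intro power_decreasing) auto
    then show False using \<zeta> by linarith
  qed
  then obtain n where "N = Suc n" "k0 \<le> n" by (cases N) auto
  then have PN: "P (N - 1)" using \<zeta>(2) by (simp add: P_def)
  define k where "k = (LEAST k. P k)"
  have k: "P k" unfolding k_def using PN by (rule LeastI)
  have "k \<le> N - 1" unfolding k_def using PN by (rule Least_le)
  then have kA: "k \<in> {k0..<N}" using k \<open>k0 < N\<close> by (simp add: P_def)
  have less: "cmod \<zeta> < (1/2) ^ k"
  proof (cases "k = k0")
    case False
    then obtain i where i: "k = Suc i" "k0 \<le> i" using k by (cases k) (auto simp: P_def)
    then have "\<not> P i" using not_less_Least[of i P] by (simp add: k_def)
    then show ?thesis using i by (simp add: P_def)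
  qed (use \<zeta> in simp)
  define s where "s = (1/2::real) ^ k"
  have s: "0 < s" "cmod \<zeta> < s" "s / 2 \<le> cmod \<zeta>" using less k by (auto simp: s_def P_def)
  have c0: "0 < cmod \<zeta>" using \<zeta>(1) by auto
  let ?m = "\<lambda>k. 12 * \<omega> (2 * (1/2) ^ k)"
  have m0: "\<And>k. k \<in> {k0..<N} \<Longrightarrow> 0 \<le> ?m k" using \<omega> by simp
  have w: "cmod w \<le> 3 / 2 * cmod \<zeta>"
    unfolding w_def by (rule norm_bend[OF _ m0 sum \<zeta>(1)]) simp
  have "Re \<zeta> / 2 + 12 * \<omega> (2 * s) * (s * ((cmod \<zeta>)\<^sup>2 / (cmod \<zeta> + s)\<^sup>2)) \<le> Re w"
    using Re_bend[OF _ m0 sum \<zeta>(1) kA] unfolding w_def s_def by simp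
  moreover have "cmod \<zeta> / 8 \<le> s * ((cmod \<zeta>)\<^sup>2 / (cmod \<zeta> + s)\<^sup>2)"
  proof -
    have "(cmod \<zeta> + s)\<^sup>2 \<le> (2 * s)\<^sup>2" using s c0 by (intro power_mono) auto
    then have "(cmod \<zeta>)\<^sup>2 / (2 * s)\<^sup>2 \<le> (cmod \<zeta>)\<^sup>2 / (cmod \<zeta> + s)\<^sup>2"
      using s c0 by (intro divide_left_mono mult_pos_pos) (auto simp: add_pos_pos)
    then have "s * ((cmod \<zeta>)\<^sup>2 / (2 * s)\<^sup>2) \<le> s * ((cmod \<zeta>)\<^sup>2 / (cmod \<zeta> + s)\<^sup>2)"
      using s by (intro mult_left_mono) auto
    moreover have "s * ((cmod \<zeta>)\<^sup>2 / (2 * s)\<^sup>2) = cmod \<zeta> * (cmod \<zeta> / (4 * s))"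
      using s by (simp add: power2_eq_square field_simps)
    moreover have "cmod \<zeta> * (1 / 8) \<le> cmod \<zeta> * (cmod \<zeta> / (4 * s))"
      using s c0 by (intro mult_left_mono) (auto simp: field_simps)
    ultimately show ?thesis by linarith
  qed
  then have "12 * \<omega> (2 * s) * (cmod \<zeta> / 8) \<le> 12 * \<omega> (2 * s) * (s * ((cmod \<zeta>)\<^sup>2 / (cmod \<zeta> + s)\<^sup>2))"
    using m0[OF kA] by (intro mult_left_mono) (auto simp: s_def)
  moreover have "\<omega> (2 * s) * cmod w \<le> \<omega> (2 * s) * (3 / 2 * cmod \<zeta>)"
    using m0[OF kA] w by (intro mult_left_mono) (auto simp: s_def)
  ultimately have "\<omega> (2 * s) * cmod w < Re w" using \<zeta>(1) by (simp add: field_simps)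
  moreover have "cmod w < 2 * s" using w s by linarith
  ultimately show thesis using that by blast
qed

text \<open>By monotonicity the integrand on \<open>I j\<close> is at least
  \<open>b j * 2 ^ j\<close>, and \<open>I j\<close> has length \<open>(1/2) ^ Suc j\<close>; so the
  integral dominates half of the sum of the \<open>b j\<close>, whose tails are therefore
  small.\<close>

lemma Dini_imp_small_dyadic_sums:
  fixes \<omega> :: "real \<Rightarrow> real"
  assumes nonneg: "\<And>t. 0 < t \<Longrightarrow> 0 \<le> \<omega> t" and mono: "\<And>s t. 0 < s \<Longrightarrow> s \<le> t \<Longrightarrow> \<omega> s \<le> \<omega> t"
    and Dini: "(\<integral>\<^sup>+ t\<in>{0<..<1}. ennreal (\<omega> t / t) \<partial>lborel) < \<infinity>" and \<epsilon>: "0 < \<epsilon>"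
  obtains k0 where "\<And>N. (\<Sum>k\<in>{k0..<N}. \<omega> (2 * (1/2) ^ k)) \<le> \<epsilon>"
proof -
  define b where "b = (\<lambda>j. \<omega> ((1/2) ^ Suc j))"
  define I where "I = (\<lambda>j. {(1/2::real) ^ Suc j <..< (1/2) ^ j})"
  define X where "X = (\<integral>\<^sup>+ t\<in>{0<..<1}. ennreal (\<omega> t / t) \<partial>lborel)"
  have b0: "0 \<le> b j" for j unfolding b_def by (rule nonneg) simp
  have disj: "i = j" if "t \<in> I i" "t \<in> I j" for i j t
  proof (rule ccontr)
    have *: False if "t \<in> I i" "t \<in> I j" "i < j" for i j
    proof -
      have "(1/2::real) ^ j \<le> (1/2) ^ Suc i" using that(3) by (intro power_decreasing) auto
      then show False using that by (auto simp: I_def)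
    qed
    assume "i \<noteq> j"
    then show False using *[of i j] *[of j i] that by linarith
  qed
  have part: "(\<Sum>j<n. ennreal (b j / 2)) \<le> X" for n
  proof -
    have "(\<Sum>j<n. ennreal (b j / 2)) = (\<Sum>j<n. \<integral>\<^sup>+ t. ennreal (b j * 2 ^ j) * indicator (I j) t \<partial>lborel)"
    proof (rule sum.cong[OF refl])
      fix j
      have "emeasure lborel (I j) = ennreal ((1/2) ^ j - (1/2) ^ Suc j)"
        unfolding I_def by (rule emeasure_lborel_Ioo) simp
      moreover have "b j * 2 ^ j * ((1/2) ^ j - (1/2) ^ Suc j) = b j / 2"
        by (simp add: power_divide field_simps)
      moreover have "(\<integral>\<^sup>+ t. ennreal (b j * 2 ^ j) * indicator (I j) t \<partial>lborel) = ennreal (b j * 2 ^ j) * emeasure lborel (I j)"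
        by (rule nn_integral_cmult_indicator) (simp add: I_def)
      ultimately show "ennreal (b j / 2) = (\<integral>\<^sup>+ t. ennreal (b j * 2 ^ j) * indicator (I j) t \<partial>lborel)"
        using b0[of j] by (simp flip: ennreal_mult'')
    qed
    also have "\<dots> = (\<integral>\<^sup>+ t. (\<Sum>j<n. ennreal (b j * 2 ^ j) * indicator (I j) t) \<partial>lborel)"
      by (rule nn_integral_sum[symmetric]) (simp add: I_def)
    also have "\<dots> \<le> X"
      unfolding X_def
    proof (rule nn_integral_mono)
      fix t :: real
      show "(\<Sum>j<n. ennreal (b j * 2 ^ j) * indicator (I j) t) \<le> ennreal (\<omega> t / t) * indicator {0<..<1} t"
      proof (cases "\<exists>j<n. t \<in> I j")
        case True
        then obtain j where j: "j < n" "t \<in> I j" by blast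
        have "(\<Sum>i<n. ennreal (b i * 2 ^ i) * indicator (I i) t) = (\<Sum>i<n. if i = j then ennreal (b j * 2 ^ j) else 0)"
        proof (rule sum.cong[OF refl])
          fix i
          show "ennreal (b i * 2 ^ i) * indicator (I i) t = (if i = j then ennreal (b j * 2 ^ j) else 0)"
            using j(2) disj[of t i j] by (cases "i = j") (auto simp: indicator_def)
        qed
        also have "\<dots> = ennreal (b j * 2 ^ j)" using j by simp
        also have "\<dots> \<le> ennreal (\<omega> t / t)"
        proof (rule ennreal_leI)
          have t: "(1/2) ^ Suc j < t" "t < (1/2) ^ j" using j by (auto simp: I_def)
          have t0: "0 < t" by (rule less_trans[OF _ t(1)]) simp
          have "b j \<le> \<omega> t" unfolding b_def using t by (intro mono) auto
          moreover have "2 ^ j \<le> 1 / t" using t t0 by (simp add: field_simps power_divide)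
          ultimately have "b j * 2 ^ j \<le> \<omega> t * (1 / t)" using b0[of j] t0 nonneg by (intro mult_mono) auto
          then show "b j * 2 ^ j \<le> \<omega> t / t" by simp
        qed
        also have "\<dots> = ennreal (\<omega> t / t) * indicator {0<..<1} t"
        proof -
          have t: "(1/2) ^ Suc j < t" "t < (1/2) ^ j" using j by (auto simp: I_def)
          have t0: "0 < t" by (rule less_trans[OF _ t(1)]) simp
          have "(1/2::real) ^ j \<le> 1" by (intro power_le_one) auto
          then have "t < 1" using t(2) by linarith
          then show ?thesis using t0 by simp
        qed
        finally show ?thesis .
      next
        case False
        then have "(\<Sum>j<n. ennreal (b j * 2 ^ j) * indicator (I j) t) = 0" by (intro sum.neutral) auto
        then show ?thesis by simp
      qed
    qed
    finally show ?thesis .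
  qed
  have "X < \<infinity>" using Dini by (simp add: X_def)
  then obtain x where x: "X = ennreal x" "0 \<le> x" by (cases X) auto
  have "(\<Sum>j<n. b j / 2) \<le> x" for n
    using part[of n] b0 x by (simp add: sum_nonneg)
  then have "summable (\<lambda>j. b j / 2)"
    using b0 by (intro summableI_nonneg_bounded) auto
  then have "summable b" using summable_mult[of "\<lambda>j. b j / 2" 2] by simp
  then obtain M where M: "\<And>m n. M \<le> m \<Longrightarrow> norm (sum b {m..<n}) < \<epsilon>"
    unfolding summable_Cauchy using \<epsilon> by blast
  show thesis
  proof (rule that)
    fix N
    \<comment> \<open>For \<open>k\<close> at least 2, \<open>2 * (1/2) ^ k\<close> equals
      \<open>(1/2) ^ Suc (k - 2)\<close>, whence the shift by two.\<close>
    have "(\<Sum>k\<in>{M + 2..<N}. \<omega> (2 * (1/2) ^ k)) = (\<Sum>k\<in>{M..<N - 2}. b k)"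
    proof (rule sum.reindex_bij_witness[of _ "\<lambda>k. k + 2" "\<lambda>k. k - 2"])
      fix k assume "k \<in> {M + 2..<N}"
      then have "k = Suc (Suc (k - 2))" by (simp, arith)
      then obtain i where "k = Suc (Suc i)" by blast
      then show "b (k - 2) = \<omega> (2 * (1/2) ^ k)" by (simp add: b_def)
    qed auto
    also have "\<dots> \<le> \<epsilon>" using M[of M "N - 2"] by simp
    finally show "(\<Sum>k\<in>{M + 2..<N}. \<omega> (2 * (1/2) ^ k)) \<le> \<epsilon>" .
  qed
qed

section \<open>The boundary estimate\<close>

lemma inner_smult_self: "n \<bullet> (c *s n) = Re c * (norm n)\<^sup>2"
  by (simp add: inner_eq_Re_herm herm_simps herm_self del: of_real_power)

text \<open>Schwarz' lemma on the discs that \<open>bend\<close> attaches to the boundary point nearest to \<open>z\<close>: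
  a quantitative Hopf lemma.\<close>

lemma boundary_estimate:
  fixes D :: "(complex ^ 'n) set"
  assumes dom: "domain D" and a: "a \<in> D" and dini: "dini_smooth_boundary_point D p"
  obtains c r where "c > 0" "r > 0"
    "\<And>(h :: complex ^ 'n \<Rightarrow> complex ^ 'm) z. holomorphic_map_on h D \<Longrightarrow> h ` D \<subseteq> ball 0 1 \<Longrightarrow>
      h a = 0 \<Longrightarrow> z \<in> D \<Longrightarrow> dist z p < r \<Longrightarrow> c * boundary_dist D z \<le> 1 - norm (h z)"
proof -
  have D: "open D" "connected D" using dom by (auto simp: domain_def)
  obtain U \<rho> g where pU: "p \<in> U" and C: "C1_defining_function D U \<rho> g" and p: "p \<in> frontier D"
    and Dini: "(\<integral>\<^sup>+ t\<in>{0<..<1}.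
            ennreal (modulus_of_continuity (frontier D \<inter> U) (\<lambda>x. - sgn (g x)) t / t) \<partial>lborel) < \<infinity>"
    using dini unfolding dini_smooth_boundary_point_def by blast
  have U: "open U" "continuous_on U g" "\<And>x. x \<in> U \<Longrightarrow> g x \<noteq> 0"
    using C by (auto simp: C1_defining_function_def)
  define n where "n = (\<lambda>x. - sgn (g x))"
  define \<omega> where "\<omega> = modulus_of_continuity (frontier D \<inter> U) n"
  have n_le: "norm (n x) \<le> 1" for x by (simp add: n_def norm_sgn)
  have n1: "norm (n x) = 1" if "x \<in> U" for x using U(3)[OF that] by (simp add: n_def norm_sgn)
  have pS: "p \<in> frontier D \<inter> U" using p pU by simp
  have \<omega>0: "0 \<le> \<omega> t" if "0 < t" for t
    unfolding \<omega>_def using modulus_of_continuity_nonneg[OF n_le pS that] .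
  have \<omega>mono: "\<omega> s \<le> \<omega> t" if "0 < s" "s \<le> t" for s t
    unfolding \<omega>_def using modulus_of_continuity_mono[OF n_le pS that] .
  have "(\<integral>\<^sup>+ t\<in>{0<..<1}. ennreal (\<omega> t / t) \<partial>lborel) < \<infinity>"
    using Dini unfolding \<omega>_def n_def .
  \<comment> \<open>With the weight 12, the bound 1/24 yields the total weight 1/2 that the lemmas
    on \<open>bend\<close> allow.\<close>
  from Dini_imp_small_dyadic_sums[OF \<omega>0 \<omega>mono this, of "1/24"]
  obtain k0 where "\<And>N. (\<Sum>k\<in>{k0..<N}. \<omega> (2 * (1/2) ^ k)) \<le> 1 / 24" by auto
  then have sum: "(\<Sum>k\<in>{k0..<N}. 12 * \<omega> (2 * (1/2) ^ k)) \<le> 1 / 2" for N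
    by (simp flip: sum_distrib_left) (metis mult.commute mult_le_cancel_left_pos numeral_times_numeral times_divide_eq_right)
  obtain e where e: "e > 0" "cball p (2 * e) \<subseteq> U"
  proof -
    obtain e where "e > 0" "cball p e \<subseteq> U" using U(1) pU open_contains_cball by blast
    then show thesis using that[of "e / 2"] by simp
  qed
  \<comment> \<open>The parameter discs lie in \<open>cmod \<zeta> < 2 * R\<close>, below the
    coarsest scale \<open>(1/2) ^ k0\<close>. Their images under \<open>bend\<close> have modulus at
    most \<open>3 * R < e\<close>, so the attached discs stay in \<open>U\<close>.\<close>
  define R where "R = min ((1/2) ^ k0) e / 4"
  have R: "0 < R" "2 * R < (1/2) ^ k0" "3 * R < e" using e by (auto simp: R_def min_def)
  \<comment> \<open>The real inner product of \<open>n x\<close> with \<open>w *s n x\<close> is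
    \<open>Re w\<close>, so the cone condition concerns the number \<open>w\<close> alone, and one
    map \<open>bend\<close> serves all boundary points \<open>x\<close>.\<close>
  have cone: "x + w *s n x \<in> D"
    if x: "x \<in> frontier D" "dist x p \<le> e" and w: "cmod w < t" "\<omega> t * cmod w < Re w" "cmod w \<le> 3 * R" for x w t
  proof (rule inner_cone_subset_domain[OF C D(1) x(1)])
    have xU: "x \<in> U" using x e by (auto simp: dist_commute)
    have nw: "norm (w *s n x) = cmod w" using n1[OF xU] by (simp add: norm_smult)
    then show "norm (w *s n x) < t" using w by simp
    show "x + s *\<^sub>R (w *s n x) \<in> U" if s: "0 \<le> s" "s \<le> 1" for s
    proof -
      have "norm (s *\<^sub>R (w *s n x)) \<le> e"
        using s w(3) R nw mult_mono[of s 1 "cmod w" e] by simp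
      then have "dist p (x + s *\<^sub>R (w *s n x)) \<le> 2 * e"
        using x(2) norm_triangle_ineq4[of "p - x" "s *\<^sub>R (w *s n x)"]
        by (simp add: dist_norm norm_minus_commute algebra_simps)
      then show ?thesis using e(2) by auto
    qed
    show "modulus_of_continuity (frontier D \<inter> U) (\<lambda>x. - sgn (g x)) t * norm (w *s n x) < - sgn (g x) \<bullet> (w *s n x)"
      using w(2) nw n1[OF xU] inner_smult_self[of "n x" w] by (simp add: \<omega>_def n_def)
  qed
  define S where "S = frontier D \<inter> cball p e"
  \<comment> \<open>\<open>bend\<close> sends \<open>R\<close> into [R/2, R], so \<open>K\<close>
    contains the centres of all attached discs, whatever \<open>x\<close> and \<open>N\<close> are;
    this gives one constant \<open>c\<close>.\<close>
  define K where "K = (\<lambda>(x, s). x + s *\<^sub>R n x) ` (S \<times> {R / 2..R})"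
  have "compact S" unfolding S_def by (simp add: compact_Int_closed Int_commute closed_Int_compact)
  have SU: "S \<subseteq> U" using e by (auto simp: S_def)
  have contn: "continuous_on S n"
    unfolding n_def using U(3) SU
    by (intro continuous_on_minus continuous_on_sgn continuous_on_subset[OF U(2) SU]) auto
  have "continuous_on (S \<times> {R / 2..R}) (\<lambda>(x, s). x + s *\<^sub>R n x)"
    unfolding case_prod_unfold
    by (intro continuous_intros continuous_on_compose2[OF contn]) auto
  then have "compact K"
    unfolding K_def using \<open>compact S\<close> by (intro compact_continuous_image compact_Times) auto
  moreover have "K \<subseteq> D"
  proof
    fix y assume "y \<in> K"
    then obtain x s where xs: "x \<in> S" "R / 2 \<le> s" "s \<le> R" "y = x + s *\<^sub>R n x" by (auto simp: K_def)
    define t where "t = 2 * (1/2::real) ^ k0"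
    have "12 * \<omega> t \<le> 1 / 2" using sum[of "Suc k0"] by (simp add: t_def)
    then have "\<omega> t * s < 1 * s" using xs R by (intro mult_strict_right_mono) auto
    then have "x + complex_of_real s *s n x \<in> D"
      using xs R by (intro cone[of x _ t]) (auto simp: S_def t_def dist_commute)
    then show "y \<in> D" using xs by (simp add: scaleR_eq_smult)
  qed
  ultimately obtain c where c: "c > 0"
    "\<And>(h :: complex ^ 'n \<Rightarrow> complex ^ 'm) q. holomorphic_map_on h D \<Longrightarrow> h ` D \<subseteq> ball 0 1 \<Longrightarrow>
      h a = 0 \<Longrightarrow> q \<in> K \<Longrightarrow> c \<le> 1 - norm (h q)"
    using uniform_bound_on_compact[OF D a] by metis
  define r where "r = min (e / 2) (R / 2)"
  show thesis
  proof (rule that[of "c / (16 * R)" r])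
    show "0 < c / (16 * R)" "0 < r" using c R e by (auto simp: r_def)
    fix h :: "complex ^ 'n \<Rightarrow> complex ^ 'm" and z
    assume h: "holomorphic_map_on h D" "h ` D \<subseteq> ball 0 1" "h a = 0" and z: "z \<in> D" "dist z p < r"
    define \<delta> where "\<delta> = boundary_dist D z"
    obtain x where x: "x \<in> frontier D" "infdist z (frontier D) = dist z x"
      using infdist_attains_inf[of "frontier D" z] p by auto
    have \<delta>x: "dist z x = \<delta>" using x by (simp add: \<delta>_def boundary_dist_def)
    have "z \<notin> frontier D" using z D by (simp add: frontier_def interior_open)
    then have "\<delta> > 0" using x \<delta>x by (metis zero_less_dist_iff)
    have "\<delta> \<le> dist z p" unfolding \<delta>_def boundary_dist_def using p by (rule infdist_le)
    then have \<delta>R: "\<delta> < R / 2" using z by (simp add: r_def)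
    have "dist x p \<le> \<delta> + dist z p" using dist_triangle[of x p z] \<delta>x by (simp add: dist_commute)
    then have xp: "dist x p \<le> e" using \<open>\<delta> \<le> dist z p\<close> z by (simp add: r_def)
    then have xS: "x \<in> S" "x \<in> U" using x SU by (auto simp: S_def dist_commute)
    have zx: "z = x + \<delta> *\<^sub>R n x"
      using nearest_boundary_point_normal[OF C D(1) z(1) x(1) xS(2)] \<delta>x by (simp add: \<delta>_def n_def)
    \<comment> \<open>Removing the strip \<open>Re \<zeta> \<le> \<eta>\<close> leaves finitely many
      scales to treat. Their number \<open>N\<close> depends on \<open>z\<close>, but no later bound
      depends on \<open>N\<close>. As \<open>t\<close> is at least \<open>\<delta>\<close>, it keeps
      the distance \<open>\<delta> / 2\<close> from the strip.\<close>
    define \<eta> where "\<eta> = \<delta> / 2"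
    have \<eta>: "0 < \<eta>" "\<eta> < R" using \<open>\<delta> > 0\<close> \<delta>R R by (auto simp: \<eta>_def)
    obtain N where N: "(1/2) ^ N < \<eta>" using real_arch_pow_inv[of \<eta> "1/2"] \<eta> by auto
    define m where "m = (\<lambda>k. 12 * \<omega> (2 * (1/2) ^ k))"
    have m0: "\<And>k. k \<in> {k0..<N} \<Longrightarrow> 0 \<le> m k" using \<omega>0 by (simp add: m_def)
    have sum': "sum m {k0..<N} \<le> 1 / 2" using sum by (simp add: m_def)
    define \<Phi> where "\<Phi> = bend {k0..<N} m"
    obtain t where t: "\<delta> \<le> t" "t \<le> 2 * \<delta>" "\<Phi> (of_real t) = of_real \<delta>"
      unfolding \<Phi>_def by (rule bend_real_surj[OF _ m0 sum' \<open>\<delta> > 0\<close>]) auto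
    define \<gamma> where "\<gamma> = (\<lambda>\<zeta>. x + \<Phi> \<zeta> *s n x)"
    let ?B = "ball (complex_of_real R) (R - \<eta>)"
    have B: "\<eta> < Re \<zeta>" "cmod \<zeta> < 2 * R" if "\<zeta> \<in> ?B" for \<zeta>
    proof -
      have d: "cmod (of_real R - \<zeta>) < R - \<eta>" using that by (simp add: dist_norm)
      then show "\<eta> < Re \<zeta>" using abs_Re_le_cmod[of "of_real R - \<zeta>"] by simp
      show "cmod \<zeta> < 2 * R"
        using norm_triangle_ineq4[of "of_real R" "of_real R - \<zeta>"] d R \<eta> by simp
    qed
    have \<gamma>D: "\<gamma> \<zeta> \<in> D" if "\<zeta> \<in> ?B" for \<zeta>
    proof -
      have Re0: "0 < Re \<zeta>" using B[OF that] \<eta> by simp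
      have ge: "(1/2) ^ N \<le> cmod \<zeta>" using B[OF that] N complex_Re_le_cmod[of \<zeta>] by simp
      have lt: "cmod \<zeta> < (1/2) ^ k0" using B[OF that] R by simp
      obtain t where "cmod (\<Phi> \<zeta>) < t" "\<omega> t * cmod (\<Phi> \<zeta>) < Re (\<Phi> \<zeta>)"
        unfolding \<Phi>_def m_def by (rule bend_in_cone[where \<omega> = \<omega>, OF _ sum Re0 ge lt]) (use \<omega>0 in auto)
      moreover have "cmod (\<Phi> \<zeta>) \<le> 3 * R"
        using norm_bend[OF _ m0 sum' Re0] B[OF that] unfolding \<Phi>_def by fastforce
      ultimately show ?thesis unfolding \<gamma>_def using x(1) xp by (intro cone)
    qed
    have hol\<gamma>: "(\<lambda>\<zeta>. \<gamma> \<zeta> $ i) holomorphic_on ?B" for i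
      unfolding \<gamma>_def \<Phi>_def
      using B \<eta> by (auto intro!: holomorphic_intros holomorphic_on_subset[OF holomorphic_on_bend] intro: less_trans)
    have "t \<le> R" using t \<delta>R by simp
    have tB: "complex_of_real t \<in> ?B"
    proof -
      have "cmod (of_real R - of_real t) = R - t"
        using \<open>t \<le> R\<close> by (metis abs_of_nonneg diff_ge_0_iff_ge norm_of_real of_real_diff)
      then show ?thesis using t \<open>\<delta> > 0\<close> by (simp add: dist_norm \<eta>_def)
    qed
    have "\<gamma> (of_real R) \<in> K"
    proof -
      obtain s where "\<Phi> (of_real R) = of_real s" "R / 2 \<le> s" "s \<le> R"
        using bend_real[OF _ m0 sum' R(1)] unfolding \<Phi>_def by blast
      then show ?thesis using xS unfolding K_def \<gamma>_def
        by (intro image_eqI[of _ _ "(x, s)"]) (auto simp: scaleR_eq_smult)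
    qed
    then have ch: "c \<le> 1 - norm (h (\<gamma> (of_real R)))" using c(2) h by blast
    have "(1 - norm (h (\<gamma> (of_real R)))) * (1 - cmod (of_real t - of_real R) / (R - \<eta>)) / 8 \<le> 1 - norm (h (\<gamma> (of_real t)))"
      by (rule Harnack_curve[OF h(1,2) hol\<gamma> _ tB]) (use \<gamma>D in auto)
    moreover have "\<gamma> (of_real t) = z" using zx t(3) by (simp add: \<gamma>_def scaleR_eq_smult)
    \<comment> \<open>With the 1/8 of \<open>Harnack_curve\<close> this gives the final constant
      \<open>c / (16 * R)\<close>.\<close>
    moreover have "\<delta> / (2 * R) \<le> 1 - cmod (of_real t - of_real R) / (R - \<eta>)"
    proof -
      have "cmod (of_real t - of_real R) = R - t"
        using \<open>t \<le> R\<close> by (metis abs_of_nonneg diff_ge_0_iff_ge norm_minus_commute norm_of_real of_real_diff)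
      then have "1 - cmod (of_real t - of_real R) / (R - \<eta>) = (t - \<eta>) / (R - \<eta>)"
        using \<eta> by (simp add: field_simps)
      moreover have "\<delta> / 2 / R \<le> (t - \<eta>) / (R - \<eta>)"
        using \<eta> t \<open>\<delta> > 0\<close> by (intro frac_le) (auto simp: \<eta>_def)
      ultimately show ?thesis by simp
    qed
    then have "c * (\<delta> / (2 * R)) \<le> (1 - norm (h (\<gamma> (of_real R)))) * (1 - cmod (of_real t - of_real R) / (R - \<eta>))"
      using ch c(1) R \<open>\<delta> > 0\<close> by (intro mult_mono) auto
    ultimately show "c / (16 * R) * boundary_dist D z \<le> 1 - norm (h z)"
      by (simp add: \<delta>_def)
  qed
qed

section \<open>The squeezing function\<close>

lemma squeezing_embedding:
  fixes D :: "(complex ^ 'n) set"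
  assumes D: "open D" and z: "z \<in> D" and s: "0 \<le> s" "s < squeezing D z"
  obtains f :: "complex ^ 'n \<Rightarrow> complex ^ 'n" where "holomorphic_map_on f D" "f ` D \<subseteq> ball 0 1"
    "f z = 0" "inj_on f D" "ball 0 s \<subseteq> f ` D"
proof -
  define X where "X = {r. 0 < r \<and> (\<exists>f :: complex ^ 'n \<Rightarrow> complex ^ 'n.
    holomorphic_map_on f D \<and> f ` D \<subseteq> ball 0 1 \<and> f z = 0 \<and> inj_on f D \<and> ball 0 r \<subseteq> f ` D)}"
  have bd: "\<exists>E. domain E \<and> bounded E \<and> biholomorphic D E"
    using s by (auto simp: squeezing_def split: if_splits)
  then have "squeezing D z = Sup X" by (simp add: squeezing_def X_def)
  \<comment> \<open>The supremum says something about \<open>X\<close> only if \<open>X\<close> is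
    nonempty. A biholomorphism onto a bounded domain is translated to vanish at \<open>z\<close> and
    scaled by \<open>1 / (2 * M)\<close>, since differences of its values are shorter than
    \<open>2 * M\<close>; its image is open and so contains a ball about \<open>0\<close>.\<close>
  have "X \<noteq> {}"
  proof -
    obtain E where E: "bounded E" "biholomorphic D E" using bd by blast
    from E(2) obtain f g where f: "holomorphic_map_on f D" "f ` D \<subseteq> E" "\<forall>z\<in>D. g (f z) = z"
      unfolding biholomorphic_def by (elim exE conjE)
    obtain M where M: "M > 0" "\<And>x. x \<in> E \<Longrightarrow> norm x < M"
      using E(1) unfolding bounded_pos_less by blast
    define k where "k = complex_of_real (1 / (2 * M))"
    define f1 where "f1 = (\<lambda>y. k *s f y + (- (k *s f z)))"
    have hol: "holomorphic_map_on f1 D"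
      unfolding f1_def by (rule holomorphic_map_on_compose[OF f(1) holomorphic_map_on_affine[of _ _ UNIV]]) simp
    have k: "k \<noteq> 0" "cmod k = 1 / (2 * M)" using M by (auto simp: k_def norm_divide)
    have f1: "f1 y = k *s (f y - f z)" for y by (simp add: f1_def vector_ssub_ldistrib)
    have inj: "inj_on f1 D"
    proof (rule inj_onI)
      fix x y assume xy: "x \<in> D" "y \<in> D" "f1 x = f1 y"
      then have "f x = f y" using k(1) by (simp add: f1 vec_eq_iff)
      then show "x = y" using f(3) xy by metis
    qed
    have "open (f1 ` D)" by (rule injective_holomorphic_map_inverse(1)[OF hol D inj])
    moreover have "f1 z = 0" by (simp add: f1_def)
    then have "0 \<in> f1 ` D" using z by (metis imageI)
    ultimately obtain r where r: "r > 0" "ball 0 r \<subseteq> f1 ` D" using open_contains_ball by metis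
    have "f1 ` D \<subseteq> ball 0 1"
    proof clarify
      fix y assume y: "y \<in> D"
      have "norm (f y - f z) < 2 * M"
        using norm_triangle_ineq4[of "f y" "f z"] M(2)[of "f y"] M(2)[of "f z"] f(2) y z by fastforce
      then have "norm (f1 y) < 1" using M(1) by (simp only: f1 norm_smult k) (simp add: field_simps)
      then show "f1 y \<in> ball 0 1" by simp
    qed
    then have "r \<in> X" using r hol inj \<open>f1 z = 0\<close> unfolding X_def by blast
    then show ?thesis by blast
  qed
  then obtain r where "r \<in> X" "s < r"
    using less_cSupE[of s X] s(2) \<open>squeezing D z = Sup X\<close> by auto
  moreover have "ball 0 s \<subseteq> ball (0 :: complex ^ 'n) r" using \<open>s < r\<close> by auto
  ultimately show thesis using that unfolding X_def by blast
qed

text \<open>Composing an embedding centred at a point \<open>z\<close> near the boundary with a ball automorphism moves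
  the centre to \<open>a\<close>. By the boundary estimate the image of \<open>a\<close> has distance at least of order
  \<open>boundary_dist D z\<close> from the sphere, whereas the image misses only points at distance
  \<open>o(boundary_dist D z)\<close>.\<close>

lemma large_embeddings_centred_at:
  fixes D :: "(complex ^ 'n) set" and p :: "complex ^ 'n"
  assumes dom: "domain D" and dini: "dini_smooth_boundary_point D p"
    and lim: "Liminf (at p within D) (\<lambda>z. ereal ((1 - squeezing D z) / boundary_dist D z)) = 0"
    and a: "a \<in> D" and q: "0 \<le> q" "q < 1"
  obtains F :: "complex ^ 'n \<Rightarrow> complex ^ 'n" where "holomorphic_map_on F D" "F ` D \<subseteq> ball 0 1"
    "F a = 0" "inj_on F D" "ball 0 q \<subseteq> F ` D"
proof -
  have D: "open D" using dom by (simp add: domain_def)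
  obtain c r where c: "c > 0" "r > 0"
    "\<And>(h :: complex ^ 'n \<Rightarrow> complex ^ 'n) z. holomorphic_map_on h D \<Longrightarrow> h ` D \<subseteq> ball 0 1 \<Longrightarrow>
      h a = 0 \<Longrightarrow> z \<in> D \<Longrightarrow> dist z p < r \<Longrightarrow> c * boundary_dist D z \<le> 1 - norm (h z)"
    using boundary_estimate[OF dom a dini] by blast
  have q2: "0 < 1 - q\<^sup>2" using q by (simp add: power_less_one_iff abs_square_less_1)
  \<comment> \<open>The 8 matches \<open>ball_aut_image_bound\<close>: \<open>1 - s\<^sup>2\<close>
    is at most \<open>2 * \<epsilon> * \<delta>\<close>, and a quarter of
    \<open>c * \<delta> * (1 - q\<^sup>2)\<close> is wanted. The minimum with 1 keeps
    \<open>s\<close> nonnegative.\<close>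
  define \<epsilon> where "\<epsilon> = min 1 (c * (1 - q\<^sup>2) / 8)"
  have \<epsilon>: "0 < \<epsilon>" "\<epsilon> \<le> 1" "\<epsilon> \<le> c * (1 - q\<^sup>2) / 8" using c(1) q2 by (auto simp: \<epsilon>_def)
  have "\<not> (\<forall>\<^sub>F z in at p within D. ereal \<epsilon> \<le> ereal ((1 - squeezing D z) / boundary_dist D z))"
  proof
    assume "\<forall>\<^sub>F z in at p within D. ereal \<epsilon> \<le> ereal ((1 - squeezing D z) / boundary_dist D z)"
    from Liminf_bounded[OF this] show False using lim \<epsilon>(1) by simp
  qed
  then obtain z where z: "z \<in> D" "dist z p < min r 1" and less: "(1 - squeezing D z) / boundary_dist D z < \<epsilon>"
    unfolding eventually_at using c(2) by (metis ereal_less_eq(3) linorder_not_le min_less_iff_conj zero_less_one)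
  define \<delta> where "\<delta> = boundary_dist D z"
  have pf: "p \<in> frontier D" using dini by (simp add: dini_smooth_boundary_point_def)
  have "z \<notin> frontier D" using z D by (simp add: frontier_def interior_open)
  then have \<delta>: "0 < \<delta>" unfolding \<delta>_def boundary_dist_def
    using pf by (metis empty_iff frontier_closed infdist_pos_not_in_closed)
  have "\<delta> \<le> dist z p" unfolding \<delta>_def boundary_dist_def using pf by (rule infdist_le)
  then have "\<delta> < 1" using z by simp
  define s where "s = 1 - \<epsilon> * \<delta>"
  have "\<epsilon> * \<delta> \<le> 1" using \<epsilon> \<delta> \<open>\<delta> < 1\<close> by (intro mult_le_one) auto
  then have s: "0 \<le> s" by (simp add: s_def)
  have "s < squeezing D z" using less \<delta> by (simp add: s_def field_simps flip: \<delta>_def)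
  from squeezing_embedding[OF D z(1) s this]
  obtain f :: "complex ^ 'n \<Rightarrow> complex ^ 'n" where f: "holomorphic_map_on f D" "f ` D \<subseteq> ball 0 1"
    "f z = 0" "inj_on f D" "ball 0 s \<subseteq> f ` D" .
  define b where "b = f a"
  have b: "norm b < 1" using f(2) a by (auto simp: b_def)
  have f1: "norm (f y) < 1" if "y \<in> D" for y using f(2) that by auto
  define F where "F = (\<lambda>y. ball_aut b (f y))"
  have F: "holomorphic_map_on F D" "F ` D \<subseteq> ball 0 1" "F a = 0"
    using holomorphic_map_on_compose[OF f(1) holomorphic_map_on_ball_aut[OF b] f(2)]
      ball_aut_in_ball[OF b f1] ball_aut_self[OF b] by (auto simp: F_def b_def)
  \<comment> \<open>The automorphism exchanges \<open>0 = f z\<close> and \<open>b = f a\<close>.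
    Thus \<open>F\<close> is admissible in the boundary estimate, and its value at \<open>z\<close>
    is the very point whose distance from the sphere is wanted.\<close>
  have "F z = b" by (simp add: F_def f(3) ball_aut_zero)
  then have cb: "c * \<delta> \<le> 1 - norm b" using c(3)[OF F z(1)] z(2) by (simp add: \<delta>_def)
  have inv: "ball_aut b (F y) = f y" if "y \<in> D" for y
    unfolding F_def by (rule ball_aut_involution[OF b f1[OF that]])
  have "inj_on F D" using f(4) inv by (metis inj_on_def)
  moreover have "ball 0 q \<subseteq> F ` D"
  proof
    fix u :: "complex ^ 'n" assume "u \<in> ball 0 q"
    then have u: "norm u < q" by simp
    have "1 - s\<^sup>2 \<le> 2 * (\<epsilon> * \<delta>)" by (simp add: s_def power2_diff)
    also have "\<dots> \<le> 2 * (c * (1 - q\<^sup>2) / 8 * \<delta>)" using \<epsilon> \<delta> by (intro mult_left_mono mult_right_mono) auto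
    also have "\<dots> = c * \<delta> * (1 - q\<^sup>2) / 4" by simp
    also have "\<dots> \<le> (1 - (norm b)\<^sup>2) * (1 - q\<^sup>2) / 4"
    proof -
      have "(norm b)\<^sup>2 \<le> norm b" using b by (simp add: power2_eq_square mult_left_le)
      then show ?thesis using cb q2 by (intro divide_right_mono mult_right_mono) auto
    qed
    finally have "norm (ball_aut b u) < s" using q by (intro ball_aut_image_bound[OF b u _ s]) auto
    then have "ball_aut b u \<in> f ` D" using f(5) by auto
    then obtain y where y: "y \<in> D" "f y = ball_aut b u" by auto
    then have "F y = u" using ball_aut_involution[OF b, of u] u q by (simp add: F_def)
    then show "u \<in> F ` D" using y by blast
  qed
  ultimately show thesis using that F by blast
qed

theorem proposition8:
  fixes D :: "(complex ^ 'n) set" and p\<^sub>0 :: "complex ^ 'n"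
  assumes "domain D"
    and "dini_smooth_boundary_point D p\<^sub>0"
    and "Liminf (at p\<^sub>0 within D) (\<lambda>z. ereal ((1 - squeezing D z) / boundary_dist D z)) = 0"
  shows "biholomorphic D (ball 0 1)"
proof -
  obtain a where a: "a \<in> D" using assms(1) by (auto simp: domain_def)
  define r where "r = (\<lambda>j. 1 - 1 / real (Suc j))"
  have "\<forall>j. \<exists>F :: complex ^ 'n \<Rightarrow> complex ^ 'n. holomorphic_map_on F D \<and> F ` D \<subseteq> ball 0 1 \<and> F a = 0 \<and>
      inj_on F D \<and> ball 0 (r j) \<subseteq> F ` D"
  proof
    fix j
    have "0 \<le> r j" "r j < 1" by (simp_all add: r_def)
    from large_embeddings_centred_at[OF assms a this]
    obtain F :: "complex ^ 'n \<Rightarrow> complex ^ 'n" where F: "holomorphic_map_on F D" "F ` D \<subseteq> ball 0 1"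
      "F a = 0" "inj_on F D" "ball 0 (r j) \<subseteq> F ` D" .
    show "\<exists>F :: complex ^ 'n \<Rightarrow> complex ^ 'n. holomorphic_map_on F D \<and> F ` D \<subseteq> ball 0 1 \<and> F a = 0 \<and>
      inj_on F D \<and> ball 0 (r j) \<subseteq> F ` D" using F by (intro exI[of _ F] conjI)
  qed
  from choice[OF this] obtain F :: "nat \<Rightarrow> complex ^ 'n \<Rightarrow> complex ^ 'n"
    where F: "\<forall>j. holomorphic_map_on (F j) D \<and> F j ` D \<subseteq> ball 0 1 \<and> F j a = 0 \<and>
      inj_on (F j) D \<and> ball 0 (r j) \<subseteq> F j ` D" by (rule exE)
  have "r \<longlonglongrightarrow> 1"
    unfolding r_def using tendsto_diff[OF tendsto_const LIMSEQ_inverse_real_of_nat, of 1]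
    by (simp add: inverse_eq_divide)
  then show ?thesis
  proof (rule biholomorphic_ball_if_images_exhaust[where F = F, rotated -1])
    show "open D" "connected D" using assms(1) by (simp_all add: domain_def)
    show "holomorphic_map_on (F j) D" "F j ` D \<subseteq> ball 0 1" "F j a = 0" "inj_on (F j) D" "ball 0 (r j) \<subseteq> F j ` D" for j
      using spec[OF F, of j] by blast+
  qed (rule a)
qed

end
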